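(* Let $f$ denote the second-order correlation function of the characteristic polynomial of an unrescaled real sample covariance matrix, and let $b^*:=b-3$. For any $\alpha\in\mathbb{N}$, $\mu,\nu\in\mathbb{R}$, put $n:=N$, $m:=N-\alpha$, and $$ Z_N(\mu,\nu):=\left(16N^2+4(\mu+\nu)N^{4/3}+\mu\nu N^{2/3}\right)^{\alpha/2}\exp\left(-4N-\tfrac12(\mu+\nu)N^{1/3}\right). $$ Then $$ \lim_{N\to\infty}\left(4\,Z_N(2^{4/3}\mu,2^{4/3}\nu)\cdot\frac{f\big(n,m;4N+2^{4/3}\mu N^{1/3},4N+2^{4/3}\nu N^{1/3}\big)}{n!\,m!}\right)=\exp(b^* )\,\widetilde{\mathbb{A}}(\mu,\nu). $$
   Context: Here $\mathbb{N}=\{0,1,2,\dots\}$ and $\alpha$ is fixed as $N\to\infty$ ($N\ge\alpha$). Let $Q$ be a probability distribution on the real line with expectation $0$, variance $1$ and finite fourth moment $b$ (i.e. $b=\int x^4\,dQ(x)<\infty$). For $n\ge m$, let $X=X(n,m)$ be the $n\times m$ random matrix whose entries are i.i.d. real random variables with distribution $Q$, and let $X^T$ be its transpose. The $m\times m$ matrix $X(n,m)^TX(n,m)$ is the unrescaled real sample covariance matrix. For $\mu,\nu\in\mathbb{C}$, $$ f(n,m;\mu,\nu):=\mathbb{E}\big(\det(X(n,m)^TX(n,m)-\mu)\,\det(X(n,m)^TX(n,m)-\nu)\big), $$ where $\mu,\nu$ inside the determinants stand for $\mu I_m,\nu I_m$. With $\mathrm{Ai}$ the Airy function, the ``differentiated''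 Airy kernel is $$ \widetilde{\mathbb{A}}(x,y):=\frac{2\,\mathrm{Ai}(x)\,\mathrm{Ai}'(y)-2\,\mathrm{Ai}'(x)\,\mathrm{Ai}(y)}{(x-y)^3}+\frac{(x+y)\,\mathrm{Ai}(x)\,\mathrm{Ai}(y)-2\,\mathrm{Ai}'(x)\,\mathrm{Ai}'(y)}{(x-y)^2}, $$ understood for $x=y$ as its continuous extension. The base of the power $\alpha/2$ in $Z_N$ is positive for all sufficiently large $N$. *)

theory Defs
  imports
    "HOL-Probability.Probability"
    "Jordan_Normal_Form.Determinant"
begin

(* The outcome space of the random matrix X(n,m) is taken to be the space of its entries with the
   product law, so that X(n,m) is the family of coordinates. A sample omega assigns a real number
   to each index pair (i,j) with i < n and j < m. *)
definition iid_entries :: "real measure \<Rightarrow> nat \<Rightarrow> nat \<Rightarrow> (nat \<times> nat \<Rightarrow> real) measure" where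
  "iid_entries Q n m = PiM ({..<n} \<times> {..<m}) (\<lambda>_. Q)"

definition entries_mat :: "nat \<Rightarrow> nat \<Rightarrow> (nat \<times> nat \<Rightarrow> real) \<Rightarrow> real mat" where
  "entries_mat n m \<omega> = Matrix.mat n m \<omega>"

definition sample_cov :: "nat \<Rightarrow> nat \<Rightarrow> (nat \<times> nat \<Rightarrow> real) \<Rightarrow> real mat" where
  "sample_cov n m \<omega> = transpose_mat (entries_mat n m \<omega>) * entries_mat n m \<omega>"

definition corr2 :: "real measure \<Rightarrow> nat \<Rightarrow> nat \<Rightarrow> complex \<Rightarrow> complex \<Rightarrow> complex" where
  "corr2 Q n m \<mu> \<nu> =
     prob_space.expectation (iid_entries Q n m)
       (\<lambda>\<omega>. Determinant.det (map_mat complex_of_real (sample_cov n m \<omega>) - \<mu> \<cdot>\<^sub>m 1\<^sub>m m)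
          * Determinant.det (map_mat complex_of_real (sample_cov n m \<omega>) - \<nu> \<cdot>\<^sub>m 1\<^sub>m m))"

(* The defining integral converges only conditionally, hence the limit of the integrals over
   {0..T}. *)
definition Airy_Ai :: "real \<Rightarrow> real" where
  "Airy_Ai x = 1 / pi * Lim at_top (\<lambda>T. integral {0..T} (\<lambda>t. cos (t ^ 3 / 3 + x * t)))"

definition airy_kernel_off_diag :: "real \<Rightarrow> real \<Rightarrow> real" where
  "airy_kernel_off_diag x y =
     (2 * Airy_Ai x * deriv Airy_Ai y - 2 * deriv Airy_Ai x * Airy_Ai y) / (x - y) ^ 3
     + ((x + y) * Airy_Ai x * Airy_Ai y - 2 * deriv Airy_Ai x * deriv Airy_Ai y) / (x - y) ^ 2"

(* On the diagonal, the limit along all points of the plane off the diagonal. *)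
definition diff_airy_kernel :: "real \<Rightarrow> real \<Rightarrow> real" where
  "diff_airy_kernel x y =
     (if x \<noteq> y then airy_kernel_off_diag x y
      else Lim (at (x, y) within {p. fst p \<noteq> snd p}) (\<lambda>p. airy_kernel_off_diag (fst p) (snd p)))"

definition Z_factor :: "nat \<Rightarrow> nat \<Rightarrow> real \<Rightarrow> real \<Rightarrow> real" where
  "Z_factor \<alpha> N \<mu> \<nu> =
     (16 * real N ^ 2 + 4 * (\<mu> + \<nu>) * real N powr (4 / 3) + \<mu> * \<nu> * real N powr (2 / 3))
       powr (real \<alpha> / 2)
     * exp (- 4 * real N - 1 / 2 * (\<mu> + \<nu>) * real N powr (1 / 3))"

end

theory Submission
  imports Defs "Jordan_Normal_Form.Char_Poly" "HOL-Complex_Analysis.Complex_Analysis" "HOL-Real_Asymp.Real_Asymp"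
begin

text \<open>Adding a row \<open>y\<close> to the matrix is a rank-one update of the covariance matrix \<open>S\<close>, under which the determinant changes by
  a quadratic form in \<open>y\<close> with matrix \<open>adj (S - \<mu>)\<close>. Averaging over \<open>y\<close> needs only the first four moments, and the
  identity \<open>(\<mu> - \<nu>) A(\<mu>) A(\<nu>) = p(\<mu>) A(\<nu>) - p(\<nu>) A(\<mu>)\<close> (up to sign) for the adjugates, together with
  \<open>tr A = p'\<close>, turns the result into a recurrence: \<open>f(n+1, m)\<close> equals
  \<open>(1 - \<partial>\<^sub>\<mu>) (1 - \<partial>\<^sub>\<nu>) + 2 (\<partial>\<^sub>\<nu> - \<partial>\<^sub>\<mu>) / (\<mu> - \<nu>)\<close> applied to \<open>f(n, m)\<close>, plus \<open>(b - 3) m f(n, m-1)\<close>.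
  By the Christoffel-Darboux formula it is solved by \<open>n! m!\<close> times
  \<open>\<Sum>\<^sub>d c\<^sub>d (m-d)! / (n-d)! L\<^sub>m\<^sub>-\<^sub>d(\<mu>) L\<^sub>m\<^sub>-\<^sub>d(\<nu>)\<close>, where the \<open>c\<^sub>d\<close> are the coefficients of \<open>exp ((b - 3) w) / (1 - w)\<^sup>2\<close>,
  so that \<open>c\<^sub>d \<sim> d exp (b - 3)\<close>.

  The Laguerre polynomials are integrals over a circle of radius \<open>exp (- h)\<close> with \<open>h = (4 / N) powr (1 / 3)\<close>, close to a
  double saddle point at \<open>- 1\<close>. On this circle the integrand is dominated uniformly in \<open>d\<close> by
  \<open>exp (- h d)\<close> times a Gaussian, so the sum over \<open>d\<close> is a Riemann sum of mesh \<open>h\<close> to which dominated convergence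
  applies, with limit \<open>exp (b - 3) \<integral> u Ai(\<mu> + u) Ai(\<nu> + u) du\<close> over \<open>u \<ge> 0\<close>. The Airy equation provides an explicit
  antiderivative that identifies this integral with the differentiated kernel.\<close>

section \<open>Laguerre polynomials and the recurrence of the explicit sum\<close>

text \<open>The recurrence starts from \<open>n = 0\<close>, so it passes through matrices with
  fewer rows than columns, although the theorem only needs n - m fixed. Comparing coefficients in it
  forces e c_e = 2 (c_0 + ... + c_(e-1)) + (b - 3) c_(e-1), that is C' = (2 / (1 - w) + b - 3) C,
  which is where exp ((b - 3) w) / (1 - w)^2 comes from. Four moments suffice because each
  characteristic polynomial has degree at most 2 in every single entry.

  The obstacle in the limit is that c_d grows linearly while d ranges up to order N, far beyond the
  region where Airy asymptotics hold, so the Laguerre factors need a bound that decays in d over the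
  whole range. Pulling the circle one mesh unit inside the saddle provides it. In the limit the same
  displacement becomes the height 1 of the Airy contour, where the Airy integral converges
  absolutely. The mesh is fixed by the cubic term of the exponent: for x near 4 N it is - (N / 12)
  v^3, and v = h z turns this into - z^3 / 3 exactly when N h^3 = 4.\<close>

text \<open>\<open>lag k p x\<close> is the generalised Laguerre polynomial of degree \<open>k\<close> with parameter \<open>p - k\<close>; indexing by
  the exponent \<open>p\<close> avoids negative parameters.\<close>

definition lag :: "nat \<Rightarrow> nat \<Rightarrow> real \<Rightarrow> real" where
  "lag k p x = (\<Sum>j\<le>k. real (p choose (k - j)) * (- x) ^ j / fact j)"

text \<open>Both recurrences in \<open>k\<close> and \<open>p\<close> come from this generating
  function: multiplying it by \<open>1 + fps_X\<close> gives \<open>lag_Suc_Suc\<close>,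
  differentiating it in the formal variable gives \<open>lag_Suc_Suc_mult\<close>.\<close>

lemma fps_lag: "fps_nth ((1 + fps_X) ^ p * fps_exp (- x)) k = lag k p x"
proof -
  have "fps_nth ((1 + fps_X) ^ p :: real fps) i = real (p choose i)" for i
    by (simp add: fps_binomial_of_nat[symmetric] binomial_gbinomial fps_binomial_def)
  then have "fps_nth ((1 + fps_X) ^ p * fps_exp (- x)) k
      = (\<Sum>i=0..k. real (p choose i) * ((- x) ^ (k - i) / fact (k - i)))"
    by (simp add: fps_mult_nth)
  also have "\<dots> = (\<Sum>j=0..k. real (p choose (k - j)) * ((- x) ^ j / fact j))"
    by (rule sum.reindex_bij_witness[of _ "\<lambda>j. k - j" "\<lambda>j. k - j"]) auto
  finally show ?thesis by (simp add: lag_def atLeast0AtMost)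
qed

lemma lag_0 [simp]: "lag 0 p x = 1"
  by (simp add: lag_def)

lemma lag_p_0 [simp]: "lag k 0 x = (- x) ^ k / fact k"
  by (simp flip: fps_lag)

lemma lag_Suc_Suc: "lag (Suc k) (Suc p) x = lag (Suc k) p x + lag k p x"
proof -
  have "(1 + fps_X) ^ Suc p * fps_exp (- x) = (1 + fps_X) ^ p * fps_exp (- x) + fps_X * ((1 + fps_X) ^ p * fps_exp (- x))"
    by (simp add: algebra_simps)
  from arg_cong[OF this, of "\<lambda>f. fps_nth f (Suc k)"] show ?thesis
    by (simp only: fps_lag fps_add_nth fps_X_mult_nth) (simp flip: fps_lag)
qed

lemma lag_Suc_Suc_mult: "real (Suc k) * lag (Suc k) (Suc p) x = real (Suc p) * lag k p x - x * lag k (Suc p) x"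
proof -
  have "fps_deriv ((1 + fps_X) ^ Suc p * fps_exp (- x)) =
     fps_const (real (Suc p)) * ((1 + fps_X) ^ p * fps_exp (- x)) - fps_const x * ((1 + fps_X) ^ Suc p * fps_exp (- x))"
    by (simp add: fps_deriv_power algebra_simps del: power_Suc of_nat_Suc flip: fps_const_neg)
  from arg_cong[OF this, of "\<lambda>f. fps_nth f k"] show ?thesis
    by (simp only: fps_lag fps_deriv_nth fps_sub_nth fps_mult_left_const_nth) simp
qed

text \<open>Raising \<open>k\<close> and \<open>p\<close> together keeps the Laguerre parameter
  \<open>p - k\<close> fixed, so this is the classical three-term recurrence of one orthogonal
  family.\<close>

lemma lag_three_term: "real (Suc (Suc k)) * lag (Suc (Suc k)) (Suc (Suc p)) x
    = (real (k + p) + 3 - x) * lag (Suc k) (Suc p) x - real (Suc p) * lag k p x"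
  using lag_Suc_Suc_mult[of "Suc k" "Suc p" x] lag_Suc_Suc_mult[of k p x] lag_Suc_Suc[of k "Suc p" x]
  by (simp add: algebra_simps)

lemma has_field_derivative_lag:
  "((\<lambda>x. lag (Suc k) p x) has_real_derivative - lag k p x) (at x)"
proof -
  have "(\<lambda>x. lag (Suc k) p x) = (\<lambda>x. real (p choose (Suc k)) + (\<Sum>j\<le>k. real (p choose (k - j)) * (- x) ^ Suc j / fact (Suc j)))"
    unfolding lag_def sum.atMost_Suc_shift by simp
  moreover have "((\<lambda>x. real (p choose (Suc k)) + (\<Sum>j\<le>k. real (p choose (k - j)) * (- x) ^ Suc j / fact (Suc j)))
     has_real_derivative 0 + (\<Sum>j\<le>k. - (real (p choose (k - j)) * (- x) ^ j / fact j))) (at x)"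
    apply (intro DERIV_add DERIV_const DERIV_sum)
    apply (rule derivative_eq_intros refl | simp)+
    done
  ultimately show ?thesis by (simp add: lag_def sum_negf)
qed

text \<open>For \<open>p \<ge> k\<close> the factor \<open>fact k / fact p\<close> is the reciprocal
  squared norm of the polynomial for the weight x^(p - k) exp (- x) on the half-line, so sums along
  a fixed \<open>p - k\<close> are Christoffel-Darboux kernels.\<close>

definition lag_kernel :: "nat \<Rightarrow> nat \<Rightarrow> real \<Rightarrow> real \<Rightarrow> real" where
  "lag_kernel k p x y = fact k / fact p * lag k p x * lag k p y"

text \<open>Induction along a fixed \<open>p - k\<close>: the three-term recurrence splits off the
  diagonal term and leaves the same difference one level lower. For \<open>p < k\<close>, a negative
  Laguerre parameter, the descent ends at \<open>p = 0\<close>; there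
  \<open>lag (Suc (Suc k)) 1\<close> is a linear polynomial times the monomial
  \<open>lag (Suc k) 0\<close>, so only the diagonal term is left.\<close>

lemma lag_christoffel_darboux:
  "fact (Suc k) / fact p * (lag k p x * lag (Suc k) (Suc p) y - lag (Suc k) (Suc p) x * lag k p y)
    = (x - y) * (\<Sum>i\<le>min k p. lag_kernel (k - i) (p - i) x y)"
proof (induction k arbitrary: p)
  case 0
  show ?case using lag_Suc_Suc_mult[of 0 p x] lag_Suc_Suc_mult[of 0 p y]
    by (simp add: lag_kernel_def field_simps)
next
  case (Suc k)
  show ?case
  proof (cases p)
    case 0
    have "real (Suc (Suc k)) * lag (Suc (Suc k)) 1 z = lag (Suc k) 0 z - z * (lag (Suc k) 0 z + lag k 0 z)" for z
      using lag_Suc_Suc_mult[of "Suc k" 0 z] lag_Suc_Suc[of k 0 z] by simp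
    moreover have "z * lag k 0 z = - real (Suc k) * lag (Suc k) 0 z" for z
      by (simp add: divide_simps) (simp add: algebra_simps)
    ultimately have *: "real (Suc (Suc k)) * lag (Suc (Suc k)) 1 z = (real (k + 2) - z) * lag (Suc k) 0 z" for z
      by (simp add: algebra_simps del: lag_p_0)
    have "fact (Suc (Suc k)) / fact p * (lag (Suc k) p x * lag (Suc (Suc k)) (Suc p) y - lag (Suc (Suc k)) (Suc p) x * lag (Suc k) p y)
      = fact (Suc k) * (lag (Suc k) 0 x * (real (Suc (Suc k)) * lag (Suc (Suc k)) 1 y) - (real (Suc (Suc k)) * lag (Suc (Suc k)) 1 x) * lag (Suc k) 0 y)"
      unfolding 0 fact_Suc[of "Suc k"] by (simp del: fact_Suc lag_p_0 add: algebra_simps)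
    also have "\<dots> = (x - y) * (fact (Suc k) * lag (Suc k) 0 x * lag (Suc k) 0 y)"
      unfolding * by (simp add: algebra_simps del: lag_p_0)
    finally show ?thesis using 0 by (simp add: lag_kernel_def del: lag_p_0)
  next
    case (Suc q)
    have gen: "s * F / P * (A * B - C * D) = F / P * (A * (s * B) - (s * C) * D)" for s F P A B C D :: real
      by (simp add: algebra_simps add_divide_distrib diff_divide_distrib)
    have "fact (Suc (Suc k)) / fact p * (lag (Suc k) p x * lag (Suc (Suc k)) (Suc p) y - lag (Suc (Suc k)) (Suc p) x * lag (Suc k) p y)
      = fact (Suc k) / fact p * (lag (Suc k) p x * (real (Suc (Suc k)) * lag (Suc (Suc k)) (Suc p) y) - (real (Suc (Suc k)) * lag (Suc (Suc k)) (Suc p) x) * lag (Suc k) p y)"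
      unfolding fact_Suc[of "Suc k"] by (rule gen)
    also have "\<dots> = (x - y) * lag_kernel (Suc k) p x y + fact (Suc k) / fact p * real p * 
      (lag k q x * lag (Suc k) p y - lag (Suc k) p x * lag k q y)"
      unfolding Suc lag_three_term
      by (simp add: algebra_simps lag_kernel_def add_divide_distrib diff_divide_distrib del: of_nat_Suc fact_Suc)
    also have "fact (Suc k) / fact p * real p = (fact (Suc k) / fact q :: real)"
      unfolding Suc by (simp add: divide_simps)
    also have "fact (Suc k) / fact q * (lag k q x * lag (Suc k) p y - lag (Suc k) p x * lag k q y)
      = (x - y) * (\<Sum>i\<le>min k q. lag_kernel (k - i) (q - i) x y)"
      unfolding Suc by (rule Suc.IH)
    also have "(\<Sum>i\<le>min k q. lag_kernel (k - i) (q - i) x y) = (\<Sum>i=1..min (Suc k) p. lag_kernel (Suc k - i) (p - i) x y)"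
      unfolding Suc by (rule sum.reindex_bij_witness[of _ "\<lambda>i. i - 1" Suc]) auto
    also have "(x - y) * lag_kernel (Suc k) p x y + (x - y) * \<dots> = (x - y) * (\<Sum>i\<le>min (Suc k) p. lag_kernel (Suc k - i) (p - i) x y)"
    proof -
      have "{..min (Suc k) p} = insert 0 {1..min (Suc k) p}" by auto
      then show ?thesis by (simp add: distrib_left)
    qed
    finally show ?thesis .
  qed
qed

text \<open>The coefficients of \<open>exp (\<beta> w) / (1 - w)\<^sup>2\<close>; the differential equation of this function gives \<open>binexp_rec\<close>.\<close>

definition binexp :: "real \<Rightarrow> nat \<Rightarrow> real" where
  "binexp \<beta> d = (\<Sum>j\<le>d. \<beta> ^ j / fact j * real (d - j + 1))"

text \<open>Coefficients of w C' = (2 w / (1 - w) + \<beta> w) C. In each term of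
  \<open>real e * binexp \<beta> e\<close> the factor \<open>e\<close> is split as
  \<open>(e - j) + j\<close>: the first part is collected by triangular numbers, the second by
  cancelling \<open>j\<close> against \<open>fact j\<close>.\<close>

lemma binexp_rec:
  "real e * binexp \<beta> e = 2 * (\<Sum>d<e. binexp \<beta> d) + (if e = 0 then 0 else \<beta> * binexp \<beta> (e - 1))"
proof -
  have *: "(\<Sum>i<l. real (i + 1)) * 2 = real l * real (l + 1)" for l
    by (induction l) (auto simp: algebra_simps)
  have "(\<Sum>d<e. binexp \<beta> d) = (\<Sum>d<e. \<Sum>j<e. if j \<le> d then \<beta> ^ j / fact j * real (d - j + 1) else 0)"
    unfolding binexp_def
    by (intro sum.cong refl sum.mono_neutral_cong_left) auto
  also have "\<dots> = (\<Sum>j<e. \<Sum>d<e. if j \<le> d then \<beta> ^ j / fact j * real (d - j + 1) else 0)"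
    by (rule sum.swap)
  also have "\<dots> = (\<Sum>j<e. \<beta> ^ j / fact j * (\<Sum>i<e - j. real (i + 1)))"
  proof (rule sum.cong[OF refl])
    fix j assume j: "j \<in> {..<e}"
    have "(\<Sum>d<e. if j \<le> d then \<beta> ^ j / fact j * real (d - j + 1) else 0)
        = (\<Sum>d\<in>{j..<e}. \<beta> ^ j / fact j * real (d - j + 1))"
      by (rule sum.mono_neutral_cong_right) auto
    also have "\<dots> = (\<Sum>i<e - j. \<beta> ^ j / fact j * real (i + 1))"
      by (rule sum.reindex_bij_witness[of _ "\<lambda>i. i + j" "\<lambda>d. d - j"]) (use j in auto)
    finally show "(\<Sum>d<e. if j \<le> d then \<beta> ^ j / fact j * real (d - j + 1) else 0)
        = \<beta> ^ j / fact j * (\<Sum>i<e - j. real (i + 1))"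
      by (simp only: sum_distrib_left)
  qed
  finally have swap: "(\<Sum>d<e. binexp \<beta> d) = (\<Sum>j<e. \<beta> ^ j / fact j * (\<Sum>i<e - j. real (i + 1)))" .
  have "2 * (\<Sum>d<e. binexp \<beta> d) = (\<Sum>j<e. 2 * (\<beta> ^ j / fact j * (\<Sum>i<e - j. real (i + 1))))"
    unfolding swap by (rule sum_distrib_left)
  also have "\<dots> = (\<Sum>j<e. \<beta> ^ j / fact j * ((\<Sum>i<e - j. real (i + 1)) * 2))"
    by (intro sum.cong refl) simp
  finally have "2 * (\<Sum>d<e. binexp \<beta> d) = (\<Sum>j<e. \<beta> ^ j / fact j * ((\<Sum>i<e - j. real (i + 1)) * 2))" .
  then have 1: "2 * (\<Sum>d<e. binexp \<beta> d) = (\<Sum>j\<le>e. \<beta> ^ j / fact j * (real (e - j) * real (e - j + 1)))"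
    unfolding * lessThan_Suc_atMost[symmetric] sum.lessThan_Suc by simp
  have 2: "(if e = 0 then 0 else \<beta> * binexp \<beta> (e - 1)) = (\<Sum>j\<le>e. \<beta> ^ j / fact j * (real j * real (e - j + 1)))"
  proof (cases e)
    case (Suc e')
    have "\<beta> * binexp \<beta> e' = (\<Sum>j\<le>e'. \<beta> ^ Suc j / fact (Suc j) * (real (Suc j) * real (e' - j + 1)))"
      unfolding binexp_def sum_distrib_left
      by (intro sum.cong refl) (simp add: divide_simps del: of_nat_Suc)
    then show ?thesis unfolding Suc sum.atMost_Suc_shift by simp
  qed simp
  have "real e * binexp \<beta> e = (\<Sum>j\<le>e. \<beta> ^ j / fact j * (real (e - j) * real (e - j + 1)))
      + (\<Sum>j\<le>e. \<beta> ^ j / fact j * (real j * real (e - j + 1)))"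
    unfolding sum.distrib[symmetric] binexp_def sum_distrib_left[of "real e"]
  proof (intro sum.cong refl)
    fix j assume "j \<in> {..e}"
    then have e: "real e = real (e - j) + real j" by simp
    have gen: "(s + t) * (B * u) = B * (s * u) + B * (t * u)" for s t B u :: real
      by (simp add: algebra_simps)
    show "real e * (\<beta> ^ j / fact j * real (e - j + 1)) = \<beta> ^ j / fact j * (real (e - j) * real (e - j + 1))
      + \<beta> ^ j / fact j * (real j * real (e - j + 1))"
      unfolding e by (rule gen)
  qed
  then show ?thesis using 1 2 by linarith
qed

section \<open>The explicit sum and the recurrence it satisfies\<close>

definition corr_sum :: "real \<Rightarrow> nat \<Rightarrow> nat \<Rightarrow> real \<Rightarrow> real \<Rightarrow> real" where
  "corr_sum \<beta> n m x y = (\<Sum>d\<le>min n m. binexp \<beta> d * lag_kernel (m - d) (n - d) x y)"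

definition lag' :: "nat \<Rightarrow> nat \<Rightarrow> real \<Rightarrow> real" where
  "lag' k p x = (if k = 0 then 0 else - lag (k - 1) p x)"

lemma DERIV_lag: "(lag k p has_real_derivative lag' k p x) (at x)"
proof (cases k)
  case 0
  have "lag 0 p = (\<lambda>_. 1)" by (rule ext) simp
  then show ?thesis by (simp add: 0 lag'_def)
next
  case (Suc j)
  then show ?thesis using has_field_derivative_lag[of j p x] by (simp add: lag'_def)
qed

text \<open>Differentiation in \<open>x\<close> multiplies the generating function by minus the
  formal variable, so 1 - d/dx multiplies it by \<open>1 + fps_X\<close> and raises
  \<open>p\<close>. This is how the operator in the recurrence passes from \<open>n\<close> to
  \<open>Suc n\<close>.\<close>

lemma lag_minus_lag': "lag k p x - lag' k p x = lag k (Suc p) x"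
  by (cases k) (auto simp: lag'_def lag_Suc_Suc)

text \<open>As \<open>lag'\<close> is minus the polynomial of one degree less, the Wronskian is a
  Christoffel-Darboux difference after one use of \<open>lag_Suc_Suc\<close>. The factor
  \<open>x - y\<close> gained here cancels the singular denominator of the recurrence.\<close>

lemma lag_wronskian:
  assumes "d \<le> min n m"
  shows "fact (m - d) / fact (n - d) * (lag (m - d) (n - d) x * lag' (m - d) (n - d) y - lag' (m - d) (n - d) x * lag (m - d) (n - d) y)
    = (x - y) * (\<Sum>e\<in>{d<..min m (Suc n)}. lag_kernel (m - e) (Suc n - e) x y)"
proof (cases "m - d")
  case 0
  with assms show ?thesis by (auto simp: lag'_def)
next
  case (Suc k)
  have "(\<Sum>e\<in>{d<..min m (Suc n)}. lag_kernel (m - e) (Suc n - e) x y)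
      = (\<Sum>i\<le>min k (n - d). lag_kernel (k - i) (n - d - i) x y)"
  proof (rule sum.reindex_bij_witness[of _ "\<lambda>i. Suc d + i" "\<lambda>e. e - Suc d"])
    show "lag_kernel (k - (e - Suc d)) (n - d - (e - Suc d)) x y = lag_kernel (m - e) (Suc n - e) x y"
      if "e \<in> {d<..min m (Suc n)}" for e
      using that Suc assms by (intro arg_cong2[of _ _ _ _ "\<lambda>k p. lag_kernel k p x y"]) auto
  qed (use Suc assms in auto)
  moreover have "lag (Suc k) (n - d) x * lag' (Suc k) (n - d) y - lag' (Suc k) (n - d) x * lag (Suc k) (n - d) y
     = - (lag k (n - d) y * lag (Suc k) (Suc (n - d)) x) + lag k (n - d) x * lag (Suc k) (Suc (n - d)) y"
    by (simp add: lag'_def lag_Suc_Suc algebra_simps)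
  ultimately show ?thesis
    unfolding Suc using lag_christoffel_darboux[of k "n - d" x y] by (simp add: mult.commute)
qed

text \<open>All parts of the right-hand side are combinations of the kernels \<open>w e\<close>
  belonging to \<open>Suc n\<close>. Comparing the coefficients of \<open>w e\<close> reduces the
  claim to \<open>Suc n = (Suc n - e) + e\<close> and \<open>binexp_rec\<close>. The factor
  \<open>x - y\<close> is kept so that nothing has to be divided by it.\<close>

lemma corr_sum_rec:
  "(x - y) * (real (Suc n) * corr_sum \<beta> (Suc n) m x y) =
    (x - y) * (\<Sum>d\<le>min n m. binexp \<beta> d * (fact (m - d) / fact (n - d)) *
       ((lag (m - d) (n - d) x - lag' (m - d) (n - d) x) * (lag (m - d) (n - d) y - lag' (m - d) (n - d) y)))
    + 2 * (\<Sum>d\<le>min n m. binexp \<beta> d * (fact (m - d) / fact (n - d)) *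
       (lag (m - d) (n - d) x * lag' (m - d) (n - d) y - lag' (m - d) (n - d) x * lag (m - d) (n - d) y))
    + (x - y) * (\<beta> * (if m = 0 then 0 else corr_sum \<beta> n (m - 1) x y))"
  (is "_ = (x - y) * ?A + 2 * ?B + _")
proof -
  define L where "L = min m (Suc n)"
  define w where "w = (\<lambda>e. lag_kernel (m - e) (Suc n - e) x y)"
  have S1: "?A = (\<Sum>e\<le>L. (real (Suc n) - real e) * binexp \<beta> e * w e)"
  proof (rule sum.mono_neutral_cong_left)
    \<comment> \<open>The only possible extra index is \<open>Suc n\<close>, and its coefficient
      \<open>Suc n - i\<close> vanishes.\<close>
    show "\<forall>i\<in>{..L} - {..min n m}. (real (Suc n) - real i) * binexp \<beta> i * w i = 0"
    proof
      fix i assume "i \<in> {..L} - {..min n m}"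
      then have "i = Suc n" by (auto simp: L_def)
      then show "(real (Suc n) - real i) * binexp \<beta> i * w i = 0" by simp
    qed
    fix d assume d: "d \<in> {..min n m}"
    then have *: "Suc n - d = Suc (n - d)" by auto
    have "real (Suc n) - real d = real (Suc (n - d))" using d by auto
    then have eq: "real (Suc n) - real d = real (Suc (n - d))" .
    have gen: "B * (F / G) * (X * Y) = S * B * (F / (S * G) * X * Y)" if "S \<noteq> 0" for B F G X Y S :: real
      using that by simp
    show "binexp \<beta> d * (fact (m - d) / fact (n - d)) *
       ((lag (m - d) (n - d) x - lag' (m - d) (n - d) x) * (lag (m - d) (n - d) y - lag' (m - d) (n - d) y))
       = (real (Suc n) - real d) * binexp \<beta> d * w d"
      unfolding w_def lag_minus_lag' lag_kernel_def * eq fact_Suc by (rule gen) simp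
  qed (auto simp: L_def)
  have "?B
     = (\<Sum>d\<le>min n m. binexp \<beta> d * ((x - y) * (\<Sum>e\<in>{d<..L}. w e)))"
    unfolding mult.assoc L_def w_def by (intro sum.cong refl arg_cong2[of _ _ _ _ "(*)"] lag_wronskian) auto
  also have "\<dots> = (x - y) * (\<Sum>d\<le>min n m. \<Sum>e\<in>{e. e \<in> {..L} \<and> d < e}. binexp \<beta> d * w e)"
  proof -
    have "{e. e \<in> {..L} \<and> d < e} = {d<..L}" for d by auto
    then show ?thesis by (simp add: sum_distrib_left mult_ac)
  qed
  also have "\<dots> = (x - y) * (\<Sum>e\<le>L. \<Sum>d\<in>{d. d \<in> {..min n m} \<and> d < e}. binexp \<beta> d * w e)"
    by (subst sum.swap_restrict) auto
  also have "\<dots> = (x - y) * (\<Sum>e\<le>L. (\<Sum>d<e. binexp \<beta> d) * w e)"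
    unfolding sum_distrib_right
    by (intro arg_cong2[of _ _ _ _ "(*)"] sum.cong refl) (auto simp: L_def)
  finally have S2: "?B
     = (x - y) * (\<Sum>e\<le>L. (\<Sum>d<e. binexp \<beta> d) * w e)" .
  have S3: "\<beta> * (if m = 0 then 0 else corr_sum \<beta> n (m - 1) x y)
      = (\<Sum>e\<le>L. (if e = 0 then 0 else \<beta> * binexp \<beta> (e - 1)) * w e)"
  proof (cases m)
    case 0
    then show ?thesis by (simp add: L_def)
  next
    case (Suc m')
    have "L = Suc (min n m')" by (simp add: L_def Suc min_def)
    then show ?thesis
      by (simp add: Suc corr_sum_def w_def sum.atMost_Suc_shift sum_distrib_left mult_ac del: sum.atMost_Suc)
  qed
  have "real (Suc n) * corr_sum \<beta> (Suc n) m x y = (\<Sum>e\<le>L. real (Suc n) * binexp \<beta> e * w e)"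
    by (simp add: corr_sum_def L_def w_def sum_distrib_left min.commute mult_ac)
  also have "\<dots> = (\<Sum>e\<le>L. (real (Suc n) - real e) * binexp \<beta> e * w e) + (\<Sum>e\<le>L. (real e * binexp \<beta> e) * w e)"
    by (simp add: sum.distrib[symmetric] algebra_simps)
  also have "(\<Sum>e\<le>L. (real e * binexp \<beta> e) * w e) = 2 * (\<Sum>e\<le>L. (\<Sum>d<e. binexp \<beta> d) * w e)
      + (\<Sum>e\<le>L. (if e = 0 then 0 else \<beta> * binexp \<beta> (e - 1)) * w e)"
    unfolding binexp_rec distrib_right sum.distrib
    by (simp only: sum_distrib_left[of 2 "\<lambda>e. (\<Sum>d<e. binexp \<beta> d) * w e"] mult.assoc)
  finally show ?thesis unfolding S1 S2 S3 by (simp add: algebra_simps)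
qed

lemma corr_sum_0: "corr_sum \<beta> 0 m x y = (x * y) ^ m / fact m"
proof -
  have "(- x) ^ m * (- y) ^ m = (x * y) ^ m" by (simp flip: power_mult_distrib)
  then show ?thesis by (simp add: corr_sum_def lag_kernel_def binexp_def)
qed

section \<open>Rank-one updates of characteristic polynomials\<close>

text \<open>Rank-one determinant formula over an integral domain, since it is applied to a matrix of
  polynomials, where inverses are lacking. The bordered matrix \<open>M\<close> is reduced once by
  column operations and once by row operations scaled with \<open>det A\<close>; equating the two
  evaluations leaves a factor \<open>det A\<close> to cancel, hence the hypothesis
  \<open>nz\<close>.\<close>

lemma det_minus_outer_product:
  fixes A :: "'a :: idom mat" and u :: "nat \<Rightarrow> 'a"
  assumes A: "A \<in> carrier_mat n n" and nz: "Determinant.det A \<noteq> 0"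
  shows "Determinant.det (A - Matrix.mat n n (\<lambda>(i, j). u i * u j))
    = Determinant.det A - (\<Sum>i<n. \<Sum>j<n. u i * u j * adj_mat A $$ (i, j))"
proof -
  let ?det = Determinant.det
  define U where "U = Matrix.mat n 1 (\<lambda>(i, _). u i)"
  define V where "V = Matrix.mat 1 n (\<lambda>(_, j). u j)"
  have U: "U \<in> carrier_mat n 1" and V: "V \<in> carrier_mat 1 n" by (auto simp: U_def V_def)
  have UV: "U * V = Matrix.mat n n (\<lambda>(i, j). u i * u j)"
    by (rule eq_matI) (auto simp: U_def V_def scalar_prod_def)
  have adj: "adj_mat A \<in> carrier_mat n n" "adj_mat A * A = ?det A \<cdot>\<^sub>m 1\<^sub>m n"
    using adj_mat[OF A] by auto
  define q where "q = (\<Sum>i<n. \<Sum>j<n. u i * u j * adj_mat A $$ (i, j))"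
  have VadjU: "V * adj_mat A * U = q \<cdot>\<^sub>m 1\<^sub>m 1"
  proof (rule eq_matI)
    fix i j assume "i < dim_row (q \<cdot>\<^sub>m 1\<^sub>m 1)" "j < dim_col (q \<cdot>\<^sub>m 1\<^sub>m 1)"
    then have "i = 0" "j = 0" by auto
    moreover have "(V * adj_mat A * U) $$ (0, 0) = (\<Sum>j<n. (\<Sum>i<n. u i * adj_mat A $$ (i, j)) * u j)"
      using adj by (auto simp: U_def V_def scalar_prod_def lessThan_atLeast0 intro!: sum.cong)
    moreover have "\<dots> = q"
      unfolding q_def sum_distrib_right by (subst sum.swap) (simp add: mult_ac)
    ultimately show "(V * adj_mat A * U) $$ (i, j) = (q \<cdot>\<^sub>m 1\<^sub>m 1) $$ (i, j)" by simp
  qed (use adj in \<open>auto simp: U_def V_def\<close>)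
  define M where "M = four_block_mat A U V (1\<^sub>m 1)"
  have M: "M \<in> carrier_mat (n + 1) (n + 1)" unfolding M_def using A by (rule four_block_carrier_mat) auto
  have 1: "M * four_block_mat (1\<^sub>m n) (0\<^sub>m n 1) (- V) (1\<^sub>m 1)
      = four_block_mat (A - U * V) U (0\<^sub>m 1 n) (1\<^sub>m 1)"
    unfolding M_def using A U V
    by (subst mult_four_block_mat[OF A U V one_carrier_mat one_carrier_mat _ _ one_carrier_mat])
       (auto intro!: arg_cong4[of _ _ _ _ _ _ _ _ four_block_mat] eq_matI)
  have 2: "four_block_mat (1\<^sub>m n) (0\<^sub>m n 1) (- (V * adj_mat A)) (?det A \<cdot>\<^sub>m 1\<^sub>m 1) * M
      = four_block_mat A U (0\<^sub>m 1 n) ((?det A - q) \<cdot>\<^sub>m 1\<^sub>m 1)"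
  proof -
    have e: "V * adj_mat A * A = ?det A \<cdot>\<^sub>m V"
      using V A adj by (subst assoc_mult_mat[of V 1 n _ n _ n]) (auto simp: mult_smult_distrib[of _ 1 n])
    have "- (V * adj_mat A) * A + (?det A \<cdot>\<^sub>m 1\<^sub>m 1) * V = 0\<^sub>m 1 n"
      using V A adj e by (subst uminus_mult_left_mat) (auto intro!: eq_matI simp: e)
    moreover have "- (V * adj_mat A) * U + (?det A \<cdot>\<^sub>m 1\<^sub>m 1) * (1\<^sub>m 1) = (?det A - q) \<cdot>\<^sub>m 1\<^sub>m 1"
      using V A adj U VadjU by (subst uminus_mult_left_mat) (auto intro!: eq_matI simp: VadjU)
    ultimately show ?thesis
      unfolding M_def using A U V adj
      by (subst mult_four_block_mat[of _ n n _ 1 _ 1 _ _ n _ 1]) (auto intro!: arg_cong4[of _ _ _ _ _ _ _ _ four_block_mat])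
  qed
  have "?det M = ?det (A - U * V)"
  proof -
    have "?det (M * four_block_mat (1\<^sub>m n) (0\<^sub>m n 1) (- V) (1\<^sub>m 1)) = ?det M * ?det (four_block_mat (1\<^sub>m n) (0\<^sub>m n 1) (- V) (1\<^sub>m 1))"
      using M V by (intro det_mult[of _ "n + 1"]) auto
    moreover have "?det (four_block_mat (1\<^sub>m n) (0\<^sub>m n 1) (- V) (1\<^sub>m 1)) = 1"
      using V by (subst det_four_block_mat_upper_right_zero[of _ n _ 1]) auto
    moreover have "?det (four_block_mat (A - U * V) U (0\<^sub>m 1 n) (1\<^sub>m 1)) = ?det (A - U * V)"
      using A U V by (subst det_four_block_mat_lower_left_zero[of _ n _ 1]) auto
    ultimately show ?thesis unfolding 1 by simp
  qed
  moreover have "?det A * ?det M = ?det A * (?det A - q)"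
  proof -
    have "?det (four_block_mat (1\<^sub>m n) (0\<^sub>m n 1) (- (V * adj_mat A)) (?det A \<cdot>\<^sub>m 1\<^sub>m 1) * M)
        = ?det (four_block_mat (1\<^sub>m n) (0\<^sub>m n 1) (- (V * adj_mat A)) (?det A \<cdot>\<^sub>m 1\<^sub>m 1)) * ?det M"
      using M V adj by (intro det_mult[of _ "n + 1"]) auto
    moreover have "?det (four_block_mat (1\<^sub>m n) (0\<^sub>m n 1) (- (V * adj_mat A)) (?det A \<cdot>\<^sub>m 1\<^sub>m 1)) = ?det A"
      using V adj by (subst det_four_block_mat_upper_right_zero[of _ n _ 1]) (auto simp: det_smult)
    moreover have "?det (four_block_mat A U (0\<^sub>m 1 n) ((?det A - q) \<cdot>\<^sub>m 1\<^sub>m 1)) = ?det A * (?det A - q)"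
      using A U V by (subst det_four_block_mat_lower_left_zero[of _ n _ 1]) (auto simp: det_smult)
    ultimately show ?thesis unfolding 2 by simp
  qed
  ultimately show ?thesis using nz by (simp add: UV q_def)
qed

text \<open>Up to the factor \<open>char_poly S\<close> this is an entry of the resolvent (x -
  S)^(-1); as a polynomial it makes sense at the eigenvalues too.\<close>

definition resolvent_adj :: "real mat \<Rightarrow> nat \<Rightarrow> nat \<Rightarrow> real poly" where
  "resolvent_adj S i j = adj_mat (char_poly_matrix S) $$ (i, j)"

lemma char_poly_plus_outer_product:
  assumes S: "S \<in> carrier_mat n n"
  shows "char_poly (S + Matrix.mat n n (\<lambda>(i, j). u i * u j))
    = char_poly S - (\<Sum>i<n. \<Sum>j<n. [:u i * u j:] * resolvent_adj S i j)"
proof -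
  let ?A = "char_poly_matrix S"
  have A: "?A \<in> carrier_mat n n" using S by simp
  have "Determinant.det ?A \<noteq> 0"
    using degree_monic_char_poly[OF S] by (auto simp: char_poly_def)
  from det_minus_outer_product[OF A this, of "\<lambda>i. [:u i:]"]
  have "Determinant.det (?A - Matrix.mat n n (\<lambda>(i, j). [:u i:] * [:u j:])) =
    char_poly S - (\<Sum>i<n. \<Sum>j<n. [:u i * u j:] * resolvent_adj S i j)"
    by (simp add: char_poly_def resolvent_adj_def mult.commute)
  moreover have "?A - Matrix.mat n n (\<lambda>(i, j). [:u i:] * [:u j:])
      = char_poly_matrix (S + Matrix.mat n n (\<lambda>(i, j). u i * u j))"
    using S by (intro eq_matI) (auto simp: char_poly_matrix_def)
  ultimately show ?thesis by (simp add: char_poly_def)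
qed

lemma mat_delete_char_poly_matrix:
  assumes S: "S \<in> carrier_mat n n" and i: "i < n"
  shows "mat_delete (char_poly_matrix S) i i = char_poly_matrix (mat_delete S i i)"
  using S i by (intro eq_matI) (auto simp: mat_delete_def char_poly_matrix_def)

text \<open>For a sample covariance matrix the principal minor belongs to the data with one column
  deleted, so these entries are the source of the term with \<open>m - 1\<close> in the
  recurrence.\<close>

lemma resolvent_adj_diag:
  assumes S: "S \<in> carrier_mat n n" and i: "i < n"
  shows "resolvent_adj S i i = char_poly (mat_delete S i i)"
proof -
  have "char_poly_matrix S \<in> carrier_mat n n" using S by simp
  then have "resolvent_adj S i i = (- 1) ^ (i + i) * Determinant.det (mat_delete (char_poly_matrix S) i i)"
    using i by (simp add: resolvent_adj_def adj_mat_def cofactor_def)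
  then show ?thesis
    unfolding mat_delete_char_poly_matrix[OF S i] by (simp add: char_poly_def flip: mult_2)
qed

lemma trace_resolvent_adj:
  assumes S: "S \<in> carrier_mat n n"
  shows "(\<Sum>i<n. resolvent_adj S i i) = pderiv (char_poly S)"
  unfolding pderiv_char_poly[OF S] by (intro sum.cong refl resolvent_adj_diag[OF S]) auto

lemma resolvent_adj_sym:
  assumes S: "S \<in> carrier_mat n n" and sym: "\<And>i j. i < n \<Longrightarrow> j < n \<Longrightarrow> S $$ (i, j) = S $$ (j, i)"
    and ij: "i < n" "j < n"
  shows "resolvent_adj S i j = resolvent_adj S j i"
proof -
  let ?A = "char_poly_matrix S"
  have A: "?A \<in> carrier_mat n n" using S by simp
  then have dims: "dim_row ?A = n" "dim_col ?A = n" by auto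
  have "mat_delete ?A j i = (mat_delete ?A i j)\<^sup>T"
    using S sym ij
    by (intro eq_matI) (auto simp: mat_delete_def char_poly_matrix_def dims)
  moreover have "mat_delete ?A i j \<in> carrier_mat (n - 1) (n - 1)"
    using A by (auto simp: mat_delete_def)
  ultimately show ?thesis
    using ij by (simp add: resolvent_adj_def adj_mat_def cofactor_def dims Determinant.det_transpose add.commute)
qed

lemma poly_resolvent_adj:
  assumes S: "S \<in> carrier_mat n n" and ik: "i < n" "k < n"
  shows "(\<Sum>j<n. S $$ (i, j) * poly (resolvent_adj S j k) x)
      = x * poly (resolvent_adj S i k) x - (if i = k then poly (char_poly S) x else 0)" (is ?th1)
    and "(\<Sum>j<n. poly (resolvent_adj S i j) x * S $$ (j, k))
      = x * poly (resolvent_adj S i k) x - (if i = k then poly (char_poly S) x else 0)" (is ?th2)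
proof -
  let ?A = "char_poly_matrix S"
  have A: "?A \<in> carrier_mat n n" using S by simp
  then have dims: "dim_row ?A = n" "dim_col ?A = n" by auto
  note adj = adj_mat[OF A]
  have entry: "poly (?A $$ (i, j)) x = (if i = j then x else 0) - S $$ (i, j)" if "i < n" "j < n" for i j
    using that S by (auto simp: char_poly_matrix_def)
  have "(?A * adj_mat ?A) $$ (i, k) = (\<Sum>j<n. ?A $$ (i, j) * resolvent_adj S j k)"
    using ik A adj(1) dims by (auto simp: scalar_prod_def resolvent_adj_def lessThan_atLeast0 intro!: sum.cong)
  moreover have "(?A * adj_mat ?A) $$ (i, k) = (if i = k then char_poly S else 0)"
    unfolding adj(2) using ik by (simp add: char_poly_def)
  ultimately have "(\<Sum>j<n. poly (?A $$ (i, j)) x * poly (resolvent_adj S j k) x) = (if i = k then poly (char_poly S) x else 0)"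
    by (metis (no_types, lifting) poly_0 poly_mult poly_sum sum.cong)
  moreover have "(\<Sum>j<n. poly (?A $$ (i, j)) x * poly (resolvent_adj S j k) x)
      = (\<Sum>j<n. (if i = j then x * poly (resolvent_adj S i k) x else 0) - S $$ (i, j) * poly (resolvent_adj S j k) x)"
    using ik by (intro sum.cong refl) (auto simp: entry algebra_simps)
  ultimately show ?th1 using ik by (simp add: sum_subtractf)
  have "(adj_mat ?A * ?A) $$ (i, k) = (\<Sum>j<n. resolvent_adj S i j * ?A $$ (j, k))"
    using ik A adj(1) dims by (auto simp: scalar_prod_def resolvent_adj_def lessThan_atLeast0 intro!: sum.cong)
  moreover have "(adj_mat ?A * ?A) $$ (i, k) = (if i = k then char_poly S else 0)"
    unfolding adj(3) using ik by (simp add: char_poly_def)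
  ultimately have "(\<Sum>j<n. poly (resolvent_adj S i j) x * poly (?A $$ (j, k)) x) = (if i = k then poly (char_poly S) x else 0)"
    by (metis (no_types, lifting) poly_0 poly_mult poly_sum sum.cong)
  moreover have "(\<Sum>j<n. poly (resolvent_adj S i j) x * poly (?A $$ (j, k)) x)
      = (\<Sum>j<n. (if j = k then x * poly (resolvent_adj S i k) x else 0) - poly (resolvent_adj S i j) x * S $$ (j, k))"
    using ik by (intro sum.cong refl) (auto simp: entry algebra_simps)
  ultimately show ?th2 using ik by (simp add: sum_subtractf)
qed

text \<open>The trace of adj (x - S) S adj (y - S) is computed twice, absorbing S into the left or
  into the right factor by \<open>poly_resolvent_adj\<close>. Equating the results gives the traced
  resolvent identity with both characteristic polynomials cleared, valid at eigenvalues as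
  well.\<close>

lemma resolvent_identity:
  assumes S: "S \<in> carrier_mat n n"
  shows "(x - y) * (\<Sum>i<n. \<Sum>j<n. poly (resolvent_adj S i j) x * poly (resolvent_adj S j i) y)
    = poly (char_poly S) x * poly (pderiv (char_poly S)) y - poly (pderiv (char_poly S)) x * poly (char_poly S) y"
proof -
  define a where "a = (\<lambda>i j x. poly (resolvent_adj S i j) x)"
  define p where "p = (\<lambda>x. poly (char_poly S) x)"
  define T where "T = (\<Sum>i<n. \<Sum>j<n. a i j x * a j i y)"
  have tr: "(\<Sum>i<n. a i i z) = poly (pderiv (char_poly S)) z" for z
    by (simp add: a_def flip: trace_resolvent_adj[OF S] poly_sum)
  have "(\<Sum>i<n. \<Sum>k<n. (\<Sum>j<n. a i j x * S $$ (j, k)) * a k i y) = x * T - p x * (\<Sum>i<n. a i i y)"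
  proof -
    have "(\<Sum>i<n. \<Sum>k<n. (\<Sum>j<n. a i j x * S $$ (j, k)) * a k i y)
       = (\<Sum>i<n. \<Sum>k<n. x * (a i k x * a k i y) - (if i = k then p x * a k i y else 0))"
      unfolding a_def p_def by (intro sum.cong refl, subst poly_resolvent_adj(2)[OF S]) (auto simp: algebra_simps)
    then show ?thesis by (simp add: sum_subtractf T_def sum_distrib_left)
  qed
  moreover have "(\<Sum>i<n. \<Sum>k<n. (\<Sum>j<n. a i j x * S $$ (j, k)) * a k i y)
      = (\<Sum>i<n. \<Sum>j<n. a i j x * (\<Sum>k<n. S $$ (j, k) * a k i y))"
    unfolding sum_distrib_left sum_distrib_right mult.assoc by (intro sum.cong refl sum.swap)
  moreover have "\<dots> = y * T - p y * (\<Sum>i<n. a i i x)"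
  proof -
    have "(\<Sum>i<n. \<Sum>j<n. a i j x * (\<Sum>k<n. S $$ (j, k) * a k i y))
       = (\<Sum>i<n. \<Sum>j<n. y * (a i j x * a j i y) - (if i = j then p y * a i j x else 0))"
      unfolding a_def p_def by (intro sum.cong refl, subst poly_resolvent_adj(1)[OF S]) (auto simp: algebra_simps)
    then show ?thesis by (simp add: sum_subtractf T_def sum_distrib_left)
  qed
  ultimately have "(x - y) * T = p x * (\<Sum>i<n. a i i y) - (\<Sum>i<n. a i i x) * p y"
    by (simp add: algebra_simps)
  then show ?thesis unfolding tr by (simp add: T_def a_def p_def)
qed

section \<open>Moments of the matrix entries\<close>

text \<open>Polynomial functions with a degree bound for each variable separately. Under a product
  law these separate degrees, not the total degree, decide integrability: a product of two functions
  with bound 2 needs fourth moments only.\<close>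

inductive deg_le :: "'i set \<Rightarrow> ('i \<Rightarrow> nat) \<Rightarrow> (('i \<Rightarrow> real) \<Rightarrow> real) \<Rightarrow> bool" for I d where
  monomial: "(\<And>i. i \<in> I \<Longrightarrow> c i \<le> d i) \<Longrightarrow> deg_le I d (\<lambda>w. a * (\<Prod>i\<in>I. w i ^ c i))"
| add: "deg_le I d F \<Longrightarrow> deg_le I d G \<Longrightarrow> deg_le I d (\<lambda>w. F w + G w)"

lemma deg_le_const: "deg_le I d (\<lambda>_. a)"
  using deg_le.monomial[of I "\<lambda>_. 0" d a] by simp

lemma deg_le_var:
  assumes "finite I" "i \<in> I" "1 \<le> d i"
  shows "deg_le I d (\<lambda>w. w i)"
proof -
  have "deg_le I d (\<lambda>w. 1 * (\<Prod>j\<in>I. w j ^ (if j = i then 1 else 0)))"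
    by (rule deg_le.monomial) (use assms in auto)
  moreover have "(\<Prod>j\<in>I. w j ^ (if j = i then 1 else 0)) = w i" for w :: "_ \<Rightarrow> real"
    using assms by (simp add: if_distrib[of "\<lambda>k. _ ^ k"] prod.If_cases cong: if_cong)
  ultimately show ?thesis by simp
qed

lemma deg_le_mono:
  assumes "deg_le I d F" "\<And>i. i \<in> I \<Longrightarrow> d i \<le> e i"
  shows "deg_le I e F"
  using assms(1) by induction (auto intro!: deg_le.intros intro: order_trans assms(2))

lemma deg_le_mult:
  assumes "deg_le I d F" "deg_le I e G"
  shows "deg_le I (\<lambda>i. d i + e i) (\<lambda>w. F w * G w)"
  using assms
proof (induction arbitrary: G)
  case (monomial c a)
  from monomial(2) show ?case
  proof induction
    case (monomial c' a')
    have "deg_le I (\<lambda>i. d i + e i) (\<lambda>w. (a * a') * (\<Prod>i\<in>I. w i ^ (c i + c' i)))"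
      by (rule deg_le.monomial) (intro add_mono \<open>\<And>i. i \<in> I \<Longrightarrow> c i \<le> d i\<close> monomial)
    then show ?case by (simp add: power_add prod.distrib mult_ac)
  qed (auto simp: distrib_left intro: deg_le.add)
qed (auto simp: distrib_right intro: deg_le.add)

lemma deg_le_sum:
  "(\<And>k. k \<in> K \<Longrightarrow> deg_le I d (F k)) \<Longrightarrow> deg_le I d (\<lambda>w. \<Sum>k\<in>K. F k w)"
  by (induction K rule: infinite_finite_induct) (auto intro: deg_le_const deg_le.add)

lemma deg_le_scale: "deg_le I d F \<Longrightarrow> deg_le I d (\<lambda>w. a * F w)"
  using deg_le_mult[OF deg_le_const[of I "\<lambda>_. 0" a]] by simp

definition deg_le_poly :: "'i set \<Rightarrow> ('i \<Rightarrow> nat) \<Rightarrow> (('i \<Rightarrow> real) \<Rightarrow> real poly) \<Rightarrow> bool" where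
  "deg_le_poly I d P \<longleftrightarrow> (\<forall>k. deg_le I d (\<lambda>w. coeff (P w) k))"

lemma deg_le_poly_mult:
  assumes "deg_le_poly I d P" "deg_le_poly I e R"
  shows "deg_le_poly I (\<lambda>i. d i + e i) (\<lambda>w. P w * R w)"
  using assms unfolding deg_le_poly_def coeff_mult
  by (intro allI deg_le_sum deg_le_mult) auto

lemma deg_le_poly_prod:
  assumes "\<And>k. k \<in> K \<Longrightarrow> deg_le_poly I (d k) (P k)"
  shows "deg_le_poly I (\<lambda>i. \<Sum>k\<in>K. d k i) (\<lambda>w. \<Prod>k\<in>K. P k w)"
  using assms
proof (induction K rule: infinite_finite_induct)
  case (insert k K)
  then show ?case by (simp add: deg_le_poly_mult)
qed (auto simp: deg_le_poly_def intro: deg_le_const)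

lemma deg_le_poly_sum:
  "(\<And>k. k \<in> K \<Longrightarrow> deg_le_poly I d (P k)) \<Longrightarrow> deg_le_poly I d (\<lambda>w. \<Sum>k\<in>K. P k w)"
  unfolding deg_le_poly_def coeff_sum by (auto intro!: deg_le_sum)

lemma deg_le_poly_mono:
  assumes "deg_le_poly I d P" "\<And>i. i \<in> I \<Longrightarrow> d i \<le> e i"
  shows "deg_le_poly I e P"
  using assms deg_le_mono unfolding deg_le_poly_def by metis

section \<open>Degrees of the characteristic polynomial in the matrix entries\<close>

lemma sample_cov_carrier [simp]: "sample_cov n m w \<in> carrier_mat m m"
  by (auto simp: sample_cov_def entries_mat_def)

lemma index_sample_cov:
  "i < m \<Longrightarrow> j < m \<Longrightarrow> sample_cov n m w $$ (i, j) = (\<Sum>r<n. w (r, i) * w (r, j))"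
  by (auto simp: sample_cov_def entries_mat_def scalar_prod_def lessThan_atLeast0 intro!: sum.cong)

abbreviation entry_set :: "nat \<Rightarrow> nat \<Rightarrow> (nat \<times> nat) set" where
  "entry_set n m \<equiv> {..<n} \<times> {..<m}"

text \<open>The bound counts how often a column \<open>c\<close> occurs among the indices
  \<open>i\<close> and \<open>j\<close>. In the Leibniz formula every column occurs once as a row
  index and once as a column index, whence the bound 2 for the whole determinant.\<close>

lemma deg_le_poly_char_poly_matrix_entry:
  assumes "i < m" "j < m"
  shows "deg_le_poly (entry_set n m) (\<lambda>(r, c). (if c = i then 1 else 0) + (if c = j then 1 else 0))
     (\<lambda>w. char_poly_matrix (sample_cov n m w) $$ (i, j))"
proof -
  have eq: "char_poly_matrix (sample_cov n m w) $$ (i, j)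
    = [:- (\<Sum>r<n. w (r, i) * w (r, j)), if i = j then 1 else 0:]" for w
    using assms carrier_matD[OF sample_cov_carrier[of n m w]]
    by (auto simp: char_poly_matrix_def index_sample_cov)
  let ?d = "\<lambda>i (r::nat, c::nat). if c = i then 1 else 0 :: nat"
  have "deg_le (entry_set n m) (\<lambda>p. ?d i p + ?d j p) (\<lambda>w. - 1 * (\<Sum>r<n. w (r, i) * w (r, j)))"
    using assms by (intro deg_le_scale deg_le_sum deg_le_mult deg_le_var) auto
  then have "deg_le (entry_set n m) (\<lambda>(r, c). (if c = i then 1 else 0) + (if c = j then 1 else 0)) (\<lambda>w. - (\<Sum>r<n. w (r, i) * w (r, j)))"
    by (simp add: case_prod_beta')
  then show ?thesis
    unfolding eq deg_le_poly_def
  proof (intro allI)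
    fix k
    have "k = 0 \<or> k = 1 \<or> (\<exists>l. k = Suc (Suc l))" by (cases k; cases "k - 1") auto
    with \<open>deg_le _ _ (\<lambda>w. - (\<Sum>r<n. w (r, i) * w (r, j)))\<close>
    show "deg_le (entry_set n m) (\<lambda>(r, c). (if c = i then 1 else 0) + (if c = j then 1 else 0))
      (\<lambda>w. coeff [:- (\<Sum>r<n. w (r, i) * w (r, j)), if i = j then 1 else 0:] k)"
      by (elim disjE exE) (auto intro: deg_le_const)
  qed
qed

lemma deg_le_poly_char_poly_sample_cov:
  "deg_le_poly (entry_set n m) (\<lambda>_. 2) (\<lambda>w. char_poly (sample_cov n m w))"
proof -
  have eq: "char_poly (sample_cov n m w) = (\<Sum>p\<in>{p. p permutes {0..<m}}. signof p * (\<Prod>i = 0..<m. char_poly_matrix (sample_cov n m w) $$ (i, p i)))" for w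
    unfolding char_poly_def by (rule det_def') simp
  have "deg_le_poly (entry_set n m) (\<lambda>_. 2) (\<lambda>w. signof p * (\<Prod>i = 0..<m. char_poly_matrix (sample_cov n m w) $$ (i, p i)))"
    if p: "p permutes {0..<m}" for p
  proof -
    have c: "deg_le_poly (entry_set n m) (\<lambda>_. 0) (\<lambda>_. signof p)"
      by (simp add: deg_le_poly_def deg_le_const)
    have "deg_le_poly (entry_set n m) (\<lambda>q. \<Sum>i=0..<m. case q of (r, c) \<Rightarrow> (if c = i then 1 else 0) + (if c = p i then 1 else 0))
        (\<lambda>w. \<Prod>i = 0..<m. char_poly_matrix (sample_cov n m w) $$ (i, p i))"
      by (rule deg_le_poly_prod, rule deg_le_poly_char_poly_matrix_entry)
         (use permutes_in_image[OF p] in auto)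
    from deg_le_poly_mult[OF c this] show ?thesis
    proof (rule deg_le_poly_mono)
      fix q assume "q \<in> entry_set n m"
      then obtain r c where q: "q = (r, c)" "c < m" by auto
      have "(\<Sum>i=0..<m. (if c = p i then 1 else 0 :: nat)) = (\<Sum>i=0..<m. (if i = Hilbert_Choice.inv p c then 1 else 0))"
        using permutes_inverses[OF p] by (intro sum.cong refl) metis
      also have "\<dots> \<le> 1" by (simp add: sum.delta)
      finally show "0 + (\<Sum>i=0..<m. case q of (r, c) \<Rightarrow> (if c = i then 1 else 0) + (if c = p i then 1 else 0)) \<le> (2 :: nat)"
        by (simp add: q sum.distrib)
    qed
  qed
  then show ?thesis unfolding eq by (intro deg_le_poly_sum) auto
qed

lemma char_poly_sample_cov_Suc:
  "char_poly (sample_cov (Suc n) m w) = char_poly (sample_cov n m w)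
     - (\<Sum>i<m. \<Sum>j<m. [:w (n, i) * w (n, j):] * resolvent_adj (sample_cov n m w) i j)"
proof -
  have "sample_cov (Suc n) m w = sample_cov n m w + Matrix.mat m m (\<lambda>(i, j). w (n, i) * w (n, j))"
    using carrier_matD[OF sample_cov_carrier[of n m w]] carrier_matD[OF sample_cov_carrier[of "Suc n" m w]]
    by (intro eq_matI) (auto simp: index_sample_cov)
  then show ?thesis using char_poly_plus_outer_product[OF sample_cov_carrier[of n m w], of "\<lambda>i. w (n, i)"] by simp
qed

lemma sample_cov_cong:
  assumes "\<And>r c. r < n \<Longrightarrow> c < m \<Longrightarrow> w (r, c) = w' (r, c)"
  shows "sample_cov n m w = sample_cov n m w'"
  using carrier_matD[OF sample_cov_carrier[of n m w]] carrier_matD[OF sample_cov_carrier[of n m w']]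
  by (intro eq_matI) (auto simp: index_sample_cov assms)

lemma mat_delete_sample_cov:
  assumes "i < Suc m"
  shows "mat_delete (sample_cov n (Suc m) w) i i = sample_cov n m (\<lambda>(r, c). w (r, insert_index i c))"
  using assms carrier_matD[OF sample_cov_carrier[of n "Suc m" w]] carrier_matD[OF sample_cov_carrier[of n m "\<lambda>(r, c). w (r, insert_index i c)"]]
  by (intro eq_matI) (auto simp: mat_delete_def index_sample_cov insert_index_def)

section \<open>Integration against the law of the entries\<close>

locale normalized_distribution = real_distribution Q for Q :: "real measure" +
  fixes b :: real
  assumes mean: "expectation (\<lambda>x. x) = 0"
    and second_moment: "expectation (\<lambda>x. x ^ 2) = 1"
    and integrable_4: "integrable Q (\<lambda>x. x ^ 4)"
    and fourth_moment: "expectation (\<lambda>x. x ^ 4) = b"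
begin

lemma integrable_power:
  assumes "k \<le> 4"
  shows "integrable Q (\<lambda>x. x ^ k)"
proof (rule Bochner_Integration.integrable_bound)
  show "integrable Q (\<lambda>x. 1 + x ^ 4)" using integrable_4 by simp
  show "AE x in Q. norm (x ^ k) \<le> norm (1 + x ^ 4)"
  proof (intro AE_I2)
    fix x :: real
    have "\<bar>x\<bar> ^ k \<le> 1 + \<bar>x\<bar> ^ 4"
    proof (cases "\<bar>x\<bar> \<le> 1")
      case True
      then have "\<bar>x\<bar> ^ k \<le> 1" by (simp add: power_le_one)
      then show ?thesis by (smt (verit) zero_le_power abs_ge_zero)
    next
      case False
      then have "\<bar>x\<bar> ^ k \<le> \<bar>x\<bar> ^ 4" using assms by (intro power_increasing) auto
      then show ?thesis by simp
    qed
    then show "norm (x ^ k) \<le> norm (1 + x ^ 4)" by (simp add: power_abs)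
  qed
qed auto

abbreviation entries :: "'i set \<Rightarrow> ('i \<Rightarrow> real) measure" where
  "entries I \<equiv> PiM I (\<lambda>_. Q)"

lemma product_sigma_finite_Q: "product_sigma_finite (\<lambda>_. Q)"
  by (simp add: product_sigma_finite_def sigma_finite_measure_axioms)

lemma prob_space_entries: "prob_space (entries I)"
  by (rule prob_space_PiM) (rule prob_space_axioms)

lemma integrable_deg_le:
  assumes "finite I" "deg_le I d F" "\<And>i. i \<in> I \<Longrightarrow> d i \<le> 4"
  shows "integrable (entries I) F"
  using assms(2)
proof induction
  case (monomial c a)
  interpret product_sigma_finite "\<lambda>_::'a. Q" by (rule product_sigma_finite_Q)
  have "integrable (entries I) (\<lambda>w. \<Prod>i\<in>I. w i ^ c i)"
    by (intro product_integrable_prod assms integrable_power) (meson assms(3) monomial order_trans)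
  then show ?case by simp
qed auto

lemma expectation_monomial:
  assumes "finite I" "\<And>i. i \<in> I \<Longrightarrow> c i \<le> 4"
  shows "(\<integral>w. (\<Prod>i\<in>I. w i ^ c i) \<partial>entries I) = (\<Prod>i\<in>I. expectation (\<lambda>x. x ^ c i))"
proof -
  interpret product_sigma_finite "\<lambda>_::'a. Q" by (rule product_sigma_finite_Q)
  show ?thesis by (intro product_integral_prod assms integrable_power)
qed

lemma expectation_entries_2:
  assumes I: "finite I" "i \<in> I" "j \<in> I"
  shows "(\<integral>w. w i * w j \<partial>entries I) = (if i = j then 1 else 0)"
proof -
  let ?d = "\<lambda>i k. if k = i then 1 else 0 :: nat"
  have *: "(\<Prod>k\<in>I. w k ^ ?d i k) = w i" if "i \<in> I" for i and w :: "_ \<Rightarrow> real"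
    using that I by (subst prod.remove[of _ i]) (auto intro!: prod.neutral)
  have "(\<integral>w. w i * w j \<partial>entries I) = (\<integral>w. (\<Prod>k\<in>I. w k ^ (?d i k + ?d j k)) \<partial>entries I)"
    unfolding power_add prod.distrib using I by (simp only: *)
  also have "\<dots> = (\<Prod>k\<in>I. expectation (\<lambda>x. x ^ (?d i k + ?d j k)))"
    using I by (intro expectation_monomial) auto
  also have "\<dots> = (\<Prod>k\<in>{i, j}. expectation (\<lambda>x. x ^ (?d i k + ?d j k)))"
    using I by (intro prod.mono_neutral_right) (use prob_space in auto)
  also have "\<dots> = (if i = j then 1 else 0)"
    using mean second_moment by (auto simp: numeral_2_eq_2)
  finally show ?thesis .
qed

text \<open>The Isserlis formula for four factors plus the fourth cumulant: when all four indices
  coincide, the three pairings account for 3, so the moment \<open>b\<close> leaves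
  \<open>b - 3\<close>.\<close>

lemma expectation_entries_4:
  assumes I: "finite I" "i \<in> I" "j \<in> I" "k \<in> I" "l \<in> I"
  shows "(\<integral>w. w i * w j * (w k * w l) \<partial>entries I) =
    (if i = j then if k = l then 1 else 0 else 0) + (if i = k then if j = l then 1 else 0 else 0)
    + (if i = l then if j = k then 1 else 0 else 0) + (if i = j then if i = k then if i = l then b - 3 else 0 else 0 else 0)" (is "_ = ?R")
proof -
  let ?d = "\<lambda>i k. if k = i then 1 else 0 :: nat"
  have *: "(\<Prod>k\<in>I. w k ^ ?d i k) = w i" if "i \<in> I" for i and w :: "_ \<Rightarrow> real"
    using that I by (subst prod.remove[of _ i]) (auto intro!: prod.neutral)
  have "(\<integral>w. w i * w j * (w k * w l) \<partial>entries I) = (\<integral>w. (\<Prod>q\<in>I. w q ^ (?d i q + ?d j q + (?d k q + ?d l q))) \<partial>entries I)"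
    unfolding power_add prod.distrib using I by (simp only: *)
  also have "\<dots> = (\<Prod>q\<in>I. expectation (\<lambda>x. x ^ (?d i q + ?d j q + (?d k q + ?d l q))))"
    using I by (intro expectation_monomial) auto
  also have "\<dots> = (\<Prod>q\<in>{i, j, k, l}. expectation (\<lambda>x. x ^ (?d i q + ?d j q + (?d k q + ?d l q))))"
    using I by (intro prod.mono_neutral_right) (use prob_space in auto)
  also have "\<dots> = ?R"
    using mean second_moment fourth_moment
    by (cases "i = j"; cases "i = k"; cases "i = l"; cases "j = k"; cases "j = l"; cases "k = l")
       (auto simp: numeral_2_eq_2 eval_nat_numeral prod.insert_if)
  finally show ?thesis .
qed

lemma integral_sum_lessThan:
  fixes f :: "nat \<Rightarrow> 'b \<Rightarrow> real"
  assumes "\<And>i. i < m \<Longrightarrow> integrable M (f i)"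
  shows "(\<integral>w. (\<Sum>i<m. f i w) \<partial>M) = (\<Sum>i<m. \<integral>w. f i w \<partial>M)"
  using assms by (intro Bochner_Integration.integral_sum) auto

text \<open>Of the three pairings in \<open>expectation_entries_4\<close>, one gives the product of
  the traces; the other two both give the trace of the product once the symmetry of \<open>B\<close>
  is used. The cumulant sees only the diagonals.\<close>

lemma expectation_quadratic_forms:
  fixes p q :: real and A B :: "nat \<Rightarrow> nat \<Rightarrow> real"
  assumes sym: "\<And>i j. i < m \<Longrightarrow> j < m \<Longrightarrow> B i j = B j i"
  shows "(\<integral>w. (p - (\<Sum>i<m. \<Sum>j<m. w (n, i) * w (n, j) * A i j)) * (q - (\<Sum>k<m. \<Sum>l<m. w (n, k) * w (n, l) * B k l))
      \<partial>entries ({n} \<times> {..<m})) =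
    (p - (\<Sum>i<m. A i i)) * (q - (\<Sum>i<m. B i i)) + 2 * (\<Sum>i<m. \<Sum>j<m. A i j * B j i) + (b - 3) * (\<Sum>i<m. A i i * B i i)"
proof -
  let ?I = "{n} \<times> {..<m}"
  let ?M = "entries ?I"
  interpret M: prob_space ?M by (rule prob_space_entries)
  have d2: "deg_le ?I (\<lambda>_. 2) (\<lambda>w. w (n, i) * w (n, j))" if "i < m" "j < m" for i j
    using deg_le_mult[OF deg_le_var deg_le_var, of ?I "(n, i)" "\<lambda>_. 1" "(n, j)" "\<lambda>_. 1"] that
    by (simp add: numeral_2_eq_2)
  have d4: "deg_le ?I (\<lambda>_. 4) (\<lambda>w. w (n, i) * w (n, j) * (w (n, k) * w (n, l)))" if "i < m" "j < m" "k < m" "l < m" for i j k l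
    using deg_le_mult[OF d2 d2, of i j k l] that by simp
  have int2: "integrable ?M (\<lambda>w. w (n, i) * w (n, j))" if "i < m" "j < m" for i j
    by (rule integrable_deg_le[OF _ d2]) (use that in auto)
  have int4: "integrable ?M (\<lambda>w. w (n, i) * w (n, j) * (w (n, k) * w (n, l)))" if "i < m" "j < m" "k < m" "l < m" for i j k l
    by (rule integrable_deg_le[OF _ d4]) (use that in auto)
  have E2: "(\<integral>w. w (n, i) * w (n, j) \<partial>?M) = (if i = j then 1 else 0)" if "i < m" "j < m" for i j
    by (subst expectation_entries_2) (use that in auto)
  have E4: "(\<integral>w. w (n, i) * w (n, j) * (w (n, k) * w (n, l)) \<partial>?M) = 
    (if i = j then if k = l then 1 else 0 else 0) + (if i = k then if j = l then 1 else 0 else 0)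
    + (if i = l then if j = k then 1 else 0 else 0) + (if i = j then if i = k then if i = l then b - 3 else 0 else 0 else 0)" if "i < m" "j < m" "k < m" "l < m" for i j k l
    by (subst expectation_entries_4) (use that in auto)
  let ?Q = "\<lambda>C w. \<Sum>i<m. \<Sum>j<m. w (n, i) * w (n, j) * C i j"
  have EQ: "(\<integral>w. ?Q C w \<partial>?M) = (\<Sum>i<m. C i i)" and intQ: "integrable ?M (?Q C)" for C :: "nat \<Rightarrow> nat \<Rightarrow> real"
  proof -
    show "integrable ?M (?Q C)" by (intro Bochner_Integration.integrable_sum integrable_mult_left int2) auto
    have "(\<integral>w. ?Q C w \<partial>?M) = (\<Sum>i<m. \<Sum>j<m. (\<integral>w. w (n, i) * w (n, j) \<partial>?M) * C i j)"
      by (subst integral_sum_lessThan, force intro!: Bochner_Integration.integrable_sum integrable_mult_left int2,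
          rule sum.cong[OF refl], subst integral_sum_lessThan, force intro!: integrable_mult_left int2) simp
    also have "\<dots> = (\<Sum>i<m. C i i)" by (simp add: E2 if_distrib[of "\<lambda>x. x * _"] cong: if_cong)
    finally show "(\<integral>w. ?Q C w \<partial>?M) = (\<Sum>i<m. C i i)" .
  qed
  have QQ: "?Q A w * ?Q B w = (\<Sum>i<m. \<Sum>j<m. \<Sum>k<m. \<Sum>l<m. w (n, i) * w (n, j) * (w (n, k) * w (n, l)) * (A i j * B k l))" for w
    by (subst sum_distrib_right, rule sum.cong[OF refl], subst sum_distrib_right, rule sum.cong[OF refl],
        subst sum_distrib_left, rule sum.cong[OF refl], subst sum_distrib_left, rule sum.cong[OF refl]) (simp add: mult_ac)
  have intQQ: "integrable ?M (\<lambda>w. ?Q A w * ?Q B w)"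
    unfolding QQ by (intro Bochner_Integration.integrable_sum integrable_mult_left int4) auto
  have "(\<integral>w. ?Q A w * ?Q B w \<partial>?M) = (\<Sum>i<m. \<Sum>j<m. \<Sum>k<m. \<Sum>l<m.
     (\<integral>w. w (n, i) * w (n, j) * (w (n, k) * w (n, l)) \<partial>?M) * (A i j * B k l))"
    unfolding QQ
    by (subst integral_sum_lessThan, force intro!: Bochner_Integration.integrable_sum integrable_mult_left int4, rule sum.cong[OF refl])+
       simp
  \<comment> \<open>The deltas are reordered so that each tests the innermost summation index first;
    then the four sums collapse one after another.\<close>
  also have "\<dots> = (\<Sum>i<m. \<Sum>j<m. \<Sum>k<m. \<Sum>l<m.
     (if l = k then if j = i then A i j * B k l else 0 else 0) + (if l = j then if k = i then A i j * B k l else 0 else 0)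
    + (if l = i then if k = j then A i j * B k l else 0 else 0) + (if l = i then if k = i then if j = i then (b - 3) * (A i j * B k l) else 0 else 0 else 0))"
    by (intro sum.cong refl, subst E4) (auto simp: algebra_simps)
  also have "\<dots> = (\<Sum>i<m. A i i) * (\<Sum>i<m. B i i) + (\<Sum>i<m. \<Sum>j<m. A i j * B i j) + (\<Sum>i<m. \<Sum>j<m. A i j * B j i) + (b - 3) * (\<Sum>i<m. A i i * B i i)"
  proof -
    have "(\<Sum>k<m. if c then f k else 0) = (if c then \<Sum>k<m. f k else 0)" for c and f :: "nat \<Rightarrow> real"
      by simp
    then show ?thesis by (simp add: sum.distrib sum_product) (simp add: sum_distrib_left)
  qed
  also have "(\<Sum>i<m. \<Sum>j<m. A i j * B i j) = (\<Sum>i<m. \<Sum>j<m. A i j * B j i)"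
    by (intro sum.cong refl arg_cong2[of _ _ _ _ "(*)"] sym) auto
  finally have EQQ: "(\<integral>w. ?Q A w * ?Q B w \<partial>?M) = (\<Sum>i<m. A i i) * (\<Sum>i<m. B i i) + 2 * (\<Sum>i<m. \<Sum>j<m. A i j * B j i) + (b - 3) * (\<Sum>i<m. A i i * B i i)"
    by simp
  have "(\<integral>w. (p - ?Q A w) * (q - ?Q B w) \<partial>?M) = (\<integral>w. p * q - p * ?Q B w - q * ?Q A w + ?Q A w * ?Q B w \<partial>?M)"
    by (simp add: algebra_simps)
  also have "\<dots> = p * q - p * (\<Sum>i<m. B i i) - q * (\<Sum>i<m. A i i) + (\<integral>w. ?Q A w * ?Q B w \<partial>?M)"
    using intQ intQQ by (simp add: EQ M.prob_space)
  finally show ?thesis unfolding EQQ by (simp add: algebra_simps)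
qed

end

section \<open>The correlation function in finite size\<close>

lemma poly_eq_sum_atMost:
  fixes p :: "'a :: comm_semiring_1 poly"
  assumes "degree p \<le> m"
  shows "poly p x = (\<Sum>i\<le>m. coeff p i * x ^ i)"
  unfolding poly_altdef using assms by (intro sum.mono_neutral_left) (auto simp: coeff_eq_0)

lemma deg_le_poly_eval:
  assumes "deg_le_poly I d P" "\<And>w. degree (P w) \<le> m"
  shows "deg_le I d (\<lambda>w. poly (P w) x)"
proof -
  have "poly (P w) x = (\<Sum>i\<le>m. x ^ i * coeff (P w) i)" for w
    using poly_eq_sum_atMost[OF assms(2)] by (simp add: mult.commute)
  then show ?thesis using assms(1) by (simp add: deg_le_poly_def deg_le_sum deg_le_scale)
qed

lemma deg_le_poly_pderiv:
  assumes "deg_le_poly I d P"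
  shows "deg_le_poly I d (\<lambda>w. pderiv (P w))"
  using assms unfolding deg_le_poly_def coeff_pderiv by (intro allI deg_le_scale) auto

lemma degree_char_poly_sample_cov: "degree (char_poly (sample_cov n m w)) = m"
  using degree_monic_char_poly[OF sample_cov_carrier] by blast

lemma deg_le_char_poly_sample_cov: "deg_le (entry_set n m) (\<lambda>_. 2) (\<lambda>w. poly (char_poly (sample_cov n m w)) x)"
  by (rule deg_le_poly_eval[OF deg_le_poly_char_poly_sample_cov]) (auto simp: degree_char_poly_sample_cov)

lemma deg_le_pderiv_char_poly_sample_cov:
  "deg_le (entry_set n m) (\<lambda>_. 2) (\<lambda>w. poly (pderiv (char_poly (sample_cov n m w))) x)"
  by (rule deg_le_poly_eval[OF deg_le_poly_pderiv[OF deg_le_poly_char_poly_sample_cov], of _ _ m])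
     (auto simp: degree_char_poly_sample_cov degree_pderiv)

lemma integral_add_scaled:
  fixes f g h :: "'a \<Rightarrow> real"
  assumes "integrable M f" "integrable M g" "integrable M h"
  shows "(\<integral>w. f w + c * g w + d * h w \<partial>M) = (\<integral>w. f w \<partial>M) + c * (\<integral>w. g w \<partial>M) + d * (\<integral>w. h w \<partial>M)"
  using assms by simp

context normalized_distribution
begin

lemma integrable_deg_le_mult:
  assumes "finite I" "deg_le I (\<lambda>_. 2) F" "deg_le I (\<lambda>_. 2) G"
  shows "integrable (entries I) (\<lambda>w. F w * G w)"
  using integrable_deg_le[OF assms(1) deg_le_mult[OF assms(2,3)]] by simp

text \<open>In \<open>x\<close> the mean is a polynomial whose coefficients are means, so it is
  differentiated termwise without dominated convergence.\<close>

lemma DERIV_expectation_poly: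
  assumes I: "finite I" and P: "deg_le_poly I (\<lambda>_. 2) P" "\<And>w. degree (P w) \<le> m" and g: "deg_le I (\<lambda>_. 2) g"
  shows "((\<lambda>x. \<integral>w. poly (P w) x * g w \<partial>entries I) has_real_derivative
     (\<integral>w. poly (pderiv (P w)) x * g w \<partial>entries I)) (at x)"
proof -
  have int: "integrable (entries I) (\<lambda>w. coeff (P w) i * g w)" for i
    using P g by (intro integrable_deg_le_mult I) (auto simp: deg_le_poly_def)
  have alt: "poly (P w) x = (\<Sum>i\<le>m. coeff (P w) i * x ^ i)" for w x
    by (rule poly_eq_sum_atMost) (rule P)
  have eq: "(\<integral>w. poly (P w) x * g w \<partial>entries I) = (\<Sum>i\<le>m. (\<integral>w. coeff (P w) i * g w \<partial>entries I) * x ^ i)" for x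
  proof -
    have "(\<integral>w. poly (P w) x * g w \<partial>entries I) = (\<integral>w. (\<Sum>i\<le>m. (coeff (P w) i * g w) * x ^ i) \<partial>entries I)"
      unfolding alt sum_distrib_right by (intro Bochner_Integration.integral_cong sum.cong refl) (simp add: mult_ac)
    also have "\<dots> = (\<Sum>i\<le>m. (\<integral>w. (coeff (P w) i * g w) * x ^ i \<partial>entries I))"
      by (intro Bochner_Integration.integral_sum integrable_mult_left int)
    finally show ?thesis by simp
  qed
  have pd: "poly (pderiv (P w)) x = (\<Sum>i\<le>m. coeff (P w) i * (real i * x ^ (i - 1)))" for w
  proof -
    have "((\<lambda>x. \<Sum>i\<le>m. coeff (P w) i * x ^ i) has_real_derivative (\<Sum>i\<le>m. coeff (P w) i * (real i * x ^ (i - 1)))) (at x)"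
      by (auto intro!: derivative_eq_intros sum.cong)
    then show ?thesis using poly_DERIV[of "P w" x] unfolding alt[abs_def] by (rule DERIV_unique[rotated])
  qed
  have "(\<integral>w. poly (pderiv (P w)) x * g w \<partial>entries I)
      = (\<integral>w. (\<Sum>i\<le>m. (coeff (P w) i * g w) * (real i * x ^ (i - 1))) \<partial>entries I)"
    unfolding pd sum_distrib_right by (intro Bochner_Integration.integral_cong sum.cong refl) (simp add: mult_ac)
  also have "\<dots> = (\<Sum>i\<le>m. (\<integral>w. (coeff (P w) i * g w) * (real i * x ^ (i - 1)) \<partial>entries I))"
    by (intro Bochner_Integration.integral_sum integrable_mult_left int)
  also have "\<dots> = (\<Sum>i\<le>m. (\<integral>w. coeff (P w) i * g w \<partial>entries I) * (real i * x ^ (i - 1)))"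
    by simp
  finally have eq': "(\<integral>w. poly (pderiv (P w)) x * g w \<partial>entries I) = \<dots>" .
  show ?thesis unfolding eq eq' by (auto intro!: derivative_eq_intros sum.cong)
qed

definition char_corr :: "nat \<Rightarrow> nat \<Rightarrow> real \<Rightarrow> real \<Rightarrow> real" where
  "char_corr n m x y = (\<integral>w. poly (char_poly (sample_cov n m w)) x * poly (char_poly (sample_cov n m w)) y
      \<partial>entries (entry_set n m))"

text \<open>The entries that remain, relabelled through the injection \<open>f\<close>, again have
  the product law, so the minor is distributed as the matrix with one column less.\<close>

lemma expectation_column_deleted:
  assumes "i < Suc m"
  shows "(\<integral>w. poly (char_poly (mat_delete (sample_cov n (Suc m) w) i i)) x * poly (char_poly (mat_delete (sample_cov n (Suc m) w) i i)) y
      \<partial>entries (entry_set n (Suc m))) = char_corr n m x y" (is ?th1)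
    and "integrable (entries (entry_set n (Suc m))) (\<lambda>w. poly (char_poly (mat_delete (sample_cov n (Suc m) w) i i)) x * poly (char_poly (mat_delete (sample_cov n (Suc m) w) i i)) y)" (is ?th2)
proof -
  let ?I = "entry_set n m" and ?K = "entry_set n (Suc m)"
  define f where "f = (\<lambda>(r::nat, c). (r, insert_index i c))"
  define t where "t = (\<lambda>w :: nat \<times> nat \<Rightarrow> real. \<lambda>p\<in>?I. w (f p))"
  define F where "F = (\<lambda>w. poly (char_poly (sample_cov n m w)) x * poly (char_poly (sample_cov n m w)) y)"
  have inj: "inj_on f ?I" by (auto simp: inj_on_def f_def insert_index_def split: if_splits)
  have fK: "f \<in> ?I \<rightarrow> ?K" by (auto simp: f_def insert_index_def)
  have distr: "distr (entries ?K) (entries ?I) t = entries ?I"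
    using distr_PiM_reindex[OF prob_space_axioms inj fK] by (simp add: t_def)
  have t: "t \<in> measurable (entries ?K) (entries ?I)"
    unfolding t_def using fK by (intro measurable_restrict measurable_component_singleton) auto
  have intF: "integrable (entries ?I) F"
    unfolding F_def by (intro integrable_deg_le_mult deg_le_char_poly_sample_cov) auto
  have Ft: "F (t w) = poly (char_poly (mat_delete (sample_cov n (Suc m) w) i i)) x * poly (char_poly (mat_delete (sample_cov n (Suc m) w) i i)) y" for w
  proof -
    have "sample_cov n m (t w) = sample_cov n m (\<lambda>(r, c). w (r, insert_index i c))"
      by (rule sample_cov_cong) (auto simp: t_def f_def)
    then show ?thesis unfolding F_def mat_delete_sample_cov[OF assms] by simp
  qed
  have "integral\<^sup>L (entries ?I) F = (\<integral>w. F (t w) \<partial>entries ?K)"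
    by (subst distr[symmetric], rule integral_distr[OF t]) (use intF in auto)
  then show ?th1 unfolding Ft by (simp add: char_corr_def F_def)
  have "integrable (distr (entries ?K) (entries ?I) t) F" unfolding distr by (rule intF)
  then have "integrable (entries ?K) (\<lambda>w. F (t w))"
    by (subst (asm) integrable_distr_eq[OF t]) (use intF in auto)
  then show ?th2 unfolding Ft .
qed

text \<open>The new row is integrated out first, by Fubini. The hypothesis
  \<open>x \<noteq> y\<close> allows solving \<open>resolvent_identity\<close> for the trace of the
  product, and each of the \<open>m\<close> diagonal products has mean
  \<open>char_corr n (m - 1)\<close>.\<close>

lemma char_corr_Suc:
  assumes "x \<noteq> y"
  defines "P \<equiv> \<lambda>n m w. char_poly (sample_cov n m w)"
  shows "char_corr (Suc n) m x y =
    (\<integral>w. (poly (P n m w) x - poly (pderiv (P n m w)) x) * (poly (P n m w) y - poly (pderiv (P n m w)) y) \<partial>entries (entry_set n m))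
    + 2 / (x - y) * (\<integral>w. poly (P n m w) x * poly (pderiv (P n m w)) y - poly (pderiv (P n m w)) x * poly (P n m w) y \<partial>entries (entry_set n m))
    + (b - 3) * (if m = 0 then 0 else real m * char_corr n (m - 1) x y)"
proof -
  interpret product_sigma_finite "\<lambda>_ :: nat \<times> nat. Q" by (rule product_sigma_finite_Q)
  let ?I = "entry_set n m" and ?J = "{n} \<times> {..<m}"
  have IJ: "?I \<union> ?J = entry_set (Suc n) m" "?I \<inter> ?J = {}" by auto
  define p where "p = (\<lambda>w z. poly (P n m w) z)"
  define p' where "p' = (\<lambda>w z. poly (pderiv (P n m w)) z)"
  define A where "A = (\<lambda>w z i j. poly (resolvent_adj (sample_cov n m w) i j) z)"
  have tr: "(\<Sum>i<m. A w z i i) = p' w z" for w z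
    unfolding A_def p'_def P_def by (simp flip: trace_resolvent_adj[OF sample_cov_carrier] poly_sum)
  have "char_corr (Suc n) m x y = (\<integral>w. \<integral>v. poly (P (Suc n) m (merge ?I ?J (w, v))) x * poly (P (Suc n) m (merge ?I ?J (w, v))) y \<partial>entries ?J \<partial>entries ?I)"
    unfolding char_corr_def IJ(1)[symmetric] P_def
    by (rule product_integral_fold[OF IJ(2)]; (unfold IJ(1))?; (intro integrable_deg_le_mult deg_le_char_poly_sample_cov)?) auto
  also have "\<dots> = (\<integral>w. (p w x - p' w x) * (p w y - p' w y)
      + 2 / (x - y) * (p w x * p' w y - p' w x * p w y) + (b - 3) * (\<Sum>i<m. A w x i i * A w y i i) \<partial>entries ?I)"
  proof (rule Bochner_Integration.integral_cong[OF refl])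
    fix w :: "nat \<times> nat \<Rightarrow> real"
    have "poly (P (Suc n) m (merge ?I ?J (w, v))) z = p w z - (\<Sum>i<m. \<Sum>j<m. v (n, i) * v (n, j) * A w z i j)" for v z
    proof -
      have S: "sample_cov n m (merge ?I ?J (w, v)) = sample_cov n m w"
        by (rule sample_cov_cong) (auto simp: merge_def)
      show ?thesis
        unfolding P_def char_poly_sample_cov_Suc S p_def A_def
        by (simp add: poly_sum merge_def)
    qed
    then have "(\<integral>v. poly (P (Suc n) m (merge ?I ?J (w, v))) x * poly (P (Suc n) m (merge ?I ?J (w, v))) y \<partial>entries ?J)
      = (\<integral>v. (p w x - (\<Sum>i<m. \<Sum>j<m. v (n, i) * v (n, j) * A w x i j)) * (p w y - (\<Sum>i<m. \<Sum>j<m. v (n, i) * v (n, j) * A w y i j)) \<partial>entries ?J)"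
      by simp
    also have "\<dots> = (p w x - p' w x) * (p w y - p' w y) + 2 * (\<Sum>i<m. \<Sum>j<m. A w x i j * A w y j i) + (b - 3) * (\<Sum>i<m. A w x i i * A w y i i)"
    proof -
      have "A w y i j = A w y j i" if "i < m" "j < m" for i j
        unfolding A_def using that
        by (subst resolvent_adj_sym[OF sample_cov_carrier]) (auto simp: index_sample_cov mult.commute)
      then show ?thesis by (subst expectation_quadratic_forms) (auto simp: tr)
    qed
    also have "(\<Sum>i<m. \<Sum>j<m. A w x i j * A w y j i) = (p w x * p' w y - p' w x * p w y) / (x - y)"
      using resolvent_identity[OF sample_cov_carrier[of n m w], of x y] assms(1)
      by (simp add: p_def p'_def A_def P_def field_simps)
    finally show "(\<integral>v. poly (P (Suc n) m (merge ?I ?J (w, v))) x * poly (P (Suc n) m (merge ?I ?J (w, v))) y \<partial>entries ?J)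
      = (p w x - p' w x) * (p w y - p' w y) + 2 / (x - y) * (p w x * p' w y - p' w x * p w y) + (b - 3) * (\<Sum>i<m. A w x i i * A w y i i)"
      by simp
  qed
  also have "\<dots> = (\<integral>w. (p w x - p' w x) * (p w y - p' w y) \<partial>entries ?I)
      + 2 / (x - y) * (\<integral>w. p w x * p' w y - p' w x * p w y \<partial>entries ?I) + (b - 3) * (\<integral>w. (\<Sum>i<m. A w x i i * A w y i i) \<partial>entries ?I)"
  proof -
    have d: "deg_le ?I (\<lambda>_. 2) (\<lambda>w. p w z)" "deg_le ?I (\<lambda>_. 2) (\<lambda>w. p' w z)" for z
      unfolding p_def p'_def P_def by (rule deg_le_char_poly_sample_cov deg_le_pderiv_char_poly_sample_cov)+
    have "deg_le ?I (\<lambda>_. 2) (\<lambda>w. p w z - p' w z)" for z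
      using deg_le.add[OF d(1) deg_le_scale[OF d(2), of "-1"]] by simp
    then have i1: "integrable (entries ?I) (\<lambda>w. (p w x - p' w x) * (p w y - p' w y))"
      by (intro integrable_deg_le_mult) auto
    have i2: "integrable (entries ?I) (\<lambda>w. p w x * p' w y - p' w x * p w y)"
      using d by (intro Bochner_Integration.integrable_diff integrable_deg_le_mult) auto
    have i3: "integrable (entries ?I) (\<lambda>w. \<Sum>i<m. A w x i i * A w y i i)"
    proof (intro Bochner_Integration.integrable_sum)
      fix i assume "i \<in> {..<m}"
      then obtain m' where "m = Suc m'" "i < m" by (cases m) auto
      then show "integrable (entries ?I) (\<lambda>w. A w x i i * A w y i i)"
        using expectation_column_deleted(2)[of i m' n x y]
        by (simp add: A_def resolvent_adj_diag[OF sample_cov_carrier])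
    qed
    show ?thesis by (rule integral_add_scaled[OF i1 i2 i3])
  qed
  also have "(\<integral>w. (\<Sum>i<m. A w x i i * A w y i i) \<partial>entries ?I) = (if m = 0 then 0 else real m * char_corr n (m - 1) x y)"
  proof (cases m)
    case (Suc m')
    have *: "A w z i i = poly (char_poly (mat_delete (sample_cov n (Suc m') w) i i)) z" if "i < m" for i z w
      using that by (simp add: A_def Suc resolvent_adj_diag[OF sample_cov_carrier])
    have "(\<integral>w. (\<Sum>i<m. A w x i i * A w y i i) \<partial>entries ?I) = (\<Sum>i<m. \<integral>w. A w x i i * A w y i i \<partial>entries ?I)"
      using expectation_column_deleted(2)[of _ m' n x y] by (intro integral_sum_lessThan) (simp add: * Suc[symmetric])
    also have "\<dots> = (\<Sum>i<m. char_corr n m' x y)"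
      using expectation_column_deleted(1)[of _ m' n x y] by (intro sum.cong refl) (simp add: * Suc[symmetric])
    finally show ?thesis by (simp add: Suc)
  qed auto
  finally show ?thesis by (simp add: p_def p'_def)
qed

lemma char_corr_0: "char_corr 0 m x y = (x * y) ^ m"
proof -
  interpret M: prob_space "entries (entry_set 0 m)" by (rule prob_space_entries)
  have "char_poly (sample_cov 0 m w) = [:0, 1:] ^ m" for w
  proof -
    have "char_poly_matrix (sample_cov 0 m w) = [:0, 1:] \<cdot>\<^sub>m 1\<^sub>m m"
      using carrier_matD[OF sample_cov_carrier[of 0 m w]]
      by (intro eq_matI) (auto simp: char_poly_matrix_def index_sample_cov)
    then show ?thesis by (simp add: char_poly_def det_smult)
  qed
  then show ?thesis using M.prob_space by (simp add: char_corr_def power_mult_distrib)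
qed

text \<open>The induction hypothesis only gives the mean of p(x) p(y); the means containing
  derivatives of p are found by differentiating it in \<open>x\<close> and in \<open>y\<close>. The
  division by \<open>x - y\<close> leaves out the diagonal, which is recovered by continuity in
  \<open>x\<close>.\<close>

theorem char_corr_eq: "char_corr n m x y = fact n * fact m * corr_sum (b - 3) n m x y"
proof (induction n arbitrary: m x y)
  case 0
  then show ?case by (simp add: char_corr_0 corr_sum_0)
next
  case (Suc n)
  let ?M = "entries (entry_set n m)"
  define P where "P = (\<lambda>w. char_poly (sample_cov n m w))"
  define c where "c = (\<lambda>d. fact n * fact m * (binexp (b - 3) d * (fact (m - d) / fact (n - d))))"
  let ?L = "\<lambda>d. lag (m - d) (n - d)" and ?L' = "\<lambda>d. lag' (m - d) (n - d)"
  have degs: "deg_le (entry_set n m) (\<lambda>_. 2) (\<lambda>w. poly (P w) z)"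
    "deg_le (entry_set n m) (\<lambda>_. 2) (\<lambda>w. poly (pderiv (P w)) z)" for z
    unfolding P_def by (rule deg_le_char_poly_sample_cov deg_le_pderiv_char_poly_sample_cov)+
  have DP: "((\<lambda>x. \<integral>w. poly (P w) x * g w \<partial>?M) has_real_derivative (\<integral>w. poly (pderiv (P w)) x * g w \<partial>?M)) (at x)"
    if "deg_le (entry_set n m) (\<lambda>_. 2) g" for g x
    unfolding P_def by (rule DERIV_expectation_poly[OF _ deg_le_poly_char_poly_sample_cov _ that, of m])
      (auto simp: degree_char_poly_sample_cov)
  have E00: "(\<integral>w. poly (P w) x * poly (P w) y \<partial>?M) = (\<Sum>d\<le>min n m. c d * (?L d x * ?L d y))" for x y
    using Suc.IH[of m x y]
    by (simp add: char_corr_def P_def corr_sum_def lag_kernel_def c_def sum_distrib_left mult_ac)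
  have E10: "(\<integral>w. poly (pderiv (P w)) x * poly (P w) y \<partial>?M) = (\<Sum>d\<le>min n m. c d * (?L' d x * ?L d y))" for x y
  proof (rule DERIV_unique)
    show "((\<lambda>x. \<integral>w. poly (P w) x * poly (P w) y \<partial>?M) has_real_derivative (\<integral>w. poly (pderiv (P w)) x * poly (P w) y \<partial>?M)) (at x)"
      by (rule DP degs)+
    show "((\<lambda>x. \<integral>w. poly (P w) x * poly (P w) y \<partial>?M) has_real_derivative (\<Sum>d\<le>min n m. c d * (?L' d x * ?L d y))) (at x)"
      unfolding E00 by (intro DERIV_sum DERIV_cmult DERIV_cmult_right DERIV_lag)
  qed
  have E01: "(\<integral>w. poly (P w) x * poly (pderiv (P w)) y \<partial>?M) = (\<Sum>d\<le>min n m. c d * (?L d x * ?L' d y))" for x y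
    using E10[of y x] by (simp add: mult.commute)
  have E11: "(\<integral>w. poly (pderiv (P w)) x * poly (pderiv (P w)) y \<partial>?M) = (\<Sum>d\<le>min n m. c d * (?L' d x * ?L' d y))" for x y
  proof (rule DERIV_unique)
    show "((\<lambda>x. \<integral>w. poly (P w) x * poly (pderiv (P w)) y \<partial>?M) has_real_derivative (\<integral>w. poly (pderiv (P w)) x * poly (pderiv (P w)) y \<partial>?M)) (at x)"
      by (rule DP degs)+
    show "((\<lambda>x. \<integral>w. poly (P w) x * poly (pderiv (P w)) y \<partial>?M) has_real_derivative (\<Sum>d\<le>min n m. c d * (?L' d x * ?L' d y))) (at x)"
      unfolding E01 by (intro DERIV_sum DERIV_cmult DERIV_cmult_right DERIV_lag)
  qed
  have int: "integrable ?M (\<lambda>w. poly (P w) x * poly (P w) y)" "integrable ?M (\<lambda>w. poly (pderiv (P w)) x * poly (P w) y)"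
    "integrable ?M (\<lambda>w. poly (P w) x * poly (pderiv (P w)) y)" "integrable ?M (\<lambda>w. poly (pderiv (P w)) x * poly (pderiv (P w)) y)" for x y
    by (intro integrable_deg_le_mult degs; simp)+
  have eq: "char_corr (Suc n) m x y = fact (Suc n) * fact m * corr_sum (b - 3) (Suc n) m x y" if xy: "x \<noteq> y" for x y
  proof -
    have "(\<integral>w. (poly (P w) x - poly (pderiv (P w)) x) * (poly (P w) y - poly (pderiv (P w)) y) \<partial>?M)
        = (\<Sum>d\<le>min n m. c d * (?L d x * ?L d y)) - (\<Sum>d\<le>min n m. c d * (?L d x * ?L' d y))
          - (\<Sum>d\<le>min n m. c d * (?L' d x * ?L d y)) + (\<Sum>d\<le>min n m. c d * (?L' d x * ?L' d y))"
      unfolding E00[symmetric] E01[symmetric] E10[symmetric] E11[symmetric]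
      using int by (simp add: algebra_simps)
    also have "\<dots> = (\<Sum>d\<le>min n m. c d * ((?L d x - ?L' d x) * (?L d y - ?L' d y)))"
      by (simp add: sum_subtractf[symmetric] sum.distrib[symmetric] algebra_simps)
    finally have T1: "(\<integral>w. (poly (P w) x - poly (pderiv (P w)) x) * (poly (P w) y - poly (pderiv (P w)) y) \<partial>?M) = \<dots>" .
    have "(\<integral>w. poly (P w) x * poly (pderiv (P w)) y - poly (pderiv (P w)) x * poly (P w) y \<partial>?M)
        = (\<Sum>d\<le>min n m. c d * (?L d x * ?L' d y)) - (\<Sum>d\<le>min n m. c d * (?L' d x * ?L d y))"
      unfolding E01[symmetric] E10[symmetric] using int by simp
    also have "\<dots> = (\<Sum>d\<le>min n m. c d * (?L d x * ?L' d y - ?L' d x * ?L d y))"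
      by (simp add: sum_subtractf[symmetric] algebra_simps)
    finally have T2: "(\<integral>w. poly (P w) x * poly (pderiv (P w)) y - poly (pderiv (P w)) x * poly (P w) y \<partial>?M) = \<dots>" .
    have T3: "(b - 3) * (if m = 0 then 0 else real m * char_corr n (m - 1) x y)
        = fact n * fact m * ((b - 3) * (if m = 0 then 0 else corr_sum (b - 3) n (m - 1) x y))"
      unfolding Suc.IH by (cases m) simp_all
    have "(x - y) * char_corr (Suc n) m x y = (x - y) * (\<Sum>d\<le>min n m. c d * ((?L d x - ?L' d x) * (?L d y - ?L' d y)))
       + 2 * (\<Sum>d\<le>min n m. c d * (?L d x * ?L' d y - ?L' d x * ?L d y))
       + (x - y) * (fact n * fact m * ((b - 3) * (if m = 0 then 0 else corr_sum (b - 3) n (m - 1) x y)))"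
      unfolding char_corr_Suc[OF xy] T1[unfolded P_def] T2[unfolded P_def] T3 using xy by (simp add: distrib_left)
    also have "\<dots> = fact n * fact m * ((x - y) * (real (Suc n) * corr_sum (b - 3) (Suc n) m x y))"
      unfolding corr_sum_rec c_def distrib_left sum_distrib_left
      by (intro arg_cong2[of _ _ _ _ "(+)"] sum.cong refl) (simp_all add: mult_ac)
    finally have "(x - y) * char_corr (Suc n) m x y = (x - y) * (fact (Suc n) * fact m * corr_sum (b - 3) (Suc n) m x y)"
      by (simp add: mult_ac)
    then show ?thesis using xy by simp
  qed
  show ?case
  proof (cases "x = y")
    case True
    let ?R = "\<lambda>x. char_corr (Suc n) m x y - fact (Suc n) * fact m * corr_sum (b - 3) (Suc n) m x y"
    have "isCont (\<lambda>x. char_corr (Suc n) m x y) y"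
      unfolding char_corr_def
      by (rule DERIV_isCont[OF DERIV_expectation_poly[OF _ deg_le_poly_char_poly_sample_cov _ deg_le_char_poly_sample_cov], of _ _ m])
         (auto simp: degree_char_poly_sample_cov)
    moreover have "isCont (lag k p) y" for k p by (rule DERIV_isCont[OF DERIV_lag])
    then have "isCont (\<lambda>x. corr_sum (b - 3) (Suc n) m x y) y"
      unfolding corr_sum_def lag_kernel_def by (intro continuous_intros)
    ultimately have "isCont ?R y" by (intro continuous_intros)
    then have "?R \<midarrow>y\<rightarrow> ?R y" by (simp add: isCont_def)
    moreover have "?R \<midarrow>y\<rightarrow> 0"
      by (rule tendsto_eventually) (auto simp: eventually_at_filter eq)
    ultimately have "?R y = 0" by (rule LIM_unique)
    then show ?thesis using True by simp
  qed (rule eq)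
qed

end

text \<open>Passing from det (S - z) to the characteristic polynomial costs a factor
  \<open>(- 1) ^ m\<close> at each of the two arguments, so no sign remains.\<close>

lemma corr2_of_real:
  assumes "normalized_distribution Q b"
  shows "corr2 Q n m (of_real x) (of_real y) = of_real (fact n * fact m * corr_sum (b - 3) n m x y)"
proof -
  interpret normalized_distribution Q b by (rule assms)
  have det: "Determinant.det (map_mat complex_of_real (sample_cov n m w) - complex_of_real z \<cdot>\<^sub>m 1\<^sub>m m)
      = complex_of_real ((- 1) ^ m * poly (char_poly (sample_cov n m w)) z)" for w z
  proof -
    let ?S = "sample_cov n m w"
    have dims: "dim_row ?S = m" "dim_col ?S = m" using carrier_matD[OF sample_cov_carrier[of n m w]] by auto
    have "map_mat complex_of_real ?S - complex_of_real z \<cdot>\<^sub>m 1\<^sub>m m = map_mat complex_of_real (?S - z \<cdot>\<^sub>m 1\<^sub>m m)"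
      by (rule eq_matI) (auto simp: dims)
    then have "Determinant.det (map_mat complex_of_real ?S - complex_of_real z \<cdot>\<^sub>m 1\<^sub>m m) = complex_of_real (Determinant.det (?S - z \<cdot>\<^sub>m 1\<^sub>m m))"
      by (simp add: of_real_hom.hom_det)
    moreover have "Determinant.det (?S - z \<cdot>\<^sub>m 1\<^sub>m m) = (- 1) ^ m * poly (char_poly ?S) z"
    proof -
      have "poly (char_poly ?S) z = Determinant.det (- 1 \<cdot>\<^sub>m (?S - z \<cdot>\<^sub>m 1\<^sub>m m))"
        unfolding char_poly_def
        by (rule poly_det_cong[of _ m]) (auto simp: char_poly_matrix_def dims)
      also have "\<dots> = (- 1) ^ m * Determinant.det (?S - z \<cdot>\<^sub>m 1\<^sub>m m)"
        by (simp add: det_smult dims)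
      finally show ?thesis by (simp flip: mult.assoc power_mult_distrib)
    qed
    ultimately show ?thesis by simp
  qed
  have "corr2 Q n m (of_real x) (of_real y) = (\<integral>w. complex_of_real (poly (char_poly (sample_cov n m w)) x * poly (char_poly (sample_cov n m w)) y)
      \<partial>entries (entry_set n m))"
    unfolding corr2_def iid_entries_def det
  proof (intro Bochner_Integration.integral_cong refl)
    fix w :: "nat \<times> nat \<Rightarrow> real"
    have sgn: "(- 1) ^ m * (- 1) ^ m = (1 :: real)" by (simp flip: power_add mult_2)
    have gen: "s * p * (s * q) = p * q" if "s * s = 1" for s p q :: real
      using that by (metis mult.assoc mult.left_commute mult_1)
    show "complex_of_real ((- 1) ^ m * poly (char_poly (sample_cov n m w)) x) * complex_of_real ((- 1) ^ m * poly (char_poly (sample_cov n m w)) y)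
      = complex_of_real (poly (char_poly (sample_cov n m w)) x * poly (char_poly (sample_cov n m w)) y)"
      unfolding of_real_mult[symmetric] gen[OF sgn] ..
  qed
  also have "\<dots> = of_real (char_corr n m x y)" unfolding char_corr_def by (rule integral_complex_of_real)
  finally show ?thesis unfolding char_corr_eq .
qed

section \<open>The Airy function and the differentiated kernel\<close>

lemma integrable_exp_minus_square:
  assumes "c > 0"
  shows "integrable lborel (\<lambda>x :: real. exp (- c * x ^ 2))"
proof -
  define s where "s = 1 / sqrt (2 * c)"
  have s: "s > 0" "s ^ 2 = 1 / (2 * c)" using assms by (auto simp: s_def power_divide)
  have "integrable lborel (normal_density 0 s)" 
    using prob_space_normal_density[OF s(1), of 0] integrable_normal_moment[OF s(1), of 0 0] by simp
  then have "integrable lborel (\<lambda>x. sqrt (2 * pi * s ^ 2) * normal_density 0 s x)" by simp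
  moreover have "sqrt (2 * pi * s ^ 2) * normal_density 0 s x = exp (- c * x ^ 2)" for x
    using s assms by (simp add: normal_density_def field_simps)
  ultimately show ?thesis by simp
qed

lemma power_le_exp: "0 \<le> y \<Longrightarrow> y ^ q \<le> fact q * exp (y :: real)"
proof -
  assume y: "0 \<le> y"
  have "(\<Sum>k\<in>{q}. y ^ k /\<^sub>R fact k) \<le> exp y"
    unfolding exp_def by (rule sum_le_suminf[OF summable_exp_generic]) (use y in auto)
  then show ?thesis by (simp add: field_simps)
qed

section \<open>Contour representation of the Airy function\<close>

definition airy_path :: "real \<Rightarrow> complex" where
  "airy_path t = of_real t + \<i>"

definition airy_weight :: "real \<Rightarrow> complex" where
  "airy_weight t = exp (\<i> * airy_path t ^ 3 / 3)"

abbreviation airy_wave :: "nat \<Rightarrow> real \<Rightarrow> real \<Rightarrow> complex" where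
  "airy_wave j x t \<equiv> airy_path t ^ j * airy_weight t * exp (\<i> * of_real x * airy_path t)"

text \<open>The moment of order 0 turns out to be the Airy function; differentiation in
  \<open>x\<close> multiplies the integrand by \<open>\<i>\<close> times the path and so raises the
  order by one.\<close>

definition airy_moment :: "nat \<Rightarrow> real \<Rightarrow> complex" where
  "airy_moment j x = (\<integral>t. airy_wave j x t \<partial>lborel) / (2 * pi)"

text \<open>This Gaussian decay is the reason for moving the contour up by 1: the conditionally
  convergent Airy integral becomes absolutely convergent.\<close>

lemma norm_airy_weight: "norm (airy_weight t) = exp (1 / 3 - t ^ 2)"
  by (simp add: airy_weight_def airy_path_def norm_exp power3_eq_cube power2_eq_square algebra_simps) (simp add: field_simps)

lemma norm_airy_exp: "norm (exp (\<i> * of_real x * airy_path t)) = exp (- x)"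
  by (simp add: airy_path_def)

lemma norm_airy_path: "norm (airy_path t) \<le> 1 + \<bar>t\<bar>"
  unfolding airy_path_def by (rule norm_triangle_le) simp

lemma measurable_airy [measurable]:
  "airy_path \<in> borel_measurable borel" "airy_weight \<in> borel_measurable borel"
  unfolding airy_path_def[abs_def] airy_weight_def[abs_def] by measurable

text \<open>The factor \<open>exp (1 + \<bar>t\<bar>)\<close> is room for the Taylor remainder of
  the exponential in \<open>has_vector_derivative_airy_moment\<close>.\<close>

lemma airy_dominated:
  "\<exists>C. \<forall>t :: real. (1 + \<bar>t\<bar>) ^ q * exp (1 + \<bar>t\<bar>) * exp (1 / 3 - t ^ 2) \<le> C * exp (- (1 / 2) * t ^ 2)"
proof (intro exI allI)
  fix t :: real
  have "(1 + \<bar>t\<bar>) ^ q * exp (1 + \<bar>t\<bar>) * exp (1 / 3 - t ^ 2) \<le> fact q * exp (1 + \<bar>t\<bar>) * exp (1 + \<bar>t\<bar>) * exp (1 / 3 - t ^ 2)"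
    by (intro mult_right_mono power_le_exp) auto
  also have "\<dots> = fact q * exp (7 / 3 + 2 * \<bar>t\<bar> - t ^ 2)"
    by (simp add: mult.assoc flip: exp_add)
  also have "\<dots> \<le> fact q * exp (5 - (1 / 2) * t ^ 2)"
  proof -
    have "0 \<le> (\<bar>t\<bar> - 2) ^ 2" by simp
    then have "2 * \<bar>t\<bar> \<le> t ^ 2 / 2 + 2" by (simp add: power2_eq_square algebra_simps abs_mult_self_eq)
    then show ?thesis by simp
  qed
  finally show "(1 + \<bar>t\<bar>) ^ q * exp (1 + \<bar>t\<bar>) * exp (1 / 3 - t ^ 2) \<le> (fact q * exp 5) * exp (- (1 / 2) * t ^ 2)"
    by (simp add: mult.assoc flip: exp_add)
qed

lemma integrable_airy_bound:
  "integrable lborel (\<lambda>t :: real. (1 + \<bar>t\<bar>) ^ q * exp (1 + \<bar>t\<bar>) * exp (1 / 3 - t ^ 2))"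
proof -
  obtain C where C: "\<And>t :: real. (1 + \<bar>t\<bar>) ^ q * exp (1 + \<bar>t\<bar>) * exp (1 / 3 - t ^ 2) \<le> C * exp (- (1 / 2) * t ^ 2)"
    using airy_dominated[of q] by blast
  have "integrable lborel (\<lambda>t. C * exp (- (1 / 2) * t ^ 2))"
    using integrable_exp_minus_square[of "1 / 2"] by simp
  then show ?thesis
  proof (rule Bochner_Integration.integrable_bound)
    show "AE t in lborel. norm ((1 + \<bar>t\<bar>) ^ q * exp (1 + \<bar>t\<bar>) * exp (1 / 3 - t ^ 2)) \<le> norm (C * exp (- (1 / 2) * t ^ 2))"
    proof (intro AE_I2)
      fix t :: real
      have "0 \<le> (1 + \<bar>t\<bar>) ^ q * exp (1 + \<bar>t\<bar>) * exp (1 / 3 - t ^ 2)" by simp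
      then show "norm ((1 + \<bar>t\<bar>) ^ q * exp (1 + \<bar>t\<bar>) * exp (1 / 3 - t ^ 2)) \<le> norm (C * exp (- (1 / 2) * t ^ 2))"
        using C[of t] unfolding real_norm_def by linarith
    qed
  qed auto
qed

lemma integrable_airy_bound':
  "integrable lborel (\<lambda>t :: real. (1 + \<bar>t\<bar>) ^ q * exp (1 / 3 - t ^ 2))"
  by (rule Bochner_Integration.integrable_bound[OF integrable_airy_bound[of q]])
     (auto intro!: AE_I2 simp: abs_mult power_abs)

lemma norm_airy_integrand:
  "norm (airy_wave j x t) \<le> exp (- x) * ((1 + \<bar>t\<bar>) ^ j * exp (1 / 3 - t ^ 2))"
  unfolding norm_mult norm_power norm_airy_weight norm_airy_exp
  using power_mono[OF norm_airy_path norm_ge_zero, of t j] by (simp add: mult_ac)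

lemma integrable_airy:
  "integrable lborel (\<lambda>t. airy_wave j x t)"
proof (rule Bochner_Integration.integrable_bound)
  show "integrable lborel (\<lambda>t. exp (- x) * ((1 + \<bar>t\<bar>) ^ j * exp (1 / 3 - t ^ 2)))"
    using integrable_airy_bound'[of j] by simp
qed (auto intro!: AE_I2 order_trans[OF norm_airy_integrand])

lemma norm_airy_moment: "\<exists>K. \<forall>x. norm (airy_moment j x) \<le> K * exp (- x)"
proof (intro exI allI)
  fix x
  have "norm (\<integral>t. airy_wave j x t \<partial>lborel)
     \<le> (\<integral>t. exp (- x) * ((1 + \<bar>t\<bar>) ^ j * exp (1 / 3 - t ^ 2)) \<partial>lborel)"
    by (rule Bochner_Integration.integral_norm_bound_integral[OF integrable_airy]) (use integrable_airy_bound'[of j] norm_airy_integrand in auto)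
  then show "norm (airy_moment j x) \<le> (\<integral>t. (1 + \<bar>t\<bar>) ^ j * exp (1 / 3 - t ^ 2) \<partial>lborel) / (2 * pi) * exp (- x)"
    by (simp add: airy_moment_def norm_divide norm_mult field_simps)
qed

lemma tendsto_integral_symmetric_interval:
  fixes f :: "real \<Rightarrow> complex"
  assumes f: "integrable lborel f"
  shows "((\<lambda>T. integral {- T..T} f) \<longlongrightarrow> (\<integral>t. f t \<partial>lborel)) at_top"
proof -
  have "((\<lambda>T. \<integral>t. indicator {- T..T} t *\<^sub>R f t \<partial>lborel) \<longlongrightarrow> (\<integral>t. f t \<partial>lborel)) at_top"
  proof (rule integral_dominated_convergence_at_top[where w = "\<lambda>t. norm (f t)"])
    show "AE t in lborel. ((\<lambda>T. indicator {- T..T} t *\<^sub>R f t) \<longlongrightarrow> f t) at_top"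
    proof (intro AE_I2 tendsto_eventually)
      fix t :: real
      show "\<forall>\<^sub>F T in at_top. indicator {- T..T} t *\<^sub>R f t = f t"
        using eventually_ge_at_top[of "\<bar>t\<bar>"] by eventually_elim (auto simp: indicator_def)
    qed
  qed (use f in \<open>auto simp: indicator_def\<close>)
  moreover have "(\<integral>t. indicator {- T..T} t *\<^sub>R f t \<partial>lborel) = integral {- T..T} f" for T
  proof -
    have "set_integrable lborel {- T..T} f"
      using integrable_mult_indicator[OF _ f, of "{- T..T}"] by (simp add: set_integrable_def)
    from set_borel_integral_eq_integral(2)[OF this] show ?thesis
      by (simp add: set_lebesgue_integral_def)
  qed
  ultimately show ?thesis by simp
qed

text \<open>The first-order Taylor remainder of the exponential is at most \<open>h ^ 2\<close>
  times an integrable function of \<open>t\<close>, so the difference quotient converges with an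
  explicit linear error.\<close>

lemma has_vector_derivative_airy_moment:
  "(airy_moment j has_vector_derivative \<i> * airy_moment (Suc j) x) (at x)"
proof -
  define I where "I = (\<lambda>j x t. airy_wave j x t)"
  define K where "K = exp (- x) / (2 * pi) * (\<integral>t. (1 + \<bar>t\<bar>) ^ (j + 2) * exp (1 + \<bar>t\<bar>) * exp (1 / 3 - t ^ 2) \<partial>lborel)"
  have int: "integrable lborel (I k y)" for k y unfolding I_def by (rule integrable_airy)
  have bound: "norm (airy_moment j (x + h) - airy_moment j x - h *\<^sub>R (\<i> * airy_moment (Suc j) x)) \<le> K * h ^ 2" if h: "\<bar>h\<bar> \<le> 1" for h
  proof -
    have le: "norm (\<integral>t. I j (x + h) t - I j x t - h *\<^sub>R (\<i> * I (Suc j) x t) \<partial>lborel)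
       \<le> (\<integral>t. exp (- x) * h ^ 2 * ((1 + \<bar>t\<bar>) ^ (j + 2) * exp (1 + \<bar>t\<bar>) * exp (1 / 3 - t ^ 2)) \<partial>lborel)"
    proof (rule Bochner_Integration.integral_norm_bound_integral)
      fix t
      define w where "w = \<i> * of_real h * airy_path t"
      have nw: "norm w \<le> \<bar>h\<bar> * (1 + \<bar>t\<bar>)"
        using norm_airy_path[of t] by (simp add: w_def norm_mult mult_left_mono)
      have "norm w \<le> 1 * (1 + \<bar>t\<bar>)" by (rule order_trans[OF nw mult_right_mono[OF h]]) simp
      then have "\<bar>Re w\<bar> \<le> 1 + \<bar>t\<bar>" using abs_Re_le_cmod[of w] by simp
      have "I j (x + h) t - I j x t - h *\<^sub>R (\<i> * I (Suc j) x t) = I j x t * (exp w - 1 - w)"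
        by (simp add: I_def w_def algebra_simps exp_add scaleR_conv_of_real)
      also have "norm \<dots> = norm (I j x t) * norm (exp w - (\<Sum>k\<le>1. w ^ k / fact k))"
        by (simp add: norm_mult diff_diff_eq)
      also have "\<dots> \<le> (exp (- x) * ((1 + \<bar>t\<bar>) ^ j * exp (1 / 3 - t ^ 2))) * (exp (1 + \<bar>t\<bar>) * (\<bar>h\<bar> * (1 + \<bar>t\<bar>)) ^ 2)"
      proof (rule mult_mono)
        show "norm (I j x t) \<le> exp (- x) * ((1 + \<bar>t\<bar>) ^ j * exp (1 / 3 - t ^ 2))"
          unfolding I_def by (rule norm_airy_integrand)
        have "norm (exp w - (\<Sum>k\<le>1. w ^ k / fact k)) \<le> exp \<bar>Re w\<bar> * norm w ^ 2"
          using Taylor_exp[of w 1] by (simp add: numeral_2_eq_2)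
        also have "\<dots> \<le> exp (1 + \<bar>t\<bar>) * (\<bar>h\<bar> * (1 + \<bar>t\<bar>)) ^ 2"
          using \<open>\<bar>Re w\<bar> \<le> 1 + \<bar>t\<bar>\<close> nw by (intro mult_mono power_mono) auto
        finally show "norm (exp w - (\<Sum>k\<le>1. w ^ k / fact k)) \<le> exp (1 + \<bar>t\<bar>) * (\<bar>h\<bar> * (1 + \<bar>t\<bar>)) ^ 2" .
      qed auto
      also have "\<dots> = exp (- x) * h ^ 2 * ((1 + \<bar>t\<bar>) ^ (j + 2) * exp (1 + \<bar>t\<bar>) * exp (1 / 3 - t ^ 2))"
        by (simp add: power_mult_distrib power_add power2_eq_square mult_ac)
      finally show "norm (I j (x + h) t - I j x t - h *\<^sub>R (\<i> * I (Suc j) x t))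
         \<le> exp (- x) * h ^ 2 * ((1 + \<bar>t\<bar>) ^ (j + 2) * exp (1 + \<bar>t\<bar>) * exp (1 / 3 - t ^ 2))" .
    qed (use int integrable_airy_bound[of "j + 2"] in auto)
    have eq: "(\<integral>t. I j (x + h) t - I j x t - h *\<^sub>R (\<i> * I (Suc j) x t) \<partial>lborel)
       = 2 * pi * (airy_moment j (x + h) - airy_moment j x - h *\<^sub>R (\<i> * airy_moment (Suc j) x))"
    proof -
      have am: "airy_moment k y = (\<integral>t. I k y t \<partial>lborel) / (2 * pi)" for k y
        by (simp add: airy_moment_def I_def)
      have eq: "(\<integral>t. I j (x + h) t - I j x t - h *\<^sub>R (\<i> * I (Suc j) x t) \<partial>lborel)
        = (\<integral>t. I j (x + h) t \<partial>lborel) - (\<integral>t. I j x t \<partial>lborel) - h *\<^sub>R (\<i> * (\<integral>t. I (Suc j) x t \<partial>lborel))"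
        using int by simp
      show ?thesis unfolding am eq by (simp add: field_simps scaleR_conv_of_real)
    qed
    define J where "J = ((\<integral>t. (1 + \<bar>t\<bar>) ^ (j + 2) * exp (1 + \<bar>t\<bar>) * exp (1 / 3 - t ^ 2) \<partial>lborel) :: real)"
    have "2 * pi * norm (airy_moment j (x + h) - airy_moment j x - h *\<^sub>R (\<i> * airy_moment (Suc j) x)) \<le> exp (- x) * h ^ 2 * J"
      using le unfolding eq norm_mult integral_mult_right_zero J_def by simp
    also have "exp (- x) * h ^ 2 * J = 2 * pi * (K * h ^ 2)" by (simp add: K_def J_def)
    finally show ?thesis by (rule mult_left_le_imp_le) simp
  qed
  show ?thesis
    unfolding has_vector_derivative_def has_derivative_at
  proof (intro conjI bounded_linear_scaleR_left)
    show "(\<lambda>h. norm (airy_moment j (x + h) - airy_moment j x - h *\<^sub>R (\<i> * airy_moment (Suc j) x)) / norm h) \<midarrow>0\<rightarrow> 0"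
    proof (rule tendsto_sandwich[OF _ _ tendsto_const])
      show "\<forall>\<^sub>F h in at 0. norm (airy_moment j (x + h) - airy_moment j x - h *\<^sub>R (\<i> * airy_moment (Suc j) x)) / norm h \<le> K * \<bar>h\<bar>"
      proof -
        have "\<forall>\<^sub>F h :: real in at 0. \<bar>h\<bar> < 1" by (auto simp: eventually_at intro!: exI[of _ 1])
        then show ?thesis
        proof eventually_elim
          case (elim h)
          then show ?case using bound[of h] by (cases "h = 0") (auto simp: field_simps power2_eq_square abs_if split: if_splits)
        qed
      qed
      show "((\<lambda>h. K * \<bar>h\<bar>) \<longlongrightarrow> 0) (at (0 :: real))" by (auto intro!: tendsto_eq_intros)
    qed auto
  qed
qed

text \<open>Contour shift from the real axis to the line of height 1. The integrand is entire, so
  all sides of the rectangle are differences of one primitive \<open>F\<close>. At height t of the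
  sides at \<plusminus>T the integrand is of size exp (- T^2 t), which integrates to order 1 /
  T^2.\<close>

lemma airy_cos_integral:
  "((\<lambda>T. complex_of_real (integral {0..T} (\<lambda>t. cos (t ^ 3 / 3 + x * t)))) \<longlongrightarrow> pi * airy_moment 0 x) at_top"
proof -
  define g where "g = (\<lambda>z :: complex. exp (\<i> * (z ^ 3 / 3 + of_real x * z)))"
  have "g holomorphic_on UNIV" unfolding g_def by (intro holomorphic_intros) auto
  then obtain F where F: "\<And>z. (F has_field_derivative g z) (at z)"
    using holomorphic_convex_primitive'[of UNIV g] by (metis UNIV_I convex_UNIV open_UNIV)
  have Fvec: "((\<lambda>t. F (of_real t * a + c)) has_vector_derivative a * g (of_real t * a + c)) (at t within S)" for a c :: complex and t :: real and S
  proof -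
    have "((\<lambda>t. of_real t * a + c) has_vector_derivative a) (at t within S)"
      by (auto intro!: derivative_eq_intros simp: has_vector_derivative_def scaleR_conv_of_real)
    from field_vector_diff_chain_within[OF this has_field_derivative_at_within[OF F]] show ?thesis
      by (simp add: o_def)
  qed
  have FTC: "((\<lambda>t. a * g (of_real t * a + c)) has_integral F (of_real v * a + c) - F (of_real u * a + c)) {u..v}" if "u \<le> v" for a c u v
    by (rule fundamental_theorem_of_calculus[OF that Fvec])
  have side: "norm (F (of_real T + \<i>) - F (of_real T)) \<le> exp (1 / 3 + \<bar>x\<bar>) / T ^ 2" if "T \<noteq> 0" for T
  proof -
    have I: "((\<lambda>t. \<i> * g (of_real t * \<i> + of_real T)) has_integral F (of_real T + \<i>) - F (of_real T)) {0..1}"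
      using FTC[of 0 1 "\<i>" "of_real T"] by (simp add: add.commute)
    have J: "((\<lambda>t. exp (1 / 3 + \<bar>x\<bar>) * exp (- (T ^ 2) * t)) has_integral exp (1 / 3 + \<bar>x\<bar>) * (exp (- (T ^ 2) * 1) / (- (T ^ 2))) - exp (1 / 3 + \<bar>x\<bar>) * (exp (- (T ^ 2) * 0) / (- (T ^ 2)))) {0..1}"
    proof -
      have "((\<lambda>t. exp (1 / 3 + \<bar>x\<bar>) * (exp (- D * t) / (- D))) has_real_derivative exp (1 / 3 + \<bar>x\<bar>) * exp (- D * t)) (at t within {0..1})" if "D \<noteq> 0" for D t :: real
        using that by (auto intro!: derivative_eq_intros)
      from this[of "T ^ 2"] that show ?thesis
        by (intro fundamental_theorem_of_calculus) (auto simp flip: has_real_derivative_iff_has_vector_derivative)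
    qed
    have "norm (F (of_real T + \<i>) - F (of_real T)) \<le> exp (1 / 3 + \<bar>x\<bar>) * (exp (- (T ^ 2) * 1) / (- (T ^ 2))) - exp (1 / 3 + \<bar>x\<bar>) * (exp (- (T ^ 2) * 0) / (- (T ^ 2)))"
      unfolding integral_unique[OF I, symmetric] integral_unique[OF J, symmetric]
    proof (rule Henstock_Kurzweil_Integration.integral_norm_bound_integral)
      fix t :: real assume t: "t \<in> {0..1}"
      have "norm (\<i> * g (of_real t * \<i> + of_real T)) = exp (t ^ 3 / 3 - x * t - T ^ 2 * t)"
        unfolding g_def by (simp add: norm_mult power3_eq_cube power2_eq_square algebra_simps) (simp add: field_simps)
      also have "\<dots> \<le> exp ((1 / 3 + \<bar>x\<bar>) - T ^ 2 * t)"
      proof -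
        have "t ^ 3 \<le> 1" using t by (simp add: power_le_one)
        moreover have "- (x * t) \<le> \<bar>x\<bar>"
        proof -
          have "- x * t \<le> \<bar>x\<bar> * t" using t by (intro mult_right_mono) auto
          also have "\<dots> \<le> \<bar>x\<bar> * 1" using t by (intro mult_left_mono) auto
          finally show ?thesis by simp
        qed
        ultimately show ?thesis by simp
      qed
      finally show "norm (\<i> * g (of_real t * \<i> + of_real T)) \<le> exp (1 / 3 + \<bar>x\<bar>) * exp (- (T ^ 2) * t)"
        by (simp flip: exp_add)
    qed (use I J in auto)
    also have "\<dots> = exp (1 / 3 + \<bar>x\<bar>) / T ^ 2 * (1 - exp (- (T ^ 2)))"
      using that by (simp add: field_simps)
    also have "\<dots> \<le> exp (1 / 3 + \<bar>x\<bar>) / T ^ 2 * 1"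
      by (intro mult_left_mono) auto
    finally show ?thesis by simp
  qed
  have lim0: "((\<lambda>T. exp (1 / 3 + \<bar>x\<bar>) / T ^ 2) \<longlongrightarrow> 0) at_top" by real_asymp
  have sides: "((\<lambda>T. F (of_real T + \<i>) - F (of_real T)) \<longlongrightarrow> 0) at_top" "((\<lambda>T. F (- of_real T + \<i>) - F (- of_real T)) \<longlongrightarrow> 0) at_top"
  proof -
    show "((\<lambda>T. F (of_real T + \<i>) - F (of_real T)) \<longlongrightarrow> 0) at_top"
    proof (rule Lim_null_comparison[OF _ lim0])
      show "\<forall>\<^sub>F T in at_top. norm (F (of_real T + \<i>) - F (of_real T)) \<le> exp (1 / 3 + \<bar>x\<bar>) / T ^ 2"
        using eventually_gt_at_top[of 0] by eventually_elim (rule side, auto)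
    qed
    show "((\<lambda>T. F (- of_real T + \<i>) - F (- of_real T)) \<longlongrightarrow> 0) at_top"
    proof (rule Lim_null_comparison[OF _ lim0])
      show "\<forall>\<^sub>F T in at_top. norm (F (- of_real T + \<i>) - F (- of_real T)) \<le> exp (1 / 3 + \<bar>x\<bar>) / T ^ 2"
        using eventually_gt_at_top[of 0] 
      proof eventually_elim
        case (elim T)
        then show ?case using side[of "- T"] by simp
      qed
    qed
  qed
  have gI: "g (of_real t + \<i>) = airy_weight t * exp (\<i> * of_real x * airy_path t)" for t
    unfolding g_def airy_weight_def airy_path_def by (simp add: algebra_simps flip: exp_add)
  have "((\<lambda>T. integral {- T..T} (\<lambda>t. g (of_real t + \<i>))) \<longlongrightarrow> (\<integral>t. g (of_real t + \<i>) \<partial>lborel)) at_top"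
    by (rule tendsto_integral_symmetric_interval) (use integrable_airy[of 0 x] in \<open>simp add: gI\<close>)
  also have "(\<integral>t. g (of_real t + \<i>) \<partial>lborel) = 2 * pi * airy_moment 0 x"
    by (simp add: gI airy_moment_def)
  finally have L1: "((\<lambda>T. integral {- T..T} (\<lambda>t. g (of_real t + \<i>))) \<longlongrightarrow> 2 * pi * airy_moment 0 x) at_top" .
  have "((\<lambda>T. integral {- T..T} (\<lambda>t. g (of_real t + \<i>)) - (F (of_real T + \<i>) - F (of_real T)) + (F (- of_real T + \<i>) - F (- of_real T)))
      \<longlongrightarrow> 2 * pi * airy_moment 0 x - 0 + 0) at_top"
    by (intro tendsto_intros L1 sides)
  then have "((\<lambda>T. complex_of_real (2 * integral {0..T} (\<lambda>t. cos (t ^ 3 / 3 + x * t)))) \<longlongrightarrow> 2 * pi * airy_moment 0 x - 0 + 0) at_top"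
  proof (rule Lim_transform_eventually)
    show "\<forall>\<^sub>F T in at_top. integral {- T..T} (\<lambda>t. g (of_real t + \<i>)) - (F (of_real T + \<i>) - F (of_real T)) + (F (- of_real T + \<i>) - F (- of_real T))
       = complex_of_real (2 * integral {0..T} (\<lambda>t. cos (t ^ 3 / 3 + x * t)))"
      using eventually_ge_at_top[of 0]
    proof eventually_elim
      case (elim T)
      have top: "integral {- T..T} (\<lambda>t. g (of_real t + \<i>)) = F (of_real T + \<i>) - F (- of_real T + \<i>)"
        using FTC[of "- T" T 1 "\<i>"] elim by (intro integral_unique) simp
      have A: "((\<lambda>t. g (of_real t)) has_integral F (of_real T) - F 0) {0..T}"
        using FTC[of 0 T 1 0] elim by simp
      have "((\<lambda>t. - g (- of_real t)) has_integral F (- of_real T) - F 0) {0..T}"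
        using FTC[of 0 T "- 1" 0] elim by simp
      then have B: "((\<lambda>t. - (- g (- of_real t))) has_integral - (F (- of_real T) - F 0)) {0..T}"
        by (rule has_integral_neg)
      have gsum: "g (of_real t) + g (- of_real t) = complex_of_real (2 * cos (t ^ 3 / 3 + x * t))" for t
      proof -
        have "g (of_real t) = cis (t ^ 3 / 3 + x * t)" "g (- of_real t) = cis (- (t ^ 3 / 3 + x * t))"
          unfolding g_def cis_conv_exp by simp_all
        moreover have "cis u + cis (- u) = complex_of_real (2 * cos u)" for u
          by (simp add: complex_eq_iff)
        ultimately show ?thesis by metis
      qed
      have I1: "((\<lambda>t. complex_of_real (2 * cos (t ^ 3 / 3 + x * t))) has_integral (F (of_real T) - F 0) + - (F (- of_real T) - F 0)) {0..T}"
        unfolding gsum[symmetric] using has_integral_add[OF A B] by simp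
      have I2: "((\<lambda>t. complex_of_real (2 * cos (t ^ 3 / 3 + x * t))) has_integral complex_of_real (2 * integral {0..T} (\<lambda>t. cos (t ^ 3 / 3 + x * t)))) {0..T}"
      proof -
        have "(\<lambda>t. cos (t ^ 3 / 3 + x * t)) integrable_on {0..T}"
          by (intro integrable_continuous_real continuous_intros) auto
        then show ?thesis
          by (intro has_integral_of_real has_integral_mult_right integrable_integral)
      qed
      show ?case unfolding top has_integral_unique[OF I2 I1] by simp
    qed
  qed
  then have "((\<lambda>T. complex_of_real (2 * integral {0..T} (\<lambda>t. cos (t ^ 3 / 3 + x * t))) / 2) \<longlongrightarrow> (2 * pi * airy_moment 0 x - 0 + 0) / 2) at_top"
    by (rule tendsto_divide) auto
  then show ?thesis by simp
qed

lemma of_real_Airy_Ai: "complex_of_real (Airy_Ai x) = airy_moment 0 x"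
proof -
  note L = airy_cos_integral[of x]
  have "((\<lambda>T. integral {0..T} (\<lambda>t. cos (t ^ 3 / 3 + x * t))) \<longlongrightarrow> Re (pi * airy_moment 0 x)) at_top"
    using tendsto_Re[OF L] by simp
  then have "Airy_Ai x = Re (airy_moment 0 x)"
    unfolding Airy_Ai_def by (subst tendsto_Lim) auto
  moreover have "((\<lambda>T :: real. 0 :: real) \<longlongrightarrow> Im (pi * airy_moment 0 x)) at_top"
    using tendsto_Im[OF L] by simp
  then have "Im (airy_moment 0 x) = 0" by (simp add: tendsto_const_iff)
  ultimately show ?thesis by (simp add: complex_eq_iff)
qed

text \<open>This is the Airy equation: the derivative of exp (\<i> (z^3 / 3 + x z)) along the line
  integrates to zero, because the function vanishes at both ends.\<close>

lemma airy_moment_2: "airy_moment 2 x = - of_real x * airy_moment 0 x"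
proof -
  define h where "h = (\<lambda>t. airy_weight t * exp (\<i> * of_real x * airy_path t))"
  have hexp: "h t = exp (\<i> * (airy_path t ^ 3 / 3 + of_real x * airy_path t))" for t
    by (simp add: h_def airy_weight_def exp_add algebra_simps)
  have int: "integrable lborel (\<lambda>t. \<i> * (airy_path t ^ 2 + of_real x) * h t)"
  proof -
    have "integrable lborel (\<lambda>t. \<i> * airy_wave 2 x t + \<i> * of_real x * airy_wave 0 x t)"
      by (intro Bochner_Integration.integrable_add integrable_mult_right integrable_airy)
    then show ?thesis by (simp add: h_def algebra_simps)
  qed
  have path: "(airy_path has_vector_derivative 1) (at t within S)" for t S
    unfolding airy_path_def[abs_def] by (auto intro!: derivative_eq_intros simp: has_vector_derivative_def scaleR_conv_of_real)
  have deriv: "(h has_vector_derivative \<i> * (airy_path t ^ 2 + of_real x) * h t) (at t within S)" for t S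
  proof -
    have "((\<lambda>z. exp (\<i> * (z ^ 3 / 3 + of_real x * z))) has_field_derivative
       exp (\<i> * (z ^ 3 / 3 + of_real x * z)) * (\<i> * (z ^ 2 + of_real x))) (at z within T)" for z T
      by (auto intro!: derivative_eq_intros)
    from field_vector_diff_chain_within[OF path this] show ?thesis
      unfolding hexp[abs_def] by (simp add: o_def mult_ac)
  qed
  have "((\<lambda>T. integral {- T..T} (\<lambda>t. \<i> * (airy_path t ^ 2 + of_real x) * h t)) \<longlongrightarrow> (\<integral>t. \<i> * (airy_path t ^ 2 + of_real x) * h t \<partial>lborel)) at_top"
    by (rule tendsto_integral_symmetric_interval[OF int])
  moreover have "((\<lambda>T. integral {- T..T} (\<lambda>t. \<i> * (airy_path t ^ 2 + of_real x) * h t)) \<longlongrightarrow> 0) at_top"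
  proof (rule Lim_null_comparison)
    have nh: "norm (h t) = exp (- x) * exp (1 / 3 - t ^ 2)" for t
      by (simp add: h_def norm_mult norm_airy_weight norm_airy_exp del: norm_exp_eq_Re)
    show "\<forall>\<^sub>F T in at_top. norm (integral {- T..T} (\<lambda>t. \<i> * (airy_path t ^ 2 + of_real x) * h t)) \<le> 2 * exp (- x) * exp (1 / 3 - T ^ 2)"
      using eventually_ge_at_top[of 0]
    proof eventually_elim
      case (elim T)
      have "integral {- T..T} (\<lambda>t. \<i> * (airy_path t ^ 2 + of_real x) * h t) = h T - h (- T)"
        using elim by (intro integral_unique fundamental_theorem_of_calculus deriv) auto
      also have "norm \<dots> \<le> norm (h T) + norm (h (- T))" by (rule norm_triangle_ineq4)
      finally show ?case by (simp add: nh)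
    qed
    show "((\<lambda>T. 2 * exp (- x) * exp (1 / 3 - T ^ 2)) \<longlongrightarrow> 0) at_top" by real_asymp
  qed
  ultimately have "(\<integral>t. \<i> * (airy_path t ^ 2 + of_real x) * h t \<partial>lborel) = 0"
    by (rule tendsto_unique[rotated]) simp
  moreover have "(\<integral>t. \<i> * (airy_path t ^ 2 + of_real x) * h t \<partial>lborel) =
     (\<integral>t. \<i> * airy_wave 2 x t + \<i> * of_real x * airy_wave 0 x t \<partial>lborel)"
    by (simp add: h_def algebra_simps)
  moreover have "\<dots> = \<i> * (\<integral>t. airy_wave 2 x t \<partial>lborel)
      + \<i> * of_real x * (\<integral>t. airy_wave 0 x t \<partial>lborel)"
    using integrable_airy[of 2 x] integrable_airy[of 0 x] by simp
  ultimately have "\<i> * ((\<integral>t. airy_wave 2 x t \<partial>lborel)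
      + of_real x * (\<integral>t. airy_wave 0 x t \<partial>lborel)) = 0"
    by (simp add: algebra_simps)
  then have "(\<integral>t. airy_wave 2 x t \<partial>lborel)
      = - of_real x * (\<integral>t. airy_wave 0 x t \<partial>lborel)"
    by (simp add: add_eq_0_iff2)
  then show ?thesis by (simp add: airy_moment_def)
qed

lemma has_real_derivative_airy_moment:
  "((\<lambda>x. Re (c * airy_moment j x)) has_real_derivative Re (c * (\<i> * airy_moment (Suc j) x))) (at x)"
  unfolding has_real_derivative_iff_has_vector_derivative
  by (rule bounded_linear.has_vector_derivative[OF bounded_linear_Re])
     (rule bounded_linear.has_vector_derivative[OF bounded_linear_mult_right has_vector_derivative_airy_moment])

lemma DERIV_Airy_Ai: "(Airy_Ai has_real_derivative deriv Airy_Ai x) (at x)"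
proof -
  have "Airy_Ai = (\<lambda>x. Re (1 * airy_moment 0 x))"
    by (simp flip: of_real_Airy_Ai)
  then show ?thesis using has_real_derivative_airy_moment[of 1 0] DERIV_imp_deriv by metis
qed

lemma deriv_Airy_Ai: "deriv Airy_Ai x = Re (\<i> * airy_moment 1 x)"
proof -
  have "Airy_Ai = (\<lambda>x. Re (1 * airy_moment 0 x))"
    by (simp flip: of_real_Airy_Ai)
  then show ?thesis using has_real_derivative_airy_moment[of 1 0] DERIV_imp_deriv by fastforce
qed

lemma airy_equation: "(deriv Airy_Ai has_real_derivative x * Airy_Ai x) (at x)"
proof -
  have "Re (\<i> * (\<i> * airy_moment (Suc 1) x)) = x * Airy_Ai x"
    using airy_moment_2[of x] by (simp add: numeral_2_eq_2 flip: of_real_Airy_Ai)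
  then show ?thesis using has_real_derivative_airy_moment[of \<i> 1 x] unfolding deriv_Airy_Ai[abs_def] by simp
qed

text \<open>The height 1 of the contour gives the factor \<open>exp (- x)\<close>. This is far
  weaker than the true decay, but it is enough for the integrals over the half-line.\<close>

lemma Airy_Ai_bound:
  "\<exists>K. \<forall>x. \<bar>Airy_Ai x\<bar> \<le> K * exp (- x) \<and> \<bar>deriv Airy_Ai x\<bar> \<le> K * exp (- x)"
proof -
  obtain K0 where K0: "\<And>x. norm (airy_moment 0 x) \<le> K0 * exp (- x)" using norm_airy_moment[of 0] by blast
  obtain K1 where K1: "\<And>x. norm (airy_moment 1 x) \<le> K1 * exp (- x)" using norm_airy_moment[of 1] by blast
  define K where "K = max 1 (max K0 K1)"
  have "K0 * exp (- x) \<le> K * exp (- x)" "K1 * exp (- x) \<le> K * exp (- x)" for x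
    by (auto intro!: mult_right_mono simp: K_def)
  moreover have "\<bar>Airy_Ai x\<bar> \<le> K0 * exp (- x)" for x
    using K0[of x] by (simp flip: of_real_Airy_Ai)
  moreover have "\<bar>deriv Airy_Ai x\<bar> \<le> K1 * exp (- x)" for x
    using K1[of x] abs_Re_le_cmod[of "\<i> * airy_moment 1 x"] unfolding deriv_Airy_Ai by (simp add: norm_mult)
  ultimately have "\<bar>Airy_Ai x\<bar> \<le> K * exp (- x)" "\<bar>deriv Airy_Ai x\<bar> \<le> K * exp (- x)" for x
    by (meson order_trans)+
  then show ?thesis by blast
qed

lemma continuous_Airy_Ai: "isCont Airy_Ai x" "isCont (deriv Airy_Ai) x"
  by (rule DERIV_isCont, rule DERIV_Airy_Ai, rule DERIV_isCont, rule airy_equation)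

lemma measurable_Airy_Ai [measurable]: "Airy_Ai \<in> borel_measurable borel"
  by (intro borel_measurable_continuous_onI continuous_at_imp_continuous_on) (auto intro: continuous_Airy_Ai)

section \<open>The differentiated kernel as an integral over the half-line\<close>

definition airy_integrand :: "real \<Rightarrow> real \<Rightarrow> real \<Rightarrow> real" where
  "airy_integrand x y u = indicator {0..} u * (u * Airy_Ai (x + u) * Airy_Ai (y + u))"

lemma integrable_exp_decay: "integrable lborel (\<lambda>u :: real. indicator {0..} u * exp (- u))"
proof -
  have "integrable lborel (\<lambda>u :: real. indicator {0<..} u * exp (- u))"
    using integrable_I0i_exp_mscale[of 1] by (simp add: set_integrable_def)
  then show ?thesis
    by (rule integrable_discrete_difference[where X = "{0}", THEN iffD1, rotated -1]) (auto simp: indicator_def)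
qed

lemma exp_ge_self: "u \<le> exp (u :: real)"
  using exp_ge_add_one_self[of u] by linarith

lemma airy_integrand_bound:
  assumes K: "\<And>x. \<bar>Airy_Ai x\<bar> \<le> K * exp (- x)"
  shows "\<bar>airy_integrand x y u\<bar> \<le> K ^ 2 * exp (- x - y) * (indicator {0..} u * exp (- u))"
proof (cases "u \<ge> 0")
  case True
  have "\<bar>Airy_Ai (x + u)\<bar> * \<bar>Airy_Ai (y + u)\<bar> \<le> (K * exp (- (x + u))) * (K * exp (- (y + u)))"
    by (intro mult_mono K order_trans[OF abs_ge_zero K]) auto
  then have "u * (\<bar>Airy_Ai (x + u)\<bar> * \<bar>Airy_Ai (y + u)\<bar>) \<le> exp u * ((K * exp (- (x + u))) * (K * exp (- (y + u))))"
    by (rule mult_mono[OF exp_ge_self]) auto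
  also have "\<dots> = K ^ 2 * (exp u * exp (- (x + u)) * exp (- (y + u)))"
    by (simp add: power2_eq_square mult_ac)
  also have "exp u * exp (- (x + u)) * exp (- (y + u)) = exp (- x - y) * exp (- u)"
    by (simp flip: exp_add)
  finally show ?thesis using True by (simp add: airy_integrand_def abs_mult mult.assoc)
qed (auto simp: airy_integrand_def)

lemma measurable_airy_integrand [measurable]: "airy_integrand x y \<in> borel_measurable borel"
  unfolding airy_integrand_def[abs_def] by measurable

lemma integrable_airy_integrand: "integrable lborel (airy_integrand x y)"
proof -
  obtain K where K: "\<And>x. \<bar>Airy_Ai x\<bar> \<le> K * exp (- x)" using Airy_Ai_bound by blast
  have "integrable lborel (\<lambda>u. K ^ 2 * exp (- x - y) * (indicator {0..} u * exp (- u)))"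
    using integrable_exp_decay by simp
  then show ?thesis
    by (rule Bochner_Integration.integrable_bound)
       (auto intro!: AE_I2 order_trans[OF airy_integrand_bound[OF K]])
qed

text \<open>By the Airy equation the Wronskian W of the two shifted functions has derivative (y - x)
  times their product, so integration by parts yields the term u W / (x - y). The leftover W / (x -
  y) is minus the derivative of the kernel under a common shift of both arguments.\<close>

lemma airy_antiderivative:
  assumes xy: "x \<noteq> y"
  shows "((\<lambda>u. u * ((Airy_Ai (x + u) * deriv Airy_Ai (y + u) - deriv Airy_Ai (x + u) * Airy_Ai (y + u)) / (x - y))
      + airy_kernel_off_diag (x + u) (y + u)) has_real_derivative - (u * Airy_Ai (x + u) * Airy_Ai (y + u))) (at u)"
proof -
  define A where "A = (\<lambda>v. Airy_Ai (x + v))"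
  define B where "B = (\<lambda>v. Airy_Ai (y + v))"
  define A' where "A' = (\<lambda>v. deriv Airy_Ai (x + v))"
  define B' where "B' = (\<lambda>v. deriv Airy_Ai (y + v))"
  have D: "(A has_real_derivative A' v) (at v)" "(B has_real_derivative B' v) (at v)"
    "(A' has_real_derivative (x + v) * A v) (at v)" "(B' has_real_derivative (y + v) * B v) (at v)" for v
    unfolding A_def B_def A'_def B'_def
    by (auto intro!: DERIV_chain2[OF DERIV_Airy_Ai, THEN DERIV_cong] DERIV_chain2[OF airy_equation, THEN DERIV_cong] derivative_eq_intros)
  define d where "d = x - y"
  have d: "d \<noteq> 0" "y = x - d" using xy by (auto simp: d_def)
  have "((\<lambda>u. u * ((A u * B' u - A' u * B u) / d)
      + ((2 * A u * B' u - 2 * A' u * B u) / d ^ 3 + ((x + u + (y + u)) * A u * B u - 2 * A' u * B' u) / d ^ 2)) has_real_derivative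
      ((A u * B' u - A' u * B u) / d + u * ((A u * ((y + u) * B u) - (x + u) * A u * B u) / d)
      + ((2 * (A u * ((y + u) * B u)) - 2 * ((x + u) * A u * B u)) / d ^ 3 
        + (2 * A u * B u + (x + u + (y + u)) * (A' u * B u + A u * B' u) - 2 * ((x + u) * A u * B' u + A' u * ((y + u) * B u))) / d ^ 2))) (at u)"
  proof -
    \<comment> \<open>The powers of \<open>1 / d\<close> are replaced by free constants, so that no
      quotient is differentiated.\<close>
    have "((\<lambda>u. u * ((A u * B' u - A' u * B u) * i1)
      + ((2 * A u * B' u - 2 * A' u * B u) * i3 + ((x + u + (y + u)) * A u * B u - 2 * A' u * B' u) * i2)) has_real_derivative
      ((A u * B' u - A' u * B u) * i1 + u * ((A u * ((y + u) * B u) - (x + u) * A u * B u) * i1)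
      + ((2 * (A u * ((y + u) * B u)) - 2 * ((x + u) * A u * B u)) * i3 
        + (2 * A u * B u + (x + u + (y + u)) * (A' u * B u + A u * B' u) - 2 * ((x + u) * A u * B' u + A' u * ((y + u) * B u))) * i2))) (at u)" for i1 i2 i3
      by (auto intro!: derivative_eq_intros D simp: algebra_simps)
    from this[of "1 / d" "1 / d ^ 3" "1 / d ^ 2"] show ?thesis by (simp only: times_divide_eq_right mult_1_right)
  qed
  also have "((A u * B' u - A' u * B u) / d + u * ((A u * ((y + u) * B u) - (x + u) * A u * B u) / d)
      + ((2 * (A u * ((y + u) * B u)) - 2 * ((x + u) * A u * B u)) / d ^ 3 
        + (2 * A u * B u + (x + u + (y + u)) * (A' u * B u + A u * B' u) - 2 * ((x + u) * A u * B' u + A' u * ((y + u) * B u))) / d ^ 2))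
     = - (u * A u * B u)"
    unfolding d(2) using d(1) by (simp add: field_simps power2_eq_square power3_eq_cube)
  finally show ?thesis
    unfolding airy_kernel_off_diag_def A_def B_def A'_def B'_def d_def by simp
qed

lemma airy_kernel_eq_integral:
  assumes xy: "x \<noteq> y"
  shows "airy_kernel_off_diag x y = (\<integral>u. airy_integrand x y u \<partial>lborel)"
proof -
  obtain K where K: "\<And>x. \<bar>Airy_Ai x\<bar> \<le> K * exp (- x)" "\<And>x. \<bar>deriv Airy_Ai x\<bar> \<le> K * exp (- x)"
    using Airy_Ai_bound by blast
  define G where "G = (\<lambda>u. u * ((Airy_Ai (x + u) * deriv Airy_Ai (y + u) - deriv Airy_Ai (x + u) * Airy_Ai (y + u)) / (x - y))
      + airy_kernel_off_diag (x + u) (y + u))"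
  have lims: "((\<lambda>u. Airy_Ai (z + u)) \<longlongrightarrow> 0) at_top" "((\<lambda>u. deriv Airy_Ai (z + u)) \<longlongrightarrow> 0) at_top"
    "((\<lambda>u. u * Airy_Ai (z + u)) \<longlongrightarrow> 0) at_top" "((\<lambda>u. u * deriv Airy_Ai (z + u)) \<longlongrightarrow> 0) at_top" for z
  proof -
    have e: "((\<lambda>u. K * exp (- (z + u))) \<longlongrightarrow> 0) at_top" "((\<lambda>u. u * (K * exp (- (z + u)))) \<longlongrightarrow> 0) at_top"
      by real_asymp+
    have k: "norm (Airy_Ai (z + u)) \<le> K * exp (- (z + u))" "norm (deriv Airy_Ai (z + u)) \<le> K * exp (- (z + u))" for u
      using K(1)[of "z + u"] K(2)[of "z + u"] by simp_all
    have k': "norm (u * Airy_Ai (z + u)) \<le> u * (K * exp (- (z + u)))" "norm (u * deriv Airy_Ai (z + u)) \<le> u * (K * exp (- (z + u)))" if "0 \<le> u" for u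
      using that mult_left_mono[OF k(1) that] mult_left_mono[OF k(2) that] by (simp_all add: abs_mult)
    show "((\<lambda>u. Airy_Ai (z + u)) \<longlongrightarrow> 0) at_top" "((\<lambda>u. deriv Airy_Ai (z + u)) \<longlongrightarrow> 0) at_top"
      by (rule Lim_null_comparison[OF always_eventually[OF allI[OF k(1)]] e(1)])
         (rule Lim_null_comparison[OF always_eventually[OF allI[OF k(2)]] e(1)])
    show "((\<lambda>u. u * Airy_Ai (z + u)) \<longlongrightarrow> 0) at_top" "((\<lambda>u. u * deriv Airy_Ai (z + u)) \<longlongrightarrow> 0) at_top"
      by (rule Lim_null_comparison[OF eventually_mono[OF eventually_ge_at_top[of 0] k'(1)] e(2)], assumption,
          rule Lim_null_comparison[OF eventually_mono[OF eventually_ge_at_top[of 0] k'(2)] e(2)], assumption)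
  qed
  \<comment> \<open>Every factor \<open>u\<close> is attached to an Airy function, whose exponential
    decay makes the product vanish at infinity.\<close>
  have Geq: "G u = ((u * Airy_Ai (x + u)) * deriv Airy_Ai (y + u) - (u * deriv Airy_Ai (x + u)) * Airy_Ai (y + u)) / (x - y)
      + ((2 * Airy_Ai (x + u) * deriv Airy_Ai (y + u) - 2 * deriv Airy_Ai (x + u) * Airy_Ai (y + u)) / (x - y) ^ 3
       + ((x + y) * Airy_Ai (x + u) * Airy_Ai (y + u) + 2 * (u * Airy_Ai (x + u)) * Airy_Ai (y + u) - 2 * deriv Airy_Ai (x + u) * deriv Airy_Ai (y + u)) / (x - y) ^ 2)" for u
    by (simp add: G_def airy_kernel_off_diag_def algebra_simps)
  have "(G \<longlongrightarrow> (0 * 0 - 0 * 0) / (x - y) + ((2 * 0 * 0 - 2 * 0 * 0) / (x - y) ^ 3 + ((x + y) * 0 * 0 + 2 * 0 * 0 - 2 * 0 * 0) / (x - y) ^ 2)) at_top"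
    unfolding Geq[abs_def] using xy by (intro tendsto_intros lims) auto
  then have G0: "(G \<longlongrightarrow> 0) at_top" by simp
  have "((\<lambda>T. \<integral>u. indicator {..T} u * airy_integrand x y u \<partial>lborel) \<longlongrightarrow> (\<integral>u. airy_integrand x y u \<partial>lborel)) at_top"
  proof (rule integral_dominated_convergence_at_top[where w = "\<lambda>u. norm (airy_integrand x y u)"])
    show "AE u in lborel. ((\<lambda>T. indicator {..T} u * airy_integrand x y u) \<longlongrightarrow> airy_integrand x y u) at_top"
    proof (intro AE_I2 tendsto_eventually)
      fix u :: real
      show "\<forall>\<^sub>F T in at_top. indicator {..T} u * airy_integrand x y u = airy_integrand x y u"
        using eventually_ge_at_top[of u] by eventually_elim auto
    qed
  qed (use integrable_airy_integrand[of x y] in \<open>auto simp: indicator_def\<close>)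
  moreover have "((\<lambda>T. \<integral>u. indicator {..T} u * airy_integrand x y u \<partial>lborel) \<longlongrightarrow> G 0 - 0) at_top"
  proof (rule Lim_transform_eventually)
    show "((\<lambda>T. G 0 - G T) \<longlongrightarrow> G 0 - 0) at_top" by (intro tendsto_intros G0)
    show "\<forall>\<^sub>F T in at_top. G 0 - G T = (\<integral>u. indicator {..T} u * airy_integrand x y u \<partial>lborel)"
      using eventually_ge_at_top[of 0]
    proof eventually_elim
      case (elim T)
      have f: "((\<lambda>u. - (u * Airy_Ai (x + u) * Airy_Ai (y + u))) has_integral G T - G 0) {0..T}"
        unfolding G_def using elim
        by (rule fundamental_theorem_of_calculus)
           (rule has_real_derivative_iff_has_vector_derivative[THEN iffD1, OF has_field_derivative_at_within[OF airy_antiderivative[OF xy]]])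
      have "set_integrable lborel {0..T} (\<lambda>u. u * Airy_Ai (x + u) * Airy_Ai (y + u))"
      proof (rule borel_integrable_atLeastAtMost')
        have "isCont (\<lambda>u. Airy_Ai (z + u)) u" for z u
          unfolding isCont_def by (intro isCont_tendsto_compose[OF continuous_Airy_Ai(1)] tendsto_intros)
        then show "continuous_on {0..T} (\<lambda>u. u * Airy_Ai (x + u) * Airy_Ai (y + u))"
          by (intro continuous_at_imp_continuous_on ballI continuous_intros) auto
      qed
      from set_borel_integral_eq_integral(2)[OF this]
      have "(\<integral>u. indicator {0..T} u * (u * Airy_Ai (x + u) * Airy_Ai (y + u)) \<partial>lborel) = integral {0..T} (\<lambda>u. u * Airy_Ai (x + u) * Airy_Ai (y + u))"
        by (simp add: set_lebesgue_integral_def)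
      also have "\<dots> = G 0 - G T"
        using has_integral_neg[OF f] by (intro integral_unique) simp
      also have "(\<integral>u. indicator {0..T} u * (u * Airy_Ai (x + u) * Airy_Ai (y + u)) \<partial>lborel) = (\<integral>u. indicator {..T} u * airy_integrand x y u \<partial>lborel)"
        by (intro Bochner_Integration.integral_cong) (auto simp: airy_integrand_def indicator_def)
      finally show ?case by simp
    qed
  qed
  ultimately have "(\<integral>u. airy_integrand x y u \<partial>lborel) = G 0 - 0"
    by (rule tendsto_unique[OF trivial_limit_at_top_linorder])
  then show ?thesis by (simp add: G_def)
qed

text \<open>Joint continuity, on the diagonal too; since the integral is the kernel off the
  diagonal, this identifies the limit that defines \<open>diff_airy_kernel\<close> there.\<close>

lemma tendsto_airy_integral:
  assumes "X \<longlonglongrightarrow> x" "Y \<longlonglongrightarrow> y"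
  shows "(\<lambda>n. \<integral>u. airy_integrand (X n) (Y n) u \<partial>lborel) \<longlonglongrightarrow> (\<integral>u. airy_integrand x y u \<partial>lborel)"
proof -
  obtain K where K: "\<And>x. \<bar>Airy_Ai x\<bar> \<le> K * exp (- x)" using Airy_Ai_bound by blast
  obtain M where M: "\<And>n. \<bar>X n\<bar> \<le> M" using convergent_imp_bounded[OF assms(1)] by (auto simp: bounded_iff)
  obtain M' where M': "\<And>n. \<bar>Y n\<bar> \<le> M'" using convergent_imp_bounded[OF assms(2)] by (auto simp: bounded_iff)
  show ?thesis
  proof (rule integral_dominated_convergence[where w = "\<lambda>u. K ^ 2 * exp (M + M') * (indicator {0..} u * exp (- u))"])
    show "AE u in lborel. (\<lambda>n. airy_integrand (X n) (Y n) u) \<longlonglongrightarrow> airy_integrand x y u"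
      unfolding airy_integrand_def
      by (intro AE_I2 tendsto_intros isCont_tendsto_compose[OF continuous_Airy_Ai(1)] assms)
    show "AE u in lborel. norm (airy_integrand (X n) (Y n) u) \<le> K ^ 2 * exp (M + M') * (indicator {0..} u * exp (- u))" for n
    proof (intro AE_I2)
      fix u
      have "exp (- X n - Y n) \<le> exp (M + M')" using M[of n] M'[of n] by simp
      then have "K ^ 2 * exp (- X n - Y n) * (indicator {0..} u * exp (- u)) \<le> K ^ 2 * exp (M + M') * (indicator {0..} u * exp (- u))"
        by (intro mult_right_mono mult_left_mono) auto
      then show "norm (airy_integrand (X n) (Y n) u) \<le> K ^ 2 * exp (M + M') * (indicator {0..} u * exp (- u))"
        using airy_integrand_bound[OF K, of "X n" "Y n" u] by simp
    qed
  qed (use integrable_exp_decay in auto)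
qed

theorem diff_airy_kernel_eq_integral: "diff_airy_kernel x y = (\<integral>u. airy_integrand x y u \<partial>lborel)"
proof (cases "x = y")
  case True
  let ?F = "at (x, x) within {p. fst p \<noteq> snd p}"
  have "((\<lambda>p. airy_kernel_off_diag (fst p) (snd p)) \<longlongrightarrow> (\<integral>u. airy_integrand x x u \<partial>lborel)) ?F"
    unfolding tendsto_at_iff_sequentially
  proof (intro allI impI)
    fix X :: "nat \<Rightarrow> real \<times> real"
    assume X: "\<forall>i. X i \<in> {p. fst p \<noteq> snd p} - {(x, x)}" "X \<longlonglongrightarrow> (x, x)"
    have "(\<lambda>n. \<integral>u. airy_integrand (fst (X n)) (snd (X n)) u \<partial>lborel) \<longlonglongrightarrow> (\<integral>u. airy_integrand x x u \<partial>lborel)"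
      using tendsto_fst[OF X(2)] tendsto_snd[OF X(2)] by (intro tendsto_airy_integral) auto
    then show "((\<lambda>p. airy_kernel_off_diag (fst p) (snd p)) \<circ> X) \<longlonglongrightarrow> (\<integral>u. airy_integrand x x u \<partial>lborel)"
      using X(1) by (simp add: o_def airy_kernel_eq_integral)
  qed
  moreover have "?F \<noteq> bot"
    unfolding trivial_limit_def[symmetric] trivial_limit_within islimpt_sequential not_not
  proof (intro exI conjI allI)
    show "(x + 1 / real (Suc n), x) \<in> {p. fst p \<noteq> snd p} - {(x, x)}" for n by auto
    show "(\<lambda>n. (x + 1 / real (Suc n), x)) \<longlonglongrightarrow> (x, x)"
      using tendsto_Pair[OF tendsto_add[OF tendsto_const LIMSEQ_Suc[OF lim_1_over_n]] tendsto_const, of x x] by simp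
  qed
  ultimately show ?thesis
    using True unfolding diff_airy_kernel_def by (simp add: tendsto_Lim)
qed (simp add: diff_airy_kernel_def airy_kernel_eq_integral)

section \<open>Plancherel-Rotach asymptotics at the soft edge\<close>

text \<open>The classical generating function of the Laguerre polynomials of parameter
  \<open>p\<close>, with \<open>c\<close> for - x. Each power of \<open>fps_X * V\<close> times
  \<open>V ^ Suc p\<close> is a shifted negative binomial series, which contributes one binomial
  coefficient.\<close>

lemma lag_coeff_fps:
  fixes c :: complex
  shows "fps_nth ((fps_exp c oo (fps_X * inverse (1 - fps_X))) * inverse (1 - fps_X) ^ Suc p) k
    = (\<Sum>i\<le>k. of_nat ((k + p) choose (k - i)) * c ^ i / fact i)"
proof -
  define V where "V = inverse (1 - fps_X :: complex fps)"
  have Vpow: "V ^ Suc q = Abs_fps (\<lambda>j. of_nat ((q + j) choose j))" for q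
    using one_minus_const_fps_X_neg_power'[of "Suc q" "1 :: complex"]
    by (simp add: V_def fps_inverse_power del: power_Suc)
  have comp: "fps_nth (fps_exp c oo (fps_X * V)) n = (\<Sum>i\<le>k. c ^ i / fact i * fps_nth ((fps_X * V) ^ i) n)" if "n \<le> k" for n
  proof -
    have "fps_nth ((fps_X * V) ^ i) n = 0" if "n < i" for i
      using that by (simp add: power_mult_distrib fps_X_power_mult_nth)
    then show ?thesis
      using that unfolding fps_compose_nth by (intro sum.mono_neutral_cong_left) auto
  qed
  have "fps_nth ((fps_exp c oo (fps_X * V)) * V ^ Suc p) k
     = (\<Sum>n=0..k. (\<Sum>i\<le>k. c ^ i / fact i * fps_nth ((fps_X * V) ^ i) n) * fps_nth (V ^ Suc p) (k - n))"
    unfolding fps_mult_nth by (intro sum.cong refl) (simp add: comp)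
  also have "\<dots> = (\<Sum>i\<le>k. c ^ i / fact i * fps_nth ((fps_X * V) ^ i * V ^ Suc p) k)"
    unfolding fps_mult_nth[of "(fps_X * V) ^ _"] sum_distrib_left sum_distrib_right mult.assoc by (rule sum.swap)
  also have "\<dots> = (\<Sum>i\<le>k. of_nat ((k + p) choose (k - i)) * c ^ i / fact i)"
  proof (intro sum.cong refl)
    fix i assume "i \<in> {..k}"
    moreover have "(fps_X * V) ^ i * V ^ Suc p = fps_X ^ i * V ^ Suc (i + p)"
      by (simp add: power_mult_distrib power_add mult_ac)
    ultimately show "c ^ i / fact i * fps_nth ((fps_X * V) ^ i * V ^ Suc p) k = of_nat ((k + p) choose (k - i)) * c ^ i / fact i"
      by (simp add: fps_X_power_mult_nth Vpow add.commute del: power_Suc)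
  qed
  finally show ?thesis by (simp add: V_def)
qed

text \<open>Substituting \<open>w / (1 - w)\<close> for \<open>z\<close> in the generating function \<open>(1 + z)^(k + p) exp (- x z)\<close> moves the dependence
  on \<open>k\<close> into the factor \<open>w^k\<close>, so that lowering \<open>k\<close> by \<open>d\<close> costs exactly \<open>r^d\<close> on the circle of radius \<open>r\<close>.\<close>

lemma lag_circle_integral:
  assumes r: "0 < r" "r < 1"
  shows "((\<lambda>\<theta>. exp (- of_real x * (of_real r * cis \<theta> / (1 - of_real r * cis \<theta>))) * inverse (1 - of_real r * cis \<theta>) ^ Suc p / (of_real r * cis \<theta>) ^ k)
     has_integral of_real (2 * pi * lag k (k + p) x)) {0..2 * pi}"
proof -
  define H where "H = (\<lambda>z :: complex. exp (- of_real x * (z * inverse (1 - z))) * inverse (1 - z) ^ Suc p)"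
  have "H has_fps_expansion ((fps_exp (- of_real x) oo (fps_X * inverse (1 - fps_X))) * inverse (1 - fps_X) ^ Suc p)"
    unfolding H_def
    by (intro has_fps_expansion_mult has_fps_expansion_power has_fps_expansion_inverse
        has_fps_expansion_compose[OF has_fps_expansion_exp, unfolded o_def] has_fps_expansion_diff has_fps_expansion_1 has_fps_expansion_fps_X) auto
  from fps_nth_fps_expansion[OF this, of k]
  have "(deriv ^^ k) H 0 / fact k = (\<Sum>i\<le>k. of_nat ((k + p) choose (k - i)) * (- of_real x) ^ i / fact i)"
    unfolding lag_coeff_fps by simp
  also have "\<dots> = of_real (lag k (k + p) x)" by (simp add: lag_def)
  finally have D: "(deriv ^^ k) H 0 / fact k = of_real (lag k (k + p) x)" .
  have ne: "1 - z \<noteq> 0" if "z \<in> cball 0 r" for z :: complex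
    using that r by (auto simp: dist_norm)
  have holo: "H holomorphic_on cball 0 r"
    unfolding H_def by (intro holomorphic_intros ne)
  have "((\<lambda>u. H u / (u - 0) ^ Suc k) has_contour_integral (2 * pi * \<i>) / fact k * (deriv ^^ k) H 0) (circlepath 0 r)"
    by (rule Cauchy_has_contour_integral_higher_derivative_circlepath)
       (use r holo in \<open>auto intro: holomorphic_on_imp_continuous_on holomorphic_on_subset\<close>)
  moreover have "(2 * pi * \<i>) / fact k * (deriv ^^ k) H 0 = \<i> * of_real (2 * pi * lag k (k + p) x)"
    using D by (simp add: field_simps)
  ultimately have "((\<lambda>u. H u / u ^ Suc k) has_contour_integral \<i> * of_real (2 * pi * lag k (k + p) x)) (part_circlepath 0 r 0 (2 * pi))"
    by (simp add: circlepath_def)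
  then have "((\<lambda>t. H (0 + r * cis t) / (0 + r * cis t) ^ Suc k * r * \<i> * cis t) has_integral \<i> * of_real (2 * pi * lag k (k + p) x)) {0..2 * pi}"
    by (subst (asm) has_contour_integral_part_circlepath_iff) auto
  then have I: "((\<lambda>t. (- \<i>) * (H (0 + r * cis t) / (0 + r * cis t) ^ Suc k * r * \<i> * cis t)) has_integral (- \<i>) * (\<i> * of_real (2 * pi * lag k (k + p) x))) {0..2 * pi}"
    by (rule has_integral_mult_right)
  have e1: "(- \<i>) * (\<i> * z) = z" for z
    by (simp flip: mult.assoc)
  have e2: "(- \<i>) * (H (0 + r * cis t) / (0 + r * cis t) ^ Suc k * r * \<i> * cis t) = exp (- of_real x * (of_real r * cis t / (1 - of_real r * cis t))) * inverse (1 - of_real r * cis t) ^ Suc p / (of_real r * cis t) ^ k" for t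
  proof -
    have gen: "(- \<i>) * (h / ((0 + z) ^ Suc k) * r * \<i> * w) = h / z ^ k" if "z = of_real r * w" "z \<noteq> 0" for h z w :: complex
      using that by (simp add: field_simps)
    have "of_real r * cis t \<noteq> 0" using r by simp
    then have "(- \<i>) * (H (0 + r * cis t) / (0 + r * cis t) ^ Suc k * r * \<i> * cis t) = H (0 + r * cis t) / (of_real r * cis t) ^ k"
      by (rule gen[OF refl])
    then show ?thesis unfolding H_def divide_inverse add_0_left .
  qed
  show ?thesis using I unfolding e1 e2 .
qed

text \<open>This is tanh (v / 2). For w = - exp v the exponent - x w / (1 - w) equals (x / 2) (1 +
  tanh (v / 2)); being odd in v apart from the constant, it has no quadratic term, which makes the
  saddle at v = 0 a double one.\<close>

definition half_tanh :: "complex \<Rightarrow> complex" where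
  "half_tanh v = (exp v - 1) / (exp v + 1)"

text \<open>The integrand at \<open>w = - exp v\<close>, centred at the double saddle point \<open>w = - 1\<close>. The mesh \<open>h\<close> is
  related to the matrix size by \<open>N = 4 / h ^ 3\<close>, so \<open>x = 4 N + 2 powr (4 / 3) * \<xi> * N powr (1 / 3)\<close> becomes
  \<open>16 / h ^ 3 + 4 * \<xi> / h\<close>.\<close>

definition lag_phase :: "nat \<Rightarrow> nat \<Rightarrow> real \<Rightarrow> real \<Rightarrow> real \<Rightarrow> complex" where
  "lag_phase p k x h t = (let v = of_real h * (- 1 + \<i> * of_real t)
     in exp (of_real x / 2 * half_tanh v - of_nat k * v) * inverse (1 + exp v) ^ Suc p)"

text \<open>The interval is the full circle in the rescaled angle; extension by zero puts the
  integrals for all \<open>h\<close> on the same line, as dominated convergence requires.\<close>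

abbreviation lag_window :: "nat \<Rightarrow> nat \<Rightarrow> real \<Rightarrow> real \<Rightarrow> real \<Rightarrow> complex" where
  "lag_window p k x h t \<equiv> indicator {- pi / h..pi / h} t *\<^sub>R lag_phase p k x h t"

lemma one_plus_exp_nonzero:
  assumes "Re v < 0"
  shows "1 + exp v \<noteq> (0 :: complex)"
proof
  assume "1 + exp v = 0"
  then have "exp v = - 1" by (simp add: add_eq_0_iff)
  then have "exp (Re v) = 1" by (metis norm_exp_eq_Re norm_minus_cancel norm_one)
  with assms show False by simp
qed

text \<open>The circle of radius \<open>exp (- h)\<close> is parametrised by the angle
  \<open>h * t + pi\<close>, that is, measured from the direction of the saddle in units of
  \<open>h\<close>.\<close>

lemma lag_phase_integral:
  assumes mesh: "h > 0"
  shows "of_real ((- 1) ^ k * exp (- x / 2) * lag k (k + p) x)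
     = of_real (h / (2 * pi)) * (\<integral>t. lag_window p k x h t \<partial>lborel)"
proof -
  define r where "r = exp (- h)"
  have r: "0 < r" "r < 1" using mesh by (auto simp: r_def)
  define G where "G = (\<lambda>\<theta>. exp (- of_real x * (of_real r * cis \<theta> / (1 - of_real r * cis \<theta>))) * inverse (1 - of_real r * cis \<theta>) ^ Suc p / (of_real r * cis \<theta>) ^ k)"
  have "(G has_integral of_real (2 * pi * lag k (k + p) x)) (cbox 0 (2 * pi))"
    unfolding G_def using lag_circle_integral[OF r] by simp
  from has_integral_affinity'[OF this mesh, of pi]
  have I: "((\<lambda>t. G (h * t + pi)) has_integral (1 / h) *\<^sub>R of_real (2 * pi * lag k (k + p) x)) {- pi / h..pi / h}"
    using mesh by (simp add: divide_inverse mult_ac)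
  have G: "G (h * t + pi) = of_real ((- 1) ^ k * exp (x / 2)) * lag_phase p k x h t" for t
  proof -
    define v where "v = of_real h * (- 1 + \<i> * of_real t)"
    have z: "of_real r * cis (h * t + pi) = - exp v"
    proof -
      have "cis (h * t + pi) = - cis (h * t)" by (simp flip: cis_mult)
      moreover have "exp v = of_real r * cis (h * t)"
        by (simp add: r_def v_def cis_conv_exp algebra_simps flip: exp_of_real exp_add)
      ultimately show ?thesis by simp
    qed
    have ne: "1 + exp v \<noteq> 0" by (rule one_plus_exp_nonzero) (use mesh in \<open>simp add: v_def\<close>)
    have "- of_real x * (- exp v / (1 - - exp v)) = of_real x / 2 + of_real x / 2 * half_tanh v"
    proof -
      have "half_tanh v = 1 - 2 / (1 + exp v)" "exp v / (1 + exp v) = 1 - 1 / (1 + exp v)"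
        using ne by (simp_all add: half_tanh_def add.commute[of _ 1] field_simps)
      then have m: "half_tanh v = 1 - 2 * (1 / (1 + exp v))" and e: "exp v / (1 + exp v) = 1 - 1 / (1 + exp v)" by simp_all
      have "- of_real x * (- exp v / (1 - - exp v)) = of_real x * (exp v / (1 + exp v))" by simp
      also have "\<dots> = of_real x / 2 + of_real x / 2 * (1 - 2 * (1 / (1 + exp v)))"
        unfolding e by (simp only: right_diff_distrib) simp
      finally show ?thesis unfolding m .
    qed
    moreover have "z / (- exp v) ^ k = (- 1) ^ k * (z * exp (- (of_nat k * v)))" for z
    proof -
      have "inverse ((- 1 :: complex) ^ k) = (- 1) ^ k" by (simp flip: power_inverse)
      then show ?thesis
        unfolding power_minus[of "exp v"] exp_minus exp_of_nat_mult divide_inverse inverse_mult_distrib by simp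
    qed
    moreover have "exp (of_real x / 2) = complex_of_real (exp (x / 2))"
      by (simp flip: exp_of_real)
    moreover have "1 - - exp v = 1 + exp v" by simp
    moreover have "exp (of_real x / 2 * half_tanh v - of_nat k * v) = exp (of_real x / 2 * half_tanh v) * exp (- (of_nat k * v))"
      by (simp flip: exp_add)
    ultimately show ?thesis
      unfolding G_def z lag_phase_def Let_def v_def[symmetric]
      by (simp only: exp_add[of "of_real x / 2"] of_real_mult of_real_power of_real_minus of_real_1 mult_ac)
  qed
  have I2: "((\<lambda>t. of_real ((- 1) ^ k * exp (- x / 2)) * (of_real ((- 1) ^ k * exp (x / 2)) * lag_phase p k x h t)) has_integral
     of_real ((- 1) ^ k * exp (- x / 2)) * ((1 / h) *\<^sub>R of_real (2 * pi * lag k (k + p) x))) {- pi / h..pi / h}"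
    using has_integral_mult_right[OF I] unfolding G .
  have e: "of_real ((- 1) ^ k * exp (- x / 2)) * (of_real ((- 1) ^ k * exp (x / 2)) * z) = z" for z :: complex
  proof -
    have "((- 1) ^ k * exp (- x / 2)) * ((- 1) ^ k * exp (x / 2)) = ((- 1) * (- 1)) ^ k * (exp (- x / 2) * exp (x / 2))"
      unfolding power_mult_distrib by (simp only: mult_ac)
    also have "\<dots> = 1" by (simp flip: exp_add)
    finally show ?thesis unfolding mult.assoc[symmetric] of_real_mult[symmetric] by simp
  qed
  have "continuous_on {- pi / h..pi / h} (lag_phase p k x h)"
    unfolding lag_phase_def[abs_def] Let_def half_tanh_def
    using mesh by (intro continuous_intros) (auto simp: add.commute[of "exp _"] intro!: one_plus_exp_nonzero)
  then have "set_integrable lborel {- pi / h..pi / h} (lag_phase p k x h)"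
    by (rule borel_integrable_atLeastAtMost')
  from set_borel_integral_eq_integral(2)[OF this]
  have "(\<integral>t. lag_window p k x h t \<partial>lborel) = integral {- pi / h..pi / h} (lag_phase p k x h)"
    by (simp add: set_lebesgue_integral_def)
  also have "\<dots> = of_real ((- 1) ^ k * exp (- x / 2)) * ((1 / h) *\<^sub>R of_real (2 * pi * lag k (k + p) x))"
    using I2 unfolding e by (rule integral_unique)
  finally show ?thesis using mesh by (simp add: scaleR_conv_of_real)
qed

section \<open>Uniform domination of the integrand on the circle\<close>

lemma cos_upper_bound:
  assumes "\<bar>x\<bar> \<le> pi"
  shows "1 - cos x \<ge> x ^ 2 / 12"
proof -
  obtain t where t: "cos x = (\<Sum>m<4. cos_coeff m * x ^ m) + (cos (t + 1/2 * real 4 * pi) / fact 4) * x ^ 4"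
    using Maclaurin_cos_expansion[of x 4] by blast
  have "(\<Sum>m<4. cos_coeff m * x ^ m) = 1 - x ^ 2 / 2"
  proof -
    have "{..<4} = {0, 1, 2, 3 :: nat}" by auto
    then show ?thesis by (simp add: cos_coeff_def)
  qed
  moreover have "(cos (t + 1/2 * real 4 * pi) / fact 4) * x ^ 4 \<le> (1 / fact 4) * x ^ 4"
    by (intro mult_right_mono divide_right_mono) auto
  \<comment> \<open>10 is an upper bound for the square of pi, and 1/2 - 10/24 = 1/12 is the
    constant of the lemma.\<close>
  moreover have "x ^ 4 \<le> 10 * x ^ 2"
  proof -
    have "x ^ 2 \<le> pi ^ 2" using assms by (metis abs_ge_zero power2_abs power_mono)
    also have "pi ^ 2 \<le> 3.15 ^ 2" using pi_approx by (intro power_mono) auto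
    finally have "x ^ 2 \<le> 10" by (simp add: power2_eq_square)
    then have "x ^ 2 * x ^ 2 \<le> 10 * x ^ 2" by (intro mult_right_mono) auto
    then show ?thesis by (simp flip: power_add)
  qed
  ultimately show ?thesis using t by (simp add: fact_numeral)
qed

text \<open>The left side is tanh (h / 2), which solves T' = (1 - T^2) / 2. First T is at most h /
  2; inserting this into the equation and integrating gives the cubic correction. The exact linear
  coefficient matters, since the bound is multiplied by a number of order 1 / h^3.\<close>

lemma tanh_lower_bound:
  fixes h :: real
  assumes "h \<ge> 0"
  shows "(1 - exp (- h)) / (1 + exp (- h)) \<ge> h / 2 - h ^ 3 / 24"
proof -
  define T where "T = (\<lambda>h :: real. (1 - exp (- h)) / (1 + exp (- h)))"
  have pos: "1 + exp (- h) > 0" for h :: real by (simp add: add_pos_pos)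
  have DT: "(T has_real_derivative (1 - T h ^ 2) / 2) (at h)" for h :: real
  proof -
    have "(T has_real_derivative (exp (- h) * (1 + exp (- h)) + (1 - exp (- h)) * exp (- h)) / ((1 + exp (- h)) * (1 + exp (- h)))) (at h)"
      unfolding T_def using pos[of h] by (auto intro!: derivative_eq_intros simp: field_simps)
    moreover have "(E * (1 + E) + (1 - E) * E) / ((1 + E) * (1 + E)) = (1 - ((1 - E) / (1 + E)) ^ 2) / 2" if "1 + E > 0" for E :: real
      using that by (simp add: power_divide divide_simps) (simp add: power2_eq_square algebra_simps)
    ultimately show ?thesis using pos[of h] by (simp add: T_def)
  qed
  have T0: "T 0 = 0" by (simp add: T_def)
  have Tnn: "T u \<ge> 0" if "u \<ge> 0" for u
    using that pos[of u] by (simp add: T_def)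
  have up: "T u \<le> u / 2" if "u \<ge> 0" for u
  proof -
    have "0 / 2 - T 0 \<le> u / 2 - T u"
    proof (rule DERIV_nonneg_imp_nondecreasing[OF that])
      fix v assume "0 \<le> v" "v \<le> u"
      show "\<exists>y. ((\<lambda>v. v / 2 - T v) has_real_derivative y) (at v) \<and> 0 \<le> y"
        by (rule exI[of _ "1 / 2 - (1 - T v ^ 2) / 2"]) (auto intro!: derivative_eq_intros DT)
    qed
    then show ?thesis by (simp add: T0)
  qed
  have "T 0 - (0 / 2 - 0 ^ 3 / 24) \<le> T h - (h / 2 - h ^ 3 / 24)"
  proof (rule DERIV_nonneg_imp_nondecreasing[OF assms])
    fix v assume v: "0 \<le> v" "v \<le> h"
    have "T v ^ 2 \<le> (v / 2) ^ 2" by (rule power_mono[OF up Tnn]) (use v in auto)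
    moreover have "((\<lambda>v. T v - (v / 2 - v ^ 3 / 24)) has_real_derivative (1 - T v ^ 2) / 2 - (1 / 2 - 3 * v ^ 2 / 24)) (at v)"
      by (auto intro!: derivative_eq_intros DT simp: power2_eq_square)
    ultimately show "\<exists>y. ((\<lambda>v. T v - (v / 2 - v ^ 3 / 24)) has_real_derivative y) (at v) \<and> 0 \<le> y"
      by (intro exI conjI) (auto simp: power_divide)
  qed
  then show ?thesis by (simp add: T0) (simp add: T_def)
qed

text \<open>With \<open>Y\<close> the inverse square of the modulus of 1 + exp v, the left side is
  \<open>exp (- a * Y + real k * h) * sqrt Y ^ Suc p\<close>. The minimum \<open>Y0\<close> of
  \<open>Y\<close> at t = 0 produces the decay in \<open>d\<close>. The excess of \<open>Y\<close>
  over \<open>Y0\<close>, quadratic in the angle on the whole circle, produces the Gaussian because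
  \<open>a\<close> is at least \<open>2 / h ^ 2\<close>.\<close>

lemma norm_lag_phase_le:
  fixes \<xi> h t :: real
  assumes mesh: "0 < h" "h \<le> 1" and xi: "\<bar>\<xi>\<bar> * h ^ 2 \<le> 2" and t: "\<bar>h * t\<bar> \<le> pi"
    and k: "real k + real p + real d = 4 / h ^ 3"
    and x: "x = 16 / h ^ 3 + 4 * \<xi> / h"
  shows "norm (lag_phase p k x h t) \<le> fact (Suc p) * exp (2 * \<bar>\<xi>\<bar> + 3) * (exp (- (h * real d)) * exp (- (1 / 288) * t ^ 2))"
proof -
  define v where "v = of_real h * (- 1 + \<i> * of_real t)"
  define r where "r = exp (- h)"
  define \<phi> where "\<phi> = h * t"
  have r: "0 < r" "r < 1" "1 / 3 \<le> r" "1 - r \<ge> h / 2"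
  proof -
    show "0 < r" "r < 1" using mesh by (auto simp: r_def)
    have "exp (-1) \<le> r" using mesh by (simp add: r_def)
    moreover have "1 / 3 \<le> exp (- 1 :: real)" using exp_le by (simp add: exp_minus field_simps)
    ultimately show "1 / 3 \<le> r" by linarith
    have "1 + h \<le> exp h" by simp
    then have "r \<le> 1 / (1 + h)" using mesh by (simp add: r_def exp_minus field_simps)
    also have "\<dots> \<le> 1 - h / 2" using mesh by (simp add: field_simps)
    finally show "1 - r \<ge> h / 2" by simp
  qed
  have Rev: "Re v = - h" "Im v = \<phi>" by (auto simp: v_def \<phi>_def)
  have expv: "Re (exp v) = r * cos \<phi>" "Im (exp v) = r * sin \<phi>" "norm (exp v) = r"
    by (simp_all add: Re_exp Im_exp Rev r_def)
  have ne: "1 + exp v \<noteq> 0" by (rule one_plus_exp_nonzero) (use mesh in \<open>simp add: Rev\<close>)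
  define W where "W = norm (1 + exp v) ^ 2"
  have Wpos: "W > 0" using ne by (simp add: W_def)
  have Weq: "W = (1 + r) ^ 2 - 2 * r * (1 - cos \<phi>)"
  proof -
    have "W = (1 + r * cos \<phi>) ^ 2 + (r * sin \<phi>) ^ 2" by (simp add: W_def cmod_power2 expv)
    also have "\<dots> = 1 + 2 * r * cos \<phi> + r ^ 2 * (sin \<phi> ^ 2 + cos \<phi> ^ 2)"
    proof -
      have "(1 + r * c) ^ 2 + (r * s) ^ 2 = 1 + 2 * r * c + r ^ 2 * (s ^ 2 + c ^ 2)" for c s
        by (simp add: power2_eq_square algebra_simps)
      then show ?thesis .
    qed
    also have "\<dots> = 1 + 2 * r * cos \<phi> + r ^ 2" by simp
    finally show ?thesis by (simp add: power2_eq_square algebra_simps)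
  qed
  define Y where "Y = 1 / W"
  define Y0 where "Y0 = 1 / (1 + r) ^ 2"
  have Yge: "Y \<ge> Y0 + \<phi> ^ 2 / 288"
  proof -
    define A where "A = (1 + r) ^ 2"
    define B where "B = 2 * r * (1 - cos \<phi>)"
    have A: "0 < A" "A \<le> 4" using r power_mono[of "1 + r" 2 2] by (auto simp: A_def)
    have AB: "A - B > 0" using Wpos unfolding Weq A_def B_def .
    \<comment> \<open>The 18 combines \<open>r \<ge> 1 / 3\<close> with the 12 of
      \<open>cos_upper_bound\<close>; together with the bound 16 for \<open>A ^ 2\<close> it makes
      288.\<close>
    have Bge: "B \<ge> \<phi> ^ 2 / 18"
    proof -
      have "2 * (1 / 3) * (\<phi> ^ 2 / 12) \<le> 2 * r * (1 - cos \<phi>)"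
        using r t by (intro mult_mono cos_upper_bound) (auto simp: \<phi>_def)
      then show ?thesis by (simp add: B_def)
    qed
    have "(A - B) * (1 / A + B / A ^ 2) = 1 - (B / A) ^ 2"
      using A by (simp add: field_simps power2_eq_square)
    also have "\<dots> \<le> 1" by simp
    finally have "1 / A + B / A ^ 2 \<le> 1 / (A - B)"
      using AB by (simp add: pos_le_divide_eq mult.commute)
    moreover have "B / A ^ 2 \<ge> (\<phi> ^ 2 / 18) / 16"
    proof (rule frac_le)
      show "A ^ 2 \<le> 16" using power_mono[OF A(2), of 2] A by simp
    qed (use A Bge in \<open>auto intro: order_trans[OF _ Bge]\<close>)
    ultimately show ?thesis by (simp add: Y_def Y0_def Weq A_def B_def)
  qed
  have Y0: "0 < Y0" "Y0 \<le> 1"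
    unfolding Y0_def using r one_le_power[of "1 + r" 2] by (auto simp: divide_le_eq_1)
  have Ypos: "Y > 0" using Wpos by (simp add: Y_def)
  have Remob: "Re (half_tanh v) = - ((1 - r ^ 2) * Y)"
  proof -
    have "Re (half_tanh v) = ((Re (exp v) - 1) * (Re (exp v) + 1) + Im (exp v) * Im (exp v)) / ((Re (exp v) + 1) ^ 2 + (Im (exp v)) ^ 2)"
      by (simp add: half_tanh_def Re_divide)
    also have "(Re (exp v) + 1) ^ 2 + (Im (exp v)) ^ 2 = W"
      by (simp add: W_def cmod_power2 add.commute)
    also have "(Re (exp v) - 1) * (Re (exp v) + 1) + Im (exp v) * Im (exp v) = norm (exp v) ^ 2 - 1"
      unfolding cmod_power2 by (simp add: power2_eq_square algebra_simps del: norm_exp_eq_Re)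
    finally show ?thesis by (simp add: Y_def expv(3) minus_divide_left del: norm_exp_eq_Re)
  qed
  define a where "a = x / 2 * (1 - r ^ 2)"
  \<comment> \<open>The hypothesis on \<xi> keeps \<open>x\<close> above half of its leading term
    \<open>16 / h ^ 3\<close>.\<close>
  have x8: "x \<ge> 8 / h ^ 3"
  proof -
    have "- \<xi> * h ^ 2 \<le> \<bar>\<xi>\<bar> * h ^ 2" by (intro mult_right_mono) auto
    then have "- \<xi> * h ^ 2 \<le> 2" using xi by linarith
    then show ?thesis using mesh by (simp add: x field_simps power2_eq_square power3_eq_cube)
  qed
  have xnn: "x \<ge> 0" using x8 mesh by (meson divide_nonneg_nonneg order_trans zero_le_numeral zero_le_power less_imp_le)
  have age: "a \<ge> 2 / h ^ 2"
  proof -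
    have "1 - r ^ 2 \<ge> 1 - r" using r by (simp add: power2_eq_square mult_left_le)
    then have "1 - r ^ 2 \<ge> h / 2" using r by linarith
    then have "x / 2 * (1 - r ^ 2) \<ge> (8 / h ^ 3) / 2 * (h / 2)"
      using x8 mesh xnn by (intro mult_mono divide_right_mono) auto
    also have "(8 / h ^ 3) / 2 * (h / 2) = 2 / h ^ 2"
      using mesh by (simp add: field_simps power2_eq_square power3_eq_cube)
    finally show ?thesis by (simp add: a_def)
  qed
  have a2: "a \<ge> 2"
  proof -
    have "h ^ 2 \<le> 1" using mesh by (simp add: power_le_one)
    then have "2 / h ^ 2 \<ge> 2" using mesh by (simp add: field_simps)
    then show ?thesis using age by linarith
  qed
  have aY0: "a * Y0 = x / 2 * ((1 - r) / (1 + r))"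
  proof -
    have "(1 - r ^ 2) / (1 + r) ^ 2 = ((1 - r) * (1 + r)) / ((1 + r) * (1 + r))"
      by (simp add: power2_eq_square algebra_simps)
    also have "\<dots> = (1 - r) / (1 + r)" using r by simp
    finally have e: "(1 - r ^ 2) / (1 + r) ^ 2 = (1 - r) / (1 + r)" .
    have "a * Y0 = x / 2 * ((1 - r ^ 2) / (1 + r) ^ 2)" by (simp add: a_def Y0_def)
    then show ?thesis unfolding e .
  qed
  have "norm (lag_phase p k x h t) = exp (Re (of_real x / 2 * half_tanh v - of_nat k * v)) * norm (inverse (1 + exp v)) ^ Suc p"
    unfolding lag_phase_def Let_def v_def[symmetric] by (simp add: norm_mult norm_power)
  also have "Re (of_real x / 2 * half_tanh v - of_nat k * v) = - a * Y + real k * h"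
    by (simp add: Remob Rev a_def)
  also have "norm (inverse (1 + exp v)) = sqrt Y"
    using ne by (simp add: Y_def W_def real_sqrt_divide norm_divide inverse_eq_divide)
  \<comment> \<open>Away from the saddle \<open>Y\<close> can be of order 1 / h^2. Its power is
    traded for \<open>exp (1 + Y)\<close>, which is paid for by using \<open>a - 1\<close> in place
    of \<open>a\<close> below.\<close>
  also have "exp (- a * Y + real k * h) * sqrt Y ^ Suc p \<le> exp (- a * Y + real k * h) * (fact (Suc p) * exp (1 + Y))"
  proof (intro mult_left_mono)
    have "sqrt Y \<le> sqrt ((1 + Y) ^ 2)" using Ypos by (intro real_sqrt_le_mono) (simp add: power2_eq_square algebra_simps)
    then have "sqrt Y ^ Suc p \<le> (1 + Y) ^ Suc p" using Ypos by (intro power_mono) auto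
    also have "(1 + Y) ^ Suc p \<le> fact (Suc p) * exp (1 + Y)"
      using Ypos by (intro power_le_exp) auto
    finally show "sqrt Y ^ Suc p \<le> fact (Suc p) * exp (1 + Y)" .
  qed auto
  also have "exp (- a * Y + real k * h) * (fact (Suc p) * exp (1 + Y)) = fact (Suc p) * exp (- a * Y + real k * h + (1 + Y))"
    by (simp only: exp_add mult_ac)
  also have "\<dots> \<le> fact (Suc p) * exp ((2 * \<bar>\<xi>\<bar> + 3) + (- (h * real d) + - (1 / 288) * t ^ 2))"
  proof (intro mult_left_mono, unfold exp_le_cancel_iff)
    have "(a - 1) * Y \<ge> (a - 1) * (Y0 + \<phi> ^ 2 / 288)"
      using a2 Yge by (intro mult_left_mono) auto
    moreover have "(a - 1) * (Y0 + \<phi> ^ 2 / 288) = a * Y0 - Y0 + (a - 1) * (\<phi> ^ 2 / 288)"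
      by (simp add: algebra_simps)
    moreover have "(a - 1) * (\<phi> ^ 2 / 288) \<ge> t ^ 2 / 288"
    proof -
      have "(a - 1) * (\<phi> ^ 2 / 288) \<ge> (a / 2) * (\<phi> ^ 2 / 288)" using a2 by (intro mult_right_mono) auto
      moreover have "(a / 2) * (\<phi> ^ 2 / 288) \<ge> (1 / h ^ 2) * (\<phi> ^ 2 / 288)" using age by (intro mult_right_mono) auto
      moreover have "(1 / h ^ 2) * (\<phi> ^ 2 / 288) = t ^ 2 / 288" using mesh by (simp add: \<phi>_def power_mult_distrib)
      ultimately show ?thesis by linarith
    qed
    \<comment> \<open>\<open>a * Y0\<close> is x / 2 times tanh (h / 2). Its leading part
      \<open>4 / h ^ 2\<close> equals h (k + p + d), so that subtracting h k leaves the decay h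
      d.\<close>
    moreover have "a * Y0 \<ge> real k * h + h * real d - 2 * \<bar>\<xi>\<bar> - 1"
    proof -
      have "x / 2 * ((1 - r) / (1 + r)) \<ge> x / 2 * (h / 2 - h ^ 3 / 24)"
        unfolding r_def using xnn mesh by (intro mult_left_mono tanh_lower_bound) auto
      moreover have "x / 2 * (h / 2 - h ^ 3 / 24) = 4 / h ^ 2 + \<xi> - 1 / 3 - \<xi> * h ^ 2 / 12"
        using mesh unfolding x by (simp add: field_simps power2_eq_square power3_eq_cube)
      moreover have "4 / h ^ 2 = (real k + real p + real d) * h"
        unfolding k using mesh by (simp add: field_simps power2_eq_square power3_eq_cube)
      moreover have "(real k + real p + real d) * h \<ge> real k * h + h * real d"
        using mesh by (simp add: algebra_simps)
      moreover have "\<xi> * h ^ 2 \<le> \<bar>\<xi>\<bar> * h ^ 2" by (intro mult_right_mono) auto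
      ultimately show ?thesis unfolding aY0 using xi by linarith
    qed
    ultimately have "(a - 1) * Y \<ge> real k * h + h * real d - 2 * \<bar>\<xi>\<bar> - 1 - Y0 + t ^ 2 / 288"
      by linarith
    moreover have "- a * Y + real k * h + (1 + Y) = real k * h + 1 - (a - 1) * Y"
      by (simp add: algebra_simps)
    moreover have "- (1 / 288) * t ^ 2 = - (t ^ 2 / 288)" by simp
    ultimately show "- a * Y + real k * h + (1 + Y) \<le> (2 * \<bar>\<xi>\<bar> + 3) + (- (h * real d) + - (1 / 288) * t ^ 2)"
      using Y0 by linarith
  qed auto
  finally show ?thesis by (simp only: exp_add mult.assoc)
qed

section \<open>Local expansion at the saddle point\<close>

lemma tendsto_half_tanh_cubic: "((\<lambda>v. (half_tanh v - v / 2) / v ^ 3) \<longlongrightarrow> - 1 / 24) (at 0)"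
proof -
  \<comment> \<open>The difference tanh (v / 2) - v / 2 is \<open>n v\<close> over 2 (exp v + 1).
    The numerator is - v^3 / 6 up to fourth order and the denominator tends to 4, hence -
    1/24.\<close>
  define n where "n = (\<lambda>v :: complex. 2 * (exp v - 1) - v * (exp v + 1))"
  have "((\<lambda>v. n v / v ^ 3 + 1 / 6) \<longlongrightarrow> 0) (at 0)"
  proof (rule Lim_null_comparison)
    show "\<forall>\<^sub>F v in at 0. norm (n v / v ^ 3 + 1 / 6) \<le> 2 * norm v"
    proof -
      have "\<forall>\<^sub>F v :: complex in at 0. v \<noteq> 0 \<and> norm v < 1"
        by (auto simp: eventually_at intro!: exI[of _ 1])
      then show ?thesis
      proof eventually_elim
        case (elim v)
        define \<rho> where "\<rho> = exp v - (\<Sum>k\<le>3. v ^ k / fact k)"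
        have ev: "exp v = 1 + v + v ^ 2 / 2 + v ^ 3 / 6 + \<rho>"
          by (simp add: \<rho>_def eval_nat_numeral)
        have "norm \<rho> \<le> exp \<bar>Re v\<bar> * norm v ^ 4 / fact 3"
          using Taylor_exp[of v 3] by (simp add: \<rho>_def)
        also have "\<dots> \<le> 3 * norm v ^ 4 / fact 3"
        proof (intro divide_right_mono mult_right_mono)
          have "\<bar>Re v\<bar> \<le> 1" using abs_Re_le_cmod[of v] elim by linarith
          then show "exp \<bar>Re v\<bar> \<le> 3" using exp_le by (meson exp_le_cancel_iff order_trans)
        qed auto
        finally have \<rho>: "norm \<rho> \<le> norm v ^ 4 / 2" by (simp add: fact_numeral)
        have "n v / v ^ 3 + 1 / 6 = - v / 6 + (2 - v) * \<rho> / v ^ 3"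
          using elim unfolding n_def ev by (simp add: field_simps power2_eq_square power3_eq_cube)
        also have "norm \<dots> \<le> norm (- v / 6) + norm ((2 - v) * \<rho> / v ^ 3)" by (rule norm_triangle_ineq)
        also have "norm ((2 - v) * \<rho> / v ^ 3) \<le> 3 * (norm v ^ 4 / 2) / norm v ^ 3"
          unfolding norm_divide norm_mult norm_power
        proof (intro divide_right_mono mult_mono \<rho>)
          show "norm (2 - v) \<le> 3" using norm_triangle_ineq4[of 2 v] elim by simp
        qed auto
        also have "3 * (norm v ^ 4 / 2) / norm v ^ 3 = 3 / 2 * norm v"
          using elim by (simp add: field_simps power3_eq_cube power4_eq_xxxx)
        finally have "norm (n v / v ^ 3 + 1 / 6) \<le> norm (- v / 6) + 3 / 2 * norm v" by simp
        moreover have "norm (- v / 6) = norm v / 6" by (simp add: norm_divide)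
        ultimately show ?case using norm_ge_zero[of v] by linarith
      qed
    qed
    show "((\<lambda>v :: complex. 2 * norm v) \<longlongrightarrow> 0) (at 0)" by (auto intro!: tendsto_eq_intros)
  qed
  then have "((\<lambda>v. (n v / v ^ 3 + 1 / 6) - 1 / 6) \<longlongrightarrow> 0 - 1 / 6) (at 0)"
    by (intro tendsto_intros)
  moreover have "((\<lambda>v :: complex. 2 * (exp v + 1)) \<longlongrightarrow> 4) (at 0)"
    by (auto intro!: tendsto_eq_intros)
  ultimately have "((\<lambda>v. ((n v / v ^ 3 + 1 / 6) - 1 / 6) / (2 * (exp v + 1))) \<longlongrightarrow> (0 - 1 / 6) / 4) (at 0)"
    by (intro tendsto_divide) auto
  moreover have "\<forall>\<^sub>F v in at 0. ((n v / v ^ 3 + 1 / 6) - 1 / 6) / (2 * (exp v + 1)) = (half_tanh v - v / 2) / v ^ 3"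
  proof -
    have "((\<lambda>v :: complex. exp v + 1) \<longlongrightarrow> 2) (at 0)" by (auto intro!: tendsto_eq_intros)
    then have "\<forall>\<^sub>F v :: complex in at 0. exp v + 1 \<noteq> 0" by (rule tendsto_imp_eventually_ne) simp
    then show ?thesis
    proof eventually_elim
      case (elim v)
      have "half_tanh v - v / 2 = n v / (2 * (exp v + 1))"
        using elim unfolding half_tanh_def n_def by (simp add: field_simps)
      then show ?case by simp
    qed
  qed
  ultimately show ?thesis using Lim_transform_eventually by fastforce
qed

text \<open>Write v = h \<zeta> with \<open>\<zeta> = \<i> * airy_path t\<close>. The cubic part
  tends to 8 \<zeta>^3 (- 1/24) = - \<zeta>^3 / 3, which is the exponent of
  \<open>airy_weight\<close>. In the linear part the orders 1 / h^2 of h x / 4 and h k cancel,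
  leaving \<xi> + h p + h d.\<close>

lemma tendsto_lag_phase:
  fixes h x :: "nat \<Rightarrow> real" and k d :: "nat \<Rightarrow> nat"
  assumes mesh: "\<And>n. 0 < h n" "h \<longlonglongrightarrow> 0"
    and k: "\<And>n. real (k n) + real p + real (d n) = 4 / h n ^ 3"
    and x: "\<And>n. x n = 16 / h n ^ 3 + 4 * \<xi> / h n"
    and d: "(\<lambda>n. h n * real (d n)) \<longlonglongrightarrow> u"
  shows "(\<lambda>n. lag_phase p (k n) (x n) (h n) t) \<longlonglongrightarrow> (1 / 2) ^ Suc p * (airy_weight t * exp (\<i> * of_real (\<xi> + u) * airy_path t))"
proof -
  define \<zeta> where "\<zeta> = - 1 + \<i> * of_real t"
  have z0: "\<zeta> \<noteq> 0" by (simp add: \<zeta>_def complex_eq_iff)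
  define v where "v = (\<lambda>n. of_real (h n) * \<zeta>)"
  have v0: "v \<longlonglongrightarrow> 0" unfolding v_def by (rule tendsto_eq_intros tendsto_of_real mesh refl)+ simp
  have vne: "v n \<noteq> 0" for n using z0 mesh(1)[of n] by (simp add: v_def)
  define S where "S = (\<lambda>v. (half_tanh v - v / 2) / v ^ 3)"
  have "filterlim v (at 0) sequentially"
    using v0 vne by (auto simp: filterlim_at)
  then have S: "(\<lambda>n. S (v n)) \<longlonglongrightarrow> - 1 / 24"
    unfolding S_def by (rule filterlim_compose[OF tendsto_half_tanh_cubic])
  have expo: "of_real (x n) / 2 * half_tanh (v n) - of_nat (k n) * v n
     = of_real (8 + 2 * \<xi> * h n ^ 2) * \<zeta> ^ 3 * S (v n) + of_real (\<xi> + h n * real p + h n * real (d n)) * \<zeta>" for n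
  proof -
    have e1: "half_tanh (v n) = v n ^ 3 * S (v n) + v n / 2" using vne[of n] by (simp add: S_def)
    have e2: "of_real (x n) / 2 * v n ^ 3 = of_real (8 + 2 * \<xi> * h n ^ 2) * \<zeta> ^ 3"
    proof -
      have "x n / 2 * h n ^ 3 = 8 + 2 * \<xi> * h n ^ 2"
        using mesh(1)[of n] by (simp add: x field_simps power2_eq_square power3_eq_cube)
      then show ?thesis unfolding v_def power_mult_distrib
        by (metis (no_types, lifting) mult.assoc of_real_divide of_real_mult of_real_numeral of_real_power)
    qed
    have e3: "of_real (x n) / 2 * (v n / 2) - of_nat (k n) * v n = of_real (\<xi> + h n * real p + h n * real (d n)) * \<zeta>"
    proof -
      have kn: "real (k n) = 4 / h n ^ 3 - real p - real (d n)" using k[of n] by simp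
      have "(x n / 4 - real (k n)) * h n = \<xi> + h n * real p + h n * real (d n)"
        using mesh(1)[of n] unfolding kn by (simp add: x field_simps power2_eq_square power3_eq_cube)
      then have "of_real ((x n / 4 - real (k n)) * h n) * \<zeta> = of_real (\<xi> + h n * real p + h n * real (d n)) * \<zeta>"
        by simp
      then show ?thesis by (simp add: v_def algebra_simps)
    qed
    have "of_real (x n) / 2 * half_tanh (v n) - of_nat (k n) * v n = (of_real (x n) / 2 * v n ^ 3) * S (v n) + (of_real (x n) / 2 * (v n / 2) - of_nat (k n) * v n)"
      unfolding e1 by (simp add: algebra_simps)
    then show ?thesis unfolding e2 e3 .
  qed
  have L: "(\<lambda>n. exp (of_real (8 + 2 * \<xi> * h n ^ 2) * \<zeta> ^ 3 * S (v n) + of_real (\<xi> + h n * real p + h n * real (d n)) * \<zeta>) * inverse (1 + exp (v n)) ^ Suc p)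
     \<longlonglongrightarrow> exp (of_real (8 + 2 * \<xi> * 0 ^ 2) * \<zeta> ^ 3 * (- 1 / 24) + of_real (\<xi> + 0 * real p + u) * \<zeta>) * inverse (1 + exp 0) ^ Suc p"
    by (intro tendsto_intros S v0 d mesh) simp
  have e: "exp (of_real (8 + 2 * \<xi> * 0 ^ 2) * \<zeta> ^ 3 * (- 1 / 24) + of_real (\<xi> + 0 * real p + u) * \<zeta>) * inverse (1 + exp 0) ^ Suc p
     = (1 / 2) ^ Suc p * (airy_weight t * exp (\<i> * of_real (\<xi> + u) * airy_path t))"
  proof -
    have z: "\<zeta> = \<i> * airy_path t" by (simp add: \<zeta>_def airy_path_def algebra_simps)
    have h: "of_real (8 + 2 * \<xi> * 0 ^ 2) * \<zeta> ^ 3 * (- 1 / 24) = \<i> * airy_path t ^ 3 / 3"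
      unfolding z power_mult_distrib by (simp add: power3_eq_cube)
    show ?thesis unfolding h exp_add airy_weight_def
      by (simp add: z inverse_eq_divide mult_ac del: power_Suc)
  qed
  have p: "lag_phase p (k n) (x n) (h n) t = exp (of_real (8 + 2 * \<xi> * h n ^ 2) * \<zeta> ^ 3 * S (v n) + of_real (\<xi> + h n * real p + h n * real (d n)) * \<zeta>) * inverse (1 + exp (v n)) ^ Suc p" for n
    unfolding expo[symmetric] by (simp add: lag_phase_def v_def \<zeta>_def Let_def)
  show ?thesis unfolding p using L unfolding e .
qed

text \<open>The sign undoes (- 1)^k from the saddle at w = - 1, and 1 / h the Jacobian of the
  substitution in \<open>lag_phase_integral\<close>; what remains has a finite limit.\<close>

definition lag_scaled :: "nat \<Rightarrow> nat \<Rightarrow> real \<Rightarrow> real \<Rightarrow> real" where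
  "lag_scaled p k x h = (- 1) ^ k * exp (- x / 2) * lag k (k + p) x / h"

lemma lag_scaled_eq:
  assumes "h > 0"
  shows "of_real (lag_scaled p k x h) = (\<integral>t. lag_window p k x h t \<partial>lborel) / (2 * pi)"
proof -
  have "complex_of_real (lag_scaled p k x h) = of_real ((- 1) ^ k * exp (- x / 2) * lag k (k + p) x) / of_real h"
    by (simp add: lag_scaled_def)
  then show ?thesis unfolding lag_phase_integral[OF assms] using assms by simp
qed

definition lag_const :: "nat \<Rightarrow> real \<Rightarrow> real" where
  "lag_const p \<xi> = fact (Suc p) * exp (2 * \<bar>\<xi>\<bar> + 3)"

lemma norm_lag_phase_indicator_le:
  fixes \<xi> h t :: real
  assumes mesh: "0 < h" "h \<le> 1" and xi: "\<bar>\<xi>\<bar> * h ^ 2 \<le> 2"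
    and k: "real k + real p + real d = 4 / h ^ 3"
    and x: "x = 16 / h ^ 3 + 4 * \<xi> / h"
  shows "norm (lag_window p k x h t) \<le> lag_const p \<xi> * exp (- (h * real d)) * exp (- (1 / 288) * t ^ 2)"
proof (cases "t \<in> {- pi / h..pi / h}")
  case True
  then have "\<bar>h * t\<bar> \<le> pi" using mesh by (auto simp: abs_le_iff field_simps)
  from norm_lag_phase_le[OF mesh xi this k x] True show ?thesis by (simp add: lag_const_def mult.assoc)
qed (simp add: lag_const_def)

lemma measurable_lag_phase [measurable]: "lag_phase p k x h \<in> borel_measurable borel"
  unfolding lag_phase_def[abs_def] Let_def half_tanh_def by measurable

lemma lag_scaled_bound:
  fixes \<xi> h :: real
  assumes mesh: "0 < h" "h \<le> 1" and xi: "\<bar>\<xi>\<bar> * h ^ 2 \<le> 2"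
    and k: "real k + real p + real d = 4 / h ^ 3"
    and x: "x = 16 / h ^ 3 + 4 * \<xi> / h"
  shows "\<bar>lag_scaled p k x h\<bar> \<le> lag_const p \<xi> * (\<integral>t. exp (- (1 / 288) * t ^ 2) \<partial>lborel) * exp (- (h * real d))"
proof -
  have int: "integrable lborel (\<lambda>t. lag_const p \<xi> * exp (- (h * real d)) * exp (- (1 / 288) * t ^ 2))"
    using integrable_exp_minus_square[of "1 / 288"] by simp
  have int': "integrable lborel (\<lambda>t. lag_window p k x h t)"
  proof (rule Bochner_Integration.integrable_bound[OF int])
    show "AE t in lborel. norm (lag_window p k x h t) \<le> norm (lag_const p \<xi> * exp (- (h * real d)) * exp (- (1 / 288) * t ^ 2))"
      unfolding real_norm_def by (intro AE_I2 order_trans[OF norm_lag_phase_indicator_le[OF assms] abs_ge_self])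
  qed auto
  define D where "D = norm (\<integral>t. lag_window p k x h t \<partial>lborel)"
  define B where "B = (\<integral>t. lag_const p \<xi> * exp (- (h * real d)) * exp (- (1 / 288) * t ^ 2) \<partial>lborel)"
  have DB: "D \<le> B"
    unfolding D_def B_def
    by (rule Bochner_Integration.integral_norm_bound_integral[OF int' int norm_lag_phase_indicator_le[OF assms]])
  have "\<bar>lag_scaled p k x h\<bar> = D / (2 * pi)"
    using arg_cong[OF lag_scaled_eq[OF mesh(1), of p k x], of norm] by (simp add: norm_divide D_def)
  also have "\<dots> \<le> D / 1"
    using pi_gt3 by (intro divide_left_mono) (auto simp: D_def)
  also have "\<dots> \<le> B" using DB by simp
  also have "B = lag_const p \<xi> * exp (- (h * real d)) * (\<integral>t. exp (- (1 / 288) * t ^ 2) \<partial>lborel)"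
    unfolding B_def by (rule integral_mult_right_zero)
  finally show ?thesis by (simp only: mult_ac)
qed

text \<open>The factor \<open>(1 / 2) ^ Suc p\<close> is the value of
  \<open>inverse (1 + exp v) ^ Suc p\<close> at the saddle v = 0. The Gaussian alone serves as
  majorant here; the decay in \<open>d\<close> is needed only for the sum.\<close>

lemma tendsto_lag_scaled:
  fixes h x :: "nat \<Rightarrow> real" and k d :: "nat \<Rightarrow> nat"
  assumes mesh: "\<And>n. 0 < h n" "\<And>n. h n \<le> 1" "h \<longlonglongrightarrow> 0"
    and xi: "\<And>n. \<bar>\<xi>\<bar> * h n ^ 2 \<le> 2"
    and k: "\<And>n. real (k n) + real p + real (d n) = 4 / h n ^ 3"
    and x: "\<And>n. x n = 16 / h n ^ 3 + 4 * \<xi> / h n"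
    and d: "(\<lambda>n. h n * real (d n)) \<longlonglongrightarrow> u"
  shows "(\<lambda>n. lag_scaled p (k n) (x n) (h n)) \<longlonglongrightarrow> (1 / 2) ^ Suc p * Airy_Ai (\<xi> + u)"
proof -
  let ?f = "\<lambda>t. (1 / 2) ^ Suc p * (airy_weight t * exp (\<i> * of_real (\<xi> + u) * airy_path t))"
  have "(\<lambda>n. \<integral>t. lag_window p (k n) (x n) (h n) t \<partial>lborel) \<longlonglongrightarrow> (\<integral>t. ?f t \<partial>lborel)"
  proof (rule integral_dominated_convergence[where w = "\<lambda>t. lag_const p \<xi> * exp (- (1 / 288) * t ^ 2)"])
    show "integrable lborel (\<lambda>t. lag_const p \<xi> * exp (- (1 / 288) * t ^ 2))"
      using integrable_exp_minus_square[of "1 / 288"] by simp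
    show "AE t in lborel. norm (lag_window p (k n) (x n) (h n) t) \<le> lag_const p \<xi> * exp (- (1 / 288) * t ^ 2)" for n
    proof (intro AE_I2)
      fix t
      have "lag_const p \<xi> * exp (- (h n * real (d n))) \<le> lag_const p \<xi> * 1"
        using mesh(1)[of n] by (intro mult_left_mono) (auto simp: lag_const_def)
      then have "lag_const p \<xi> * exp (- (h n * real (d n))) * exp (- (1 / 288) * t ^ 2) \<le> lag_const p \<xi> * 1 * exp (- (1 / 288) * t ^ 2)"
        by (intro mult_right_mono) auto
      with norm_lag_phase_indicator_le[OF mesh(1,2) xi k x, of n t] 
      show "norm (lag_window p (k n) (x n) (h n) t) \<le> lag_const p \<xi> * exp (- (1 / 288) * t ^ 2)"
        by simp
    qed
    show "AE t in lborel. (\<lambda>n. lag_window p (k n) (x n) (h n) t) \<longlonglongrightarrow> ?f t"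
    proof (intro AE_I2)
      fix t :: real
      have "(\<lambda>n. h n * \<bar>t\<bar>) \<longlonglongrightarrow> 0 * \<bar>t\<bar>" by (intro tendsto_intros mesh)
      then have "\<forall>\<^sub>F n in sequentially. h n * \<bar>t\<bar> < pi"
        by (rule order_tendstoD) simp
      then have ev: "\<forall>\<^sub>F n in sequentially. lag_phase p (k n) (x n) (h n) t = lag_window p (k n) (x n) (h n) t"
      proof eventually_elim
        case (elim n)
        then have "\<bar>t\<bar> \<le> pi / h n" using mesh(1)[of n] by (simp add: pos_le_divide_eq mult.commute)
        then have "t \<in> {- pi / h n..pi / h n}" by (auto simp: abs_le_iff)
        then show ?case by simp
      qed
      show "(\<lambda>n. lag_window p (k n) (x n) (h n) t) \<longlonglongrightarrow> ?f t"
        by (rule Lim_transform_eventually[OF tendsto_lag_phase[OF mesh(1,3) k x d] ev])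
    qed
  qed auto
  then have "(\<lambda>n. (\<integral>t. lag_window p (k n) (x n) (h n) t \<partial>lborel) / (2 * pi)) \<longlonglongrightarrow> (\<integral>t. ?f t \<partial>lborel) / (2 * pi)"
    by (intro tendsto_intros) auto
  also have "(\<integral>t. ?f t \<partial>lborel) / (2 * pi) = of_real ((1 / 2) ^ Suc p * Airy_Ai (\<xi> + u))"
    using of_real_Airy_Ai[of "\<xi> + u"] by (simp add: airy_moment_def del: power_Suc)
  finally have "(\<lambda>n. complex_of_real (lag_scaled p (k n) (x n) (h n))) \<longlonglongrightarrow> of_real ((1 / 2) ^ Suc p * Airy_Ai (\<xi> + u))"
    unfolding lag_scaled_eq[OF mesh(1)] .
  then show ?thesis by (simp only: tendsto_of_real_iff)
qed

section \<open>The scaling limit\<close>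

lemma fact_ratio: "(fact k :: real) / fact (k + p) = (\<Prod>i<p. 1 / (real k + 1 + real i))"
proof (induction p)
  case (Suc p)
  have "(fact k :: real) / fact (k + Suc p) = fact k / fact (k + p) * (1 / (real k + 1 + real p))"
    by (simp add: field_simps)
  then show ?case unfolding Suc.IH by simp
qed simp

lemma abs_binexp_le: "\<bar>binexp \<beta> d\<bar> \<le> exp \<bar>\<beta>\<bar> * (real d + 1)"
proof -
  have "\<bar>binexp \<beta> d\<bar> \<le> (\<Sum>j\<le>d. \<bar>\<beta> ^ j / fact j * real (d - j + 1)\<bar>)"
    unfolding binexp_def by (rule sum_abs)
  also have "\<dots> \<le> (\<Sum>j\<le>d. \<bar>\<beta>\<bar> ^ j / fact j * (real d + 1))"
    by (intro sum_mono) (auto simp: abs_mult power_abs intro!: mult_left_mono divide_right_mono)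
  also have "\<dots> = (\<Sum>j\<le>d. \<bar>\<beta>\<bar> ^ j /\<^sub>R fact j) * (real d + 1)"
    unfolding sum_distrib_right by (simp add: divide_inverse mult_ac)
  also have "(\<Sum>j\<le>d. \<bar>\<beta>\<bar> ^ j /\<^sub>R fact j) \<le> exp \<bar>\<beta>\<bar>"
    unfolding exp_def by (rule sum_le_suminf[OF summable_exp_generic]) auto
  finally show ?thesis by (simp add: mult_right_mono)
qed

text \<open>Splitting \<open>d - j + 1\<close> writes \<open>binexp\<close> as \<open>d + 1\<close>
  times a partial sum of the exponential series minus a convergent sequence, which \<open>h\<close>
  kills. Positivity of \<open>u\<close> forces the indices to infinity.\<close>

lemma tendsto_binexp:
  fixes h :: "nat \<Rightarrow> real" and d :: "nat \<Rightarrow> nat"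
  assumes mesh: "\<And>n. 0 < h n" "h \<longlonglongrightarrow> 0" and d: "(\<lambda>n. h n * real (d n)) \<longlonglongrightarrow> u" and u: "u > 0"
  shows "(\<lambda>n. h n * binexp \<beta> (d n)) \<longlonglongrightarrow> u * exp \<beta>"
proof -
  define A where "A = (\<lambda>d. \<Sum>j\<le>d. \<beta> ^ j / fact j)"
  define B where "B = (\<lambda>d. \<Sum>j\<le>d. \<beta> ^ j / fact j * real j)"
  have eq: "binexp \<beta> d = (real d + 1) * A d - B d" for d
  proof -
    have "binexp \<beta> d = (\<Sum>j\<le>d. (real d + 1) * (\<beta> ^ j / fact j) - \<beta> ^ j / fact j * real j)"
      unfolding binexp_def by (intro sum.cong refl) (auto simp: of_nat_diff algebra_simps)
    then show ?thesis by (simp add: A_def B_def sum_subtractf sum_distrib_left)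
  qed
  have A: "A \<longlonglongrightarrow> exp \<beta>"
    using exp_converges[of \<beta>] unfolding A_def sums_def_le by (simp add: divide_inverse mult.commute)
  have "B (Suc d) = \<beta> * A d" for d
    unfolding B_def A_def sum.atMost_Suc_shift sum_distrib_left
    by (simp add: field_simps del: of_nat_Suc)
  then have "(\<lambda>d. B (Suc d)) \<longlonglongrightarrow> \<beta> * exp \<beta>" using tendsto_mult_left[OF A] by simp
  then have B: "B \<longlonglongrightarrow> \<beta> * exp \<beta>" by (rule LIMSEQ_imp_Suc)
  have "filterlim (\<lambda>n. inverse (h n)) at_top sequentially"
    by (rule filterlim_inverse_at_top[OF mesh(2)]) (simp add: mesh(1))
  from filterlim_tendsto_pos_mult_at_top[OF d u this]
  have "filterlim (\<lambda>n. real (d n)) at_top sequentially"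
    using mesh(1) by (simp add: less_imp_neq[symmetric] mult.commute[of "h _"] mult.assoc)
  then have d_top: "filterlim d at_top sequentially"
    by (simp add: filterlim_sequentially_iff_filterlim_real)
  have "(\<lambda>n. (h n * real (d n) + h n) * A (d n) - h n * B (d n)) \<longlonglongrightarrow> (u + 0) * exp \<beta> - 0 * (\<beta> * exp \<beta>)"
    by (intro tendsto_intros d mesh filterlim_compose[OF A d_top] filterlim_compose[OF B d_top])
  then show ?thesis by (simp add: eq algebra_simps)
qed

text \<open>A Riemann sum of mesh \<open>h\<close> as an integral. The floor form suits pointwise
  limits; the sum of indicators in \<open>step_eq_sum\<close> suits integration and
  measurability.\<close>

definition step :: "real \<Rightarrow> nat \<Rightarrow> (nat \<Rightarrow> real) \<Rightarrow> real \<Rightarrow> real" where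
  "step h M g u = (if 0 \<le> u \<and> nat \<lfloor>u / h\<rfloor> \<le> M then g (nat \<lfloor>u / h\<rfloor>) else 0)"

lemma step_eq_sum:
  assumes "h > 0"
  shows "step h M g u = (\<Sum>d\<le>M. indicator {h * real d..<h * real (Suc d)} u * g d)"
proof (cases "0 \<le> u")
  case True
  have iff: "u \<in> {h * real d..<h * real (Suc d)} \<longleftrightarrow> d = nat \<lfloor>u / h\<rfloor>" for d
  proof -
    have "u \<in> {h * real d..<h * real (Suc d)} \<longleftrightarrow> real d \<le> u / h \<and> u / h < real d + 1"
      using assms by (auto simp: field_simps)
    also have "\<dots> \<longleftrightarrow> \<lfloor>u / h\<rfloor> = int d" by (auto simp: floor_eq_iff)
    also have "\<dots> \<longleftrightarrow> d = nat \<lfloor>u / h\<rfloor>" using True assms by auto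
    finally show ?thesis .
  qed
  have "indicator {h * real d..<h * real (Suc d)} u = (if d = nat \<lfloor>u / h\<rfloor> then 1 else 0 :: real)" for d
    unfolding indicator_def iff by simp
  then have "(\<Sum>d\<le>M. indicator {h * real d..<h * real (Suc d)} u * g d) = (\<Sum>d\<le>M. if d = nat \<lfloor>u / h\<rfloor> then g d else 0)"
    by (intro sum.cong refl) simp
  then show ?thesis using True by (simp add: step_def)
next
  case False
  have "u < h * real d" for d using False assms by (meson linorder_not_le mult_nonneg_nonneg of_nat_0_le_iff order.strict_trans2 less_imp_le)
  then have "indicator {h * real d..<h * real (Suc d)} u = (0 :: real)" for d by (auto simp: indicator_def not_le)
  then show ?thesis using False by (simp add: step_def)
qed

lemma integral_step:
  assumes h: "h > 0"
  shows "(\<integral>u. step h M g u \<partial>lborel) = (\<Sum>d\<le>M. h * g d)"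
proof -
  have int: "integrable lborel (\<lambda>u. indicator {h * real d..<h * real (Suc d)} u * g d)" for d
    by (intro integrable_mult_left integrable_real_indicator) (use h in \<open>auto simp: emeasure_lborel_Ico\<close>)
  have "(\<integral>u. step h M g u \<partial>lborel) = (\<Sum>d\<le>M. \<integral>u. indicator {h * real d..<h * real (Suc d)} u * g d \<partial>lborel)"
    unfolding step_eq_sum[OF h] by (rule Bochner_Integration.integral_sum) (rule int)
  also have "\<dots> = (\<Sum>d\<le>M. h * g d)"
    using h by (intro sum.cong refl) (simp add: algebra_simps)
  finally show ?thesis .
qed

lemma measurable_step:
  assumes "h > 0"
  shows "step h M g \<in> borel_measurable borel"
proof -
  have eq: "step h M g = (\<lambda>u. \<Sum>d\<le>M. indicator {h * real d..<h * real (Suc d)} u * g d)"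
    by (rule ext) (rule step_eq_sum[OF assms])
  show ?thesis unfolding eq by measurable
qed

text \<open>A factor exceeds 4 only if k is below half of N. Then d is at least N / 4, so h d is at
  least 1 / h^2, and its square already dominates 1 / h^3. The resulting polynomial growth in h d is
  later absorbed by the exponential decay.\<close>

lemma weight_bound:
  fixes h :: real
  assumes mesh: "0 < h" "h \<le> 1" and k: "real k + real p + real d = 4 / h ^ 3" and large: "4 * real p \<le> 4 / h ^ 3"
  shows "(\<Prod>i<p. (4 / h ^ 3) / (real k + 1 + real i)) \<le> (4 * (1 + h * real d) ^ 2) ^ p"
proof -
  define N where "N = 4 / h ^ 3"
  have N: "N \<ge> 0" using mesh by (simp add: N_def)
  have "N / (real k + 1 + real i) \<le> 4 * (1 + h * real d) ^ 2" for i
  proof -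
    have pos: "1 \<le> (1 + h * real d) ^ 2" using mesh by (intro one_le_power) auto
    show ?thesis
    proof (cases "N \<le> 2 * (real k + 1)")
      case True
      then have "N \<le> 4 * (real k + 1 + real i)"
        using of_nat_0_le_iff[of k, where 'a = real] of_nat_0_le_iff[of i, where 'a = real] by argo
      then have "N / (real k + 1 + real i) \<le> 4" by (simp add: divide_le_eq)
      then show ?thesis using pos by linarith
    next
      case False
      have "N \<le> 4 * real d" using False k large by (simp add: N_def[symmetric])
      then have "h * N \<le> h * (4 * real d)" using mesh by (intro mult_left_mono) auto
      moreover have "h * N = 4 / h ^ 2" using mesh by (simp add: N_def power2_eq_square power3_eq_cube)
      ultimately have "1 / h ^ 2 \<le> h * real d" by simp
      moreover have "1 \<le> 1 / h ^ 2" using mesh by (simp add: power_le_one)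
      ultimately have "(1 / h ^ 2) ^ 2 \<le> (1 + h * real d) ^ 2" by (intro power_mono) auto
      moreover have "1 / h ^ 3 \<le> (1 / h ^ 2) ^ 2"
        using mesh by (simp add: field_simps power2_eq_square power3_eq_cube)
      ultimately have "N \<le> 4 * (1 + h * real d) ^ 2" by (simp add: N_def)
      moreover have "N / (real k + 1 + real i) \<le> N / 1" using N by (intro divide_left_mono) auto
      ultimately show ?thesis by simp
    qed
  qed
  then have "(\<Prod>i<p. N / (real k + 1 + real i)) \<le> (\<Prod>i<p. 4 * (1 + h * real d) ^ 2)"
    by (intro prod_mono) (use N in auto)
  then show ?thesis by (simp add: N_def)
qed

text \<open>One term of the rescaled sum over \<open>d\<close>, divided by the mesh \<open>h\<close>. The index \<open>k\<close> stands for \<open>N - p - d\<close>; it is a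
  separate argument so that the limit is stated along arbitrary sequences without natural subtraction.\<close>

definition summand :: "real \<Rightarrow> nat \<Rightarrow> real \<Rightarrow> nat \<Rightarrow> real \<Rightarrow> real \<Rightarrow> nat \<Rightarrow> nat \<Rightarrow> real" where
  "summand \<beta> p h N x y k d = 4 * (h * binexp \<beta> d)
     * ((\<Prod>i<p. real N / (real k + 1 + real i)) * (x / real N * (y / real N)) powr (real p / 2))
     * (lag_scaled p k x h * lag_scaled p k y h)"

text \<open>\<open>N ^ p\<close> is moved from the prefactor into the factorial ratio, so that every
  factor of \<open>summand\<close> has a finite limit. The two factors 1 / h in
  \<open>lag_scaled\<close> are balanced by one \<open>h\<close> that normalises
  \<open>binexp\<close> and one that is the mesh of the Riemann sum.\<close>

lemma scaled_corr_sum: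
  assumes mesh: "h > 0" and N: "p \<le> N" "0 < N"
  shows "4 * ((x * y) powr (real p / 2) * exp (- (x + y) / 2)) * corr_sum \<beta> N (N - p) x y
     = (\<Sum>d\<le>N - p. h * summand \<beta> p h N x y (N - p - d) d)"
proof -
  have pow: "(x * y) powr (real p / 2) = real N ^ p * (x / real N * (y / real N)) powr (real p / 2)"
  proof -
    have "x * y = (real N * real N) * (x / real N * (y / real N))" using N by simp
    then have "(x * y) powr (real p / 2) = (real N * real N) powr (real p / 2) * (x / real N * (y / real N)) powr (real p / 2)"
      by (metis powr_mult)
    also have "(real N * real N) powr (real p / 2) = real N powr (real p)"
      using N by (simp add: powr_mult flip: powr_add)
    also have "\<dots> = real N ^ p" using N by (simp add: powr_realpow)
    finally show ?thesis .
  qed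
  have "4 * ((x * y) powr (real p / 2) * exp (- (x + y) / 2)) * (binexp \<beta> d * lag_kernel (N - p - d) (N - d) x y)
      = h * summand \<beta> p h N x y (N - p - d) d" if d: "d \<le> N - p" for d
  proof -
    define k where "k = N - p - d"
    have kN: "N - d = k + p" using d N by (simp add: k_def)
    have prod: "(\<Prod>i<p. real N / (real k + 1 + real i)) = real N ^ p * (fact k / fact (k + p))"
      unfolding fact_ratio by (simp add: prod_dividef)
    have ee: "exp (- (x + y) / 2) = exp (- x / 2) * exp (- y / 2)" by (simp add: add_divide_distrib flip: exp_add)
    have sq: "lag_scaled p k x h * lag_scaled p k y h = exp (- x / 2) * exp (- y / 2) * lag k (k + p) x * lag k (k + p) y / h ^ 2"
    proof -
      have "((- 1) ^ k * a) * ((- 1) ^ k * c) = a * c" for a c :: real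
        by (metis (no_types, lifting) left_minus_one_mult_self mult.assoc mult.left_commute)
      then have "((- 1) ^ k * (exp (- x / 2) * lag k (k + p) x)) * ((- 1) ^ k * (exp (- y / 2) * lag k (k + p) y))
        = (exp (- x / 2) * lag k (k + p) x) * (exp (- y / 2) * lag k (k + p) y)" .
      then show ?thesis unfolding lag_scaled_def by (simp add: power2_eq_square mult_ac)
    qed
    have gen: "4 * (P * R * (E * F)) * (c * (f * a * b)) = h * (4 * (h * c) * (P * f * R) * (E * F * a * b / h ^ 2))" for P R E F c f a b :: real
      using mesh by (simp add: power2_eq_square)
    show ?thesis
      unfolding k_def[symmetric] kN summand_def prod sq lag_kernel_def pow ee by (rule gen)
  qed
  then show ?thesis
    unfolding corr_sum_def sum_distrib_left by (intro sum.cong) auto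
qed

text \<open>The sum is the integral of the step function \<open>f n\<close>; its majorant is a
  multiple of exp (- u) on the half-line, and \<open>diff_airy_kernel_eq_integral\<close> identifies
  the limiting integral.\<close>

lemma corr_sum_limit:
  fixes N :: "nat \<Rightarrow> nat" and h x y :: "nat \<Rightarrow> real" and \<mu> \<nu> :: real
  assumes mesh: "\<And>n. 0 < h n" "\<And>n. h n \<le> 1" "h \<longlonglongrightarrow> 0"
    and N: "\<And>n. real (N n) = 4 / h n ^ 3" "\<And>n. 4 * p \<le> N n"
    and mu: "\<And>n. \<bar>\<mu>\<bar> * h n ^ 2 \<le> 2" and nu: "\<And>n. \<bar>\<nu>\<bar> * h n ^ 2 \<le> 2"
    and x: "\<And>n. x n = 16 / h n ^ 3 + 4 * \<mu> / h n" and y: "\<And>n. y n = 16 / h n ^ 3 + 4 * \<nu> / h n"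
  shows "(\<lambda>n. \<Sum>d\<le>N n - p. h n * summand \<beta> p (h n) (N n) (x n) (y n) (N n - p - d) d)
     \<longlonglongrightarrow> exp \<beta> * diff_airy_kernel \<mu> \<nu>"
proof -
  define g where "g = (\<lambda>n d. summand \<beta> p (h n) (N n) (x n) (y n) (N n - p - d) d)"
  define f where "f = (\<lambda>n. step (h n) (N n - p) (g n))"
  define J where "J = ((\<integral>t. exp (- (1 / 288) * t ^ 2) \<partial>lborel) :: real)"
  define C\<mu> where "C\<mu> = lag_const p \<mu> * J"
  define C\<nu> where "C\<nu> = lag_const p \<nu> * J"
  have Jnn: "0 \<le> J" unfolding J_def by (rule Bochner_Integration.integral_nonneg) simp
  have Cnn: "0 \<le> C\<mu>" "0 \<le> C\<nu>" using Jnn by (simp_all add: C\<mu>_def C\<nu>_def lag_const_def)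
  have ratio: "x n / real (N n) = 4 + \<mu> * h n ^ 2" "y n / real (N n) = 4 + \<nu> * h n ^ 2" for n
    using mesh(1)[of n] unfolding N x y by (simp_all add: field_simps power2_eq_square power3_eq_cube)
  have ratio_bounds: "0 \<le> x n / real (N n) * (y n / real (N n))" "x n / real (N n) * (y n / real (N n)) \<le> 36" for n
  proof -
    have "\<bar>\<mu> * h n ^ 2\<bar> \<le> 2" "\<bar>\<nu> * h n ^ 2\<bar> \<le> 2" using mu[of n] nu[of n] by (simp_all add: abs_mult)
    then have b: "0 \<le> 4 + \<mu> * h n ^ 2" "4 + \<mu> * h n ^ 2 \<le> 6" "0 \<le> 4 + \<nu> * h n ^ 2" "4 + \<nu> * h n ^ 2 \<le> 6"
      by linarith+
    show "0 \<le> x n / real (N n) * (y n / real (N n))" unfolding ratio using b by simp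
    show "x n / real (N n) * (y n / real (N n)) \<le> 36"
      unfolding ratio using mult_mono[OF b(2) b(4)] b by simp
  qed
  define K where "K = 4 * exp \<bar>\<beta>\<bar> * (4 ^ p * 36 powr (real p / 2)) * (C\<mu> * C\<nu>)"
  have g_bound: "\<bar>g n d\<bar> \<le> K * (fact (2 * p + 1) * exp 1) * exp (- (h n * real d))" if d: "d \<le> N n - p" for n d
  proof -
    define k where "k = N n - p - d"
    define s where "s = h n * real d"
    have s: "0 \<le> s" using mesh(1)[of n] by (simp add: s_def)
    have k: "real k + real p + real d = 4 / h n ^ 3"
      using d N(2)[of n] unfolding N(1)[of n, symmetric] by (simp add: k_def)
    have "\<bar>lag_scaled p k (x n) (h n)\<bar> \<le> C\<mu> * exp (- s)"
      unfolding C\<mu>_def J_def s_def by (rule lag_scaled_bound[OF mesh(1,2) mu k x])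
    moreover have "\<bar>lag_scaled p k (y n) (h n)\<bar> \<le> C\<nu> * exp (- s)"
      unfolding C\<nu>_def J_def s_def by (rule lag_scaled_bound[OF mesh(1,2) nu k y])
    ultimately have 1: "\<bar>lag_scaled p k (x n) (h n)\<bar> * \<bar>lag_scaled p k (y n) (h n)\<bar> \<le> (C\<mu> * exp (- s)) * (C\<nu> * exp (- s))"
      by (intro mult_mono) (use Cnn in auto)
    have 2: "h n * \<bar>binexp \<beta> d\<bar> \<le> exp \<bar>\<beta>\<bar> * (1 + s)"
    proof -
      have "h n * \<bar>binexp \<beta> d\<bar> \<le> h n * (exp \<bar>\<beta>\<bar> * (real d + 1))"
        using mesh(1)[of n] by (intro mult_left_mono abs_binexp_le) auto
      also have "\<dots> = exp \<bar>\<beta>\<bar> * (s + h n)" by (simp add: s_def algebra_simps)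
      also have "\<dots> \<le> exp \<bar>\<beta>\<bar> * (1 + s)" using mesh(2)[of n] by (intro mult_left_mono) auto
      finally show ?thesis .
    qed
    have Nnn: "0 \<le> 4 / h n ^ 3" using mesh(1)[of n] by simp
    have prod_nn: "0 \<le> (\<Prod>i<p. real (N n) / (real k + 1 + real i))"
      by (intro prod_nonneg) auto
    have 3: "(\<Prod>i<p. real (N n) / (real k + 1 + real i)) * (x n / real (N n) * (y n / real (N n))) powr (real p / 2)
       \<le> (4 * (1 + s) ^ 2) ^ p * 36 powr (real p / 2)"
    proof (rule mult_mono)
      show "(\<Prod>i<p. real (N n) / (real k + 1 + real i)) \<le> (4 * (1 + s) ^ 2) ^ p"
      proof -
        have "4 * real p \<le> 4 / h n ^ 3" using N(2)[of n] unfolding N(1)[of n, symmetric] by linarith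
        then show ?thesis unfolding s_def N(1) by (intro weight_bound mesh k)
      qed
      show "(x n / real (N n) * (y n / real (N n))) powr (real p / 2) \<le> 36 powr (real p / 2)"
        using ratio_bounds by (intro powr_mono2) auto
    qed auto
    have "\<bar>g n d\<bar> = 4 * (h n * \<bar>binexp \<beta> d\<bar>)
       * ((\<Prod>i<p. real (N n) / (real k + 1 + real i)) * (x n / real (N n) * (y n / real (N n))) powr (real p / 2))
       * (\<bar>lag_scaled p k (x n) (h n)\<bar> * \<bar>lag_scaled p k (y n) (h n)\<bar>)"
    proof -
      have "g n d = summand \<beta> p (h n) (N n) (x n) (y n) k d" by (simp only: g_def k_def)
      then show ?thesis
        using mesh(1)[of n] unfolding summand_def by (simp add: abs_mult abs_of_nonneg[OF prod_nn])
    qed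
    also have "\<dots> \<le> 4 * (exp \<bar>\<beta>\<bar> * (1 + s)) * ((4 * (1 + s) ^ 2) ^ p * 36 powr (real p / 2)) * ((C\<mu> * exp (- s)) * (C\<nu> * exp (- s)))"
      by (intro mult_mono 1 2 3 mult_left_mono) (use s prod_nn mesh(1)[of n] Cnn in \<open>auto intro!: mult_nonneg_nonneg\<close>)
    also have "\<dots> = K * ((1 + s) ^ (2 * p + 1) * exp (- s) * exp (- s))"
      by (simp add: K_def power_mult_distrib power_mult[symmetric] mult_ac)
    \<comment> \<open>The power collects one factor 1 + s from \<open>binexp\<close> and 2 p from
      the weight. It costs one of the two exponentials supplied by the Laguerre factors; the other
      survives.\<close>
    also have "\<dots> \<le> K * ((fact (2 * p + 1) * exp (1 + s)) * exp (- s) * exp (- s))"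
      using s Cnn by (intro mult_left_mono mult_right_mono power_le_exp) (auto simp: K_def)
    also have "\<dots> = K * (fact (2 * p + 1) * exp 1) * exp (- s)"
      by (simp add: exp_add exp_minus)
    finally show ?thesis by (simp add: s_def)
  qed
  define K' where "K' = K * (fact (2 * p + 1) * exp 1)"
  have K'nn: "0 \<le> K'" using Cnn by (simp add: K'_def K_def)
  have "(\<lambda>n. \<integral>u. f n u \<partial>lborel) \<longlonglongrightarrow> (\<integral>u. exp \<beta> * airy_integrand \<mu> \<nu> u \<partial>lborel)"
  proof (rule integral_dominated_convergence[where w = "\<lambda>u. K' * exp 1 * (indicator {0..} u * exp (- u))"])
    show "AE u in lborel. norm (f n u) \<le> K' * exp 1 * (indicator {0..} u * exp (- u))" for n
    proof (intro AE_I2)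
      fix u :: real
      show "norm (f n u) \<le> K' * exp 1 * (indicator {0..} u * exp (- u))"
      proof (cases "0 \<le> u \<and> nat \<lfloor>u / h n\<rfloor> \<le> N n - p")
        case True
        define d where "d = nat \<lfloor>u / h n\<rfloor>"
        have "u / h n < real d + 1"
          using True mesh(1)[of n] by (simp add: d_def)
        then have "u < h n * real d + h n"
          using mesh(1)[of n] by (simp add: divide_less_eq algebra_simps)
        \<comment> \<open>Within one mesh cell \<open>u\<close> exceeds \<open>h n * real d\<close>
          by at most 1, which accounts for the factor \<open>exp 1\<close> in the majorant.\<close>
        then have ud: "- (h n * real d) \<le> 1 + - u" using mesh(2)[of n] by linarith
        have "norm (f n u) = \<bar>g n d\<bar>" using True by (simp add: f_def step_def d_def)
        also have "\<dots> \<le> K' * exp (- (h n * real d))"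
          unfolding K'_def by (rule g_bound) (use True in \<open>simp add: d_def\<close>)
        also have "\<dots> \<le> K' * exp (1 + - u)" using ud K'nn by (intro mult_left_mono) auto
        finally show ?thesis using True by (simp only: exp_add) simp
      next
        case False
        then show ?thesis using K'nn by (auto simp: f_def step_def)
      qed
    qed
    \<comment> \<open>The point 0 is discarded because \<open>tendsto_binexp\<close> needs a
      positive limit.\<close>
    have "AE u :: real in lborel. u \<noteq> 0" by (rule AE_lborel_singleton)
    then show "AE u in lborel. (\<lambda>n. f n u) \<longlonglongrightarrow> exp \<beta> * airy_integrand \<mu> \<nu> u"
    proof eventually_elim
      case (elim u)
      show ?case
      proof (cases "u < 0")
        case True
        then show ?thesis by (simp add: f_def step_def airy_integrand_def)
      next
        case False
        then have u: "u > 0" using elim by simp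
        define d0 where "d0 = (\<lambda>n. nat \<lfloor>u / h n\<rfloor>)"
        \<comment> \<open>Replacing indices beyond the range by 0 keeps k + p + d = N true for every
          \<open>n\<close>, as \<open>tendsto_lag_scaled\<close> requires; eventually nothing is
          replaced.\<close>
        define d where "d = (\<lambda>n. if d0 n \<le> N n - p then d0 n else 0)"
        define k where "k = (\<lambda>n. N n - p - d n)"
        have dle: "d n \<le> N n - p" for n by (simp add: d_def)
        have k: "real (k n) + real p + real (d n) = 4 / h n ^ 3" for n
          using dle[of n] N(2)[of n] unfolding N(1)[of n, symmetric] by (simp add: k_def)
        have d0_bounds: "h n * real (d0 n) \<le> u" "u - h n \<le> h n * real (d0 n)" for n
        proof -
          have "real (d0 n) \<le> u / h n" "u / h n < real (d0 n) + 1"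
            using u mesh(1)[of n] by (simp_all add: d0_def)
          then show "h n * real (d0 n) \<le> u" "u - h n \<le> h n * real (d0 n)"
            using mesh(1)[of n] by (simp_all add: field_simps)
        qed
        have lim_d0: "(\<lambda>n. h n * real (d0 n)) \<longlonglongrightarrow> u"
        proof (rule tendsto_sandwich[of "\<lambda>n. u - h n" _ _ "\<lambda>_. u"])
          show "(\<lambda>n. u - h n) \<longlonglongrightarrow> u" using tendsto_diff[OF tendsto_const mesh(3), of u] by simp
        qed (auto intro: d0_bounds always_eventually)
        have "\<forall>\<^sub>F n in sequentially. d n = d0 n"
        proof -
          \<comment> \<open>This is d0 + p \<le> N multiplied by h^3, with \<open>d0\<close>
            estimated by u / h and N = 4 / h^3.\<close>
          have "(\<lambda>n. u * h n ^ 2 + real p * h n ^ 3) \<longlonglongrightarrow> u * 0 ^ 2 + real p * 0 ^ 3"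
            by (intro tendsto_intros mesh)
          then have "(\<lambda>n. u * h n ^ 2 + real p * h n ^ 3) \<longlonglongrightarrow> 0" by simp
          then have "\<forall>\<^sub>F n in sequentially. u * h n ^ 2 + real p * h n ^ 3 < 4"
            by (rule order_tendstoD) simp
          then show ?thesis
          proof eventually_elim
            case (elim n)
            have e: "h n > 0" by (rule mesh)
            have "h n * real (d0 n) * h n ^ 2 \<le> u * h n ^ 2"
              using d0_bounds(1)[of n] by (intro mult_right_mono) auto
            then have "(real (d0 n) + real p) * h n ^ 3 \<le> 4"
              using elim by (simp add: algebra_simps power2_eq_square power3_eq_cube)
            then have "real (d0 n) + real p \<le> real (N n)"
              unfolding N(1) using e by (simp add: pos_le_divide_eq)
            then have "d0 n \<le> N n - p" by linarith
            then show ?case by (simp add: d_def)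
          qed
        qed
        note ev = this
        have lim_d: "(\<lambda>n. h n * real (d n)) \<longlonglongrightarrow> u"
          by (rule Lim_transform_eventually[OF lim_d0]) (use ev in eventually_elim, simp)
        have lag1: "(\<lambda>n. lag_scaled p (k n) (x n) (h n)) \<longlonglongrightarrow> (1 / 2) ^ Suc p * Airy_Ai (\<mu> + u)"
          by (rule tendsto_lag_scaled[OF mesh mu k x lim_d])
        have lag2: "(\<lambda>n. lag_scaled p (k n) (y n) (h n)) \<longlonglongrightarrow> (1 / 2) ^ Suc p * Airy_Ai (\<nu> + u)"
          by (rule tendsto_lag_scaled[OF mesh nu k y lim_d])
        have factor: "(\<lambda>n. real (N n) / (real (k n) + 1 + real i)) \<longlonglongrightarrow> 1" for i
        proof -
          have "(\<lambda>n. 1 / (1 + (1 + real i - real p) * h n ^ 3 / 4 - (h n * real (d n)) * h n ^ 2 / 4)) \<longlonglongrightarrow> 1 / (1 + (1 + real i - real p) * 0 ^ 3 / 4 - u * 0 ^ 2 / 4)"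
            by (intro tendsto_intros mesh lim_d) simp_all
          moreover have "1 / (1 + (1 + real i - real p) * h n ^ 3 / 4 - (h n * real (d n)) * h n ^ 2 / 4) = real (N n) / (real (k n) + 1 + real i)" for n
          proof -
            have e: "h n > 0" by (rule mesh)
            have kn: "real (k n) = 4 / h n ^ 3 - real p - real (d n)" using k[of n] by simp
            have "(real (k n) + 1 + real i) * (h n ^ 3 / 4) = 1 + (1 + real i - real p) * h n ^ 3 / 4 - (h n * real (d n)) * h n ^ 2 / 4"
              unfolding kn using e by (simp add: field_simps power2_eq_square power3_eq_cube)
            moreover have "real (N n) = 1 / (h n ^ 3 / 4)" unfolding N(1) by simp
            ultimately show ?thesis by (metis divide_divide_eq_left mult.commute)
          qed
          ultimately show ?thesis by simp
        qed
        have "(\<lambda>n. \<Prod>i<p. real (N n) / (real (k n) + 1 + real i)) \<longlonglongrightarrow> (\<Prod>i<p. 1)"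
          by (intro tendsto_prod factor)
        then have prod_lim: "(\<lambda>n. \<Prod>i<p. real (N n) / (real (k n) + 1 + real i)) \<longlonglongrightarrow> 1" by simp
        have "(\<lambda>n. ((4 + \<mu> * h n ^ 2) * (4 + \<nu> * h n ^ 2)) powr (real p / 2)) \<longlonglongrightarrow> ((4 + \<mu> * 0 ^ 2) * (4 + \<nu> * 0 ^ 2)) powr (real p / 2)"
          by (intro tendsto_intros mesh) simp
        moreover have "((4 + \<mu> * 0 ^ 2) * (4 + \<nu> * 0 ^ 2)) powr (real p / 2) = 4 ^ p"
        proof -
          have "(16 :: real) = 4 powr 2" by simp
          then have "(16 :: real) powr (real p / 2) = 4 powr (real p)" by (simp only: powr_powr) simp
          then show ?thesis by (simp add: powr_realpow)
        qed
        ultimately have powr_lim: "(\<lambda>n. (x n / real (N n) * (y n / real (N n))) powr (real p / 2)) \<longlonglongrightarrow> 4 ^ p"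
          unfolding ratio by simp
        have "(\<lambda>n. summand \<beta> p (h n) (N n) (x n) (y n) (k n) (d n)) \<longlonglongrightarrow>
            4 * (u * exp \<beta>) * (1 * 4 ^ p) * (((1 / 2) ^ Suc p * Airy_Ai (\<mu> + u)) * ((1 / 2) ^ Suc p * Airy_Ai (\<nu> + u)))"
          unfolding summand_def
          by (intro tendsto_intros tendsto_binexp[OF mesh(1,3) lim_d u] prod_lim powr_lim lag1 lag2)
        also have "4 * (u * exp \<beta>) * (1 * 4 ^ p) * (((1 / 2) ^ Suc p * Airy_Ai (\<mu> + u)) * ((1 / 2) ^ Suc p * Airy_Ai (\<nu> + u)))
           = exp \<beta> * airy_integrand \<mu> \<nu> u"
        proof -
          \<comment> \<open>Here the constant 4 of the theorem is used up: with the limit 4^p of the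
            ratio it cancels the two factors 2^(- p - 1) from the Laguerre asymptotics.\<close>
          have "4 * 4 ^ p * ((1 / 2) ^ Suc p * (1 / 2) ^ Suc p) = (1 :: real)"
          proof -
            have "(1 / 2 :: real) ^ Suc p * (1 / 2) ^ Suc p = (1 / 4) ^ Suc p" by (simp flip: power_mult_distrib)
            then show ?thesis by (simp add: power_divide)
          qed
          then have gen: "4 * (u * E) * (1 * 4 ^ p) * (((1 / 2) ^ Suc p * a) * ((1 / 2) ^ Suc p * c)) = E * (u * a * c)" for E a c
            by (metis (no_types, opaque_lifting) mult.assoc mult.commute mult.left_commute mult_1)
          show ?thesis unfolding gen using u by (simp add: airy_integrand_def)
        qed
        finally have L: "(\<lambda>n. summand \<beta> p (h n) (N n) (x n) (y n) (k n) (d n)) \<longlonglongrightarrow> exp \<beta> * airy_integrand \<mu> \<nu> u" .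
        show ?thesis
        proof (rule Lim_transform_eventually[OF L])
          show "\<forall>\<^sub>F n in sequentially. summand \<beta> p (h n) (N n) (x n) (y n) (k n) (d n) = f n u"
            using ev
          proof eventually_elim
            case (elim n)
            have "d0 n \<le> N n - p" using dle[of n] elim by simp
            then show ?case using u elim by (simp add: f_def step_def g_def k_def d0_def)
          qed
        qed
      qed
    qed
    show "(\<lambda>u. exp \<beta> * airy_integrand \<mu> \<nu> u) \<in> borel_measurable lborel" by measurable
    show "f n \<in> borel_measurable lborel" for n unfolding f_def using measurable_step[OF mesh(1)] by simp
  qed (use integrable_exp_decay in simp)
  then show ?thesis
    unfolding f_def integral_step[OF mesh(1)] g_def by (simp add: diff_airy_kernel_eq_integral)
qed

section \<open>Translation between the matrix size and the mesh\<close>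

theorem theorem5p2:
  fixes Q :: "real measure" and b :: real and \<alpha> :: nat and \<mu> \<nu> :: real
  assumes "real_distribution Q"
    and "prob_space.expectation Q (\<lambda>x. x) = 0"
    and "prob_space.variance Q (\<lambda>x. x) = 1"
    and "integrable Q (\<lambda>x. x ^ 4)"
    and "b = prob_space.expectation Q (\<lambda>x. x ^ 4)"
  shows "(\<lambda>N. 4 * complex_of_real (Z_factor \<alpha> N (2 powr (4 / 3) * \<mu>) (2 powr (4 / 3) * \<nu>))
            * (corr2 Q N (N - \<alpha>)
                 (complex_of_real (4 * real N + 2 powr (4 / 3) * \<mu> * real N powr (1 / 3)))
                 (complex_of_real (4 * real N + 2 powr (4 / 3) * \<nu> * real N powr (1 / 3)))
               / (fact N * fact (N - \<alpha>))))
         \<longlonglongrightarrow> complex_of_real (exp (b - 3) * diff_airy_kernel \<mu> \<nu>)"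
proof -
  interpret real_distribution Q by (rule assms(1))
  have nd: "normalized_distribution Q b"
    using assms by (simp add: normalized_distribution_def normalized_distribution_axioms_def)
  define X where "X = (\<lambda>\<xi> N. 4 * real N + 2 powr (4 / 3) * \<xi> * real N powr (1 / 3))"
  define h where "h = (\<lambda>N. (4 / real N) powr (1 / 3))"
  have eta_pos: "0 < h N" if "0 < N" for N using that by (simp add: h_def)
  have eta3: "real N = 4 / h N ^ 3" if "0 < N" for N
  proof -
    have "h N ^ 3 = 4 / real N"
      using that by (simp add: h_def powr_power)
    then show ?thesis using that by simp
  qed
  have X_eq: "X \<xi> N = 16 / h N ^ 3 + 4 * \<xi> / h N" if N: "0 < N" for \<xi> N
  proof -
    have a: "4 / h N = 2 powr (4 / 3) * real N powr (1 / 3)"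
    proof -
      have "(4 :: real) powr (2 / 3) = 2 powr (4 / 3)"
      proof -
        have "(4 :: real) = 2 powr 2" by simp
        then show ?thesis by (simp only: powr_powr) simp
      qed
      moreover have "4 / (4 / real N) powr (1 / 3) = 4 powr (2 / 3) * real N powr (1 / 3)"
      proof -
        have "(4 :: real) / 4 powr (1 / 3) = 4 powr (2 / 3)" using powr_diff[of "4 :: real" 1 "1 / 3"] by simp
        moreover have "4 / (4 / real N) powr (1 / 3) = 4 / 4 powr (1 / 3) * real N powr (1 / 3)"
          using N by (simp add: powr_divide)
        ultimately show ?thesis by simp
      qed
      ultimately show ?thesis by (simp add: h_def)
    qed
    have b: "16 / h N ^ 3 = 4 * real N" using eta3[OF N] by simp
    have c: "4 * \<xi> / h N = \<xi> * (4 / h N)" by simp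
    show ?thesis unfolding X_def b c a by simp
  qed
  \<comment> \<open>The base of the power factors into the two spectral arguments, and the
    exponential is the product of the weights exp (- x / 2) contained in
    \<open>lag_scaled\<close>.\<close>
  have Z: "Z_factor \<alpha> N (2 powr (4 / 3) * \<mu>) (2 powr (4 / 3) * \<nu>) = (X \<mu> N * X \<nu> N) powr (real \<alpha> / 2) * exp (- (X \<mu> N + X \<nu> N) / 2)" if N: "0 < N" for N
  proof -
    have p: "real N powr (4 / 3) = real N * real N powr (1 / 3)" "real N powr (2 / 3) = real N powr (1 / 3) * real N powr (1 / 3)"
      using N powr_add[of "real N" 1 "1 / 3"] by (simp_all flip: powr_add)
    have "16 * real N ^ 2 + 4 * (2 powr (4 / 3) * \<mu> + 2 powr (4 / 3) * \<nu>) * real N powr (4 / 3) + 2 powr (4 / 3) * \<mu> * (2 powr (4 / 3) * \<nu>) * real N powr (2 / 3) = X \<mu> N * X \<nu> N"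
      unfolding p X_def by (simp add: power2_eq_square algebra_simps)
    moreover have "- 4 * real N - 1 / 2 * (2 powr (4 / 3) * \<mu> + 2 powr (4 / 3) * \<nu>) * real N powr (1 / 3) = - (X \<mu> N + X \<nu> N) / 2"
      unfolding X_def by (simp add: algebra_simps)
    ultimately show ?thesis unfolding Z_factor_def by metis
  qed
  have eta0: "h \<longlonglongrightarrow> 0" unfolding h_def by real_asymp
  have "(\<lambda>N. \<bar>\<mu>\<bar> * h N ^ 2) \<longlonglongrightarrow> \<bar>\<mu>\<bar> * 0 ^ 2" "(\<lambda>N. \<bar>\<nu>\<bar> * h N ^ 2) \<longlonglongrightarrow> \<bar>\<nu>\<bar> * 0 ^ 2"
    by (intro tendsto_intros eta0)+
  then have "\<forall>\<^sub>F N in sequentially. \<bar>\<mu>\<bar> * h N ^ 2 < 2" "\<forall>\<^sub>F N in sequentially. \<bar>\<nu>\<bar> * h N ^ 2 < 2"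
    by (auto dest!: order_tendstoD(2)[of _ _ _ 2])
  moreover have "\<forall>\<^sub>F N in sequentially. h N < 1" by (rule order_tendstoD(2)[OF eta0]) simp
  ultimately have "\<forall>\<^sub>F N in sequentially. \<bar>\<mu>\<bar> * h N ^ 2 \<le> 2 \<and> \<bar>\<nu>\<bar> * h N ^ 2 \<le> 2 \<and> h N \<le> 1 \<and> 0 < N \<and> 4 * \<alpha> \<le> N"
    using eventually_gt_at_top[of 0] eventually_ge_at_top[of "4 * \<alpha>"] by eventually_elim auto
  \<comment> \<open>\<open>corr_sum_limit\<close> demands its hypotheses at every index, so the
    sequence is shifted past a threshold; \<open>LIMSEQ_offset\<close> undoes the shift at the
    end.\<close>
  then obtain N0 where N0: "\<And>N. N0 \<le> N \<Longrightarrow> \<bar>\<mu>\<bar> * h N ^ 2 \<le> 2 \<and> \<bar>\<nu>\<bar> * h N ^ 2 \<le> 2 \<and> h N \<le> 1 \<and> 0 < N \<and> 4 * \<alpha> \<le> N"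
    by (auto simp: eventually_sequentially)
  have "(\<lambda>n. \<Sum>d\<le>n + N0 - \<alpha>. h (n + N0) * summand (b - 3) \<alpha> (h (n + N0)) (n + N0) (X \<mu> (n + N0)) (X \<nu> (n + N0)) (n + N0 - \<alpha> - d) d)
      \<longlonglongrightarrow> exp (b - 3) * diff_airy_kernel \<mu> \<nu>"
  proof (rule corr_sum_limit)
    fix n
    have pos: "0 < n + N0" using N0[of "n + N0"] by simp
    show "0 < h (n + N0)" by (rule eta_pos[OF pos])
    show "real (n + N0) = 4 / h (n + N0) ^ 3" by (rule eta3[OF pos])
    show "X \<mu> (n + N0) = 16 / h (n + N0) ^ 3 + 4 * \<mu> / h (n + N0)"
      "X \<nu> (n + N0) = 16 / h (n + N0) ^ 3 + 4 * \<nu> / h (n + N0)"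
      by (rule X_eq[OF pos])+
    show "h (n + N0) \<le> 1" "4 * \<alpha> \<le> n + N0" "\<bar>\<mu>\<bar> * h (n + N0) ^ 2 \<le> 2" "\<bar>\<nu>\<bar> * h (n + N0) ^ 2 \<le> 2"
      using N0[of "n + N0"] by simp_all
  qed (rule LIMSEQ_ignore_initial_segment[OF eta0])
  then have lim: "(\<lambda>n. complex_of_real (\<Sum>d\<le>n + N0 - \<alpha>. h (n + N0) * summand (b - 3) \<alpha> (h (n + N0)) (n + N0) (X \<mu> (n + N0)) (X \<nu> (n + N0)) (n + N0 - \<alpha> - d) d))
      \<longlonglongrightarrow> complex_of_real (exp (b - 3) * diff_airy_kernel \<mu> \<nu>)"
    by (rule tendsto_of_real)
  have eq: "4 * complex_of_real (Z_factor \<alpha> N (2 powr (4 / 3) * \<mu>) (2 powr (4 / 3) * \<nu>))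
            * (corr2 Q N (N - \<alpha>) (complex_of_real (X \<mu> N)) (complex_of_real (X \<nu> N)) / (fact N * fact (N - \<alpha>)))
     = complex_of_real (\<Sum>d\<le>N - \<alpha>. h N * summand (b - 3) \<alpha> (h N) N (X \<mu> N) (X \<nu> N) (N - \<alpha> - d) d)" if "N0 \<le> N" for N
  proof -
    have N: "0 < N" "\<alpha> \<le> N" using N0[OF that] by auto
    have "corr2 Q N (N - \<alpha>) (complex_of_real (X \<mu> N)) (complex_of_real (X \<nu> N)) / (fact N * fact (N - \<alpha>)) = complex_of_real (corr_sum (b - 3) N (N - \<alpha>) (X \<mu> N) (X \<nu> N))"
      unfolding corr2_of_real[OF nd] by simp
    then have "4 * complex_of_real (Z_factor \<alpha> N (2 powr (4 / 3) * \<mu>) (2 powr (4 / 3) * \<nu>))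
            * (corr2 Q N (N - \<alpha>) (complex_of_real (X \<mu> N)) (complex_of_real (X \<nu> N)) / (fact N * fact (N - \<alpha>)))
      = complex_of_real (4 * ((X \<mu> N * X \<nu> N) powr (real \<alpha> / 2) * exp (- (X \<mu> N + X \<nu> N) / 2)) * corr_sum (b - 3) N (N - \<alpha>) (X \<mu> N) (X \<nu> N))"
      unfolding Z[OF N(1)] by simp
    then show ?thesis unfolding scaled_corr_sum[OF eta_pos[OF N(1)] N(2,1)] .
  qed
  show ?thesis
    by (rule LIMSEQ_offset[of _ N0]) (rule lim[folded eq[OF le_add2], unfolded X_def])
qed

end
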